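(* Let $K$ be a compact manifold and $M$ a manifold, and let $\mathrm{C}^{\infty}(K,M)$ be equipped with the functional diffeology. The following subsets of $\mathrm{C}^{\infty}(K,M)$ are D-open: (i) the set of diffeomorphisms $K\to M$; (ii) the set of étale maps (i.e., local diffeomorphisms) $K\to M$; (iii) the set of submersions $K\to M$; (iv) the set of immersions $K\to M$; (v) the set of embeddings $K\to M$; (vi) for any specified closed submanifold $N\subseteq M$, the set of smooth maps $K\to M$ transversal to $N$.
   Context: A manifold is a second-countable Hausdorff finite-dimensional smooth manifold (without boundary), regarded as a diffeological space with its standard diffeology. Submersion, immersion, embedding, transversality have their usual meaning in differential topology. Functional diffeology: a map $P:U\to \mathrm{C}^{\infty}(K,M)$ ($U$ open in some $\mathbb{R}^n$) is a plot iff $(u,x)\mapsto P(u)(x)$ is a smooth map $U\times K\to M$. D-topology: a subset $A$ of a diffeological space is D-open iff its preimage by every plot is open. *)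

theory Defs
  imports "HOL-Analysis.Analysis"
begin

text \<open>
  All dimensions are natural numbers (including 0): \<open>Euclidean_space n\<close> is the space \<open>\<real>\<^sup>n\<close>, realised
  as the functions \<open>nat \<Rightarrow> real\<close> that vanish at all indices \<open>\<ge> n\<close>.
\<close>

section \<open>Smooth maps between open subsets of Euclidean spaces\<close>

definition partial_deriv :: "nat \<Rightarrow> ((nat \<Rightarrow> real) \<Rightarrow> real) \<Rightarrow> (nat \<Rightarrow> real) \<Rightarrow> real" where
  "partial_deriv i f x = deriv (\<lambda>t. f (x(i := t))) (x i)"

definition has_partial_deriv :: "nat \<Rightarrow> ((nat \<Rightarrow> real) \<Rightarrow> real) \<Rightarrow> (nat \<Rightarrow> real) \<Rightarrow> bool" where
  "has_partial_deriv i f x \<longleftrightarrow> (\<lambda>t. f (x(i := t))) field_differentiable (at (x i))"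

text \<open>\<open>Ck_on m k U f\<close>: on the open set \<open>U\<close> of \<open>\<real>\<^sup>m\<close>, all iterated partial derivatives of \<open>f\<close> of order
  at most \<open>k\<close> exist and are continuous on \<open>U\<close>.\<close>

primrec Ck_on :: "nat \<Rightarrow> nat \<Rightarrow> (nat \<Rightarrow> real) set \<Rightarrow> ((nat \<Rightarrow> real) \<Rightarrow> real) \<Rightarrow> bool" where
  "Ck_on m 0 U f \<longleftrightarrow> continuous_map (subtopology (Euclidean_space m) U) euclideanreal f"
| "Ck_on m (Suc k) U f \<longleftrightarrow>
     continuous_map (subtopology (Euclidean_space m) U) euclideanreal f \<and>
     (\<forall>i<m. (\<forall>x\<in>U. has_partial_deriv i f x) \<and> Ck_on m k U (partial_deriv i f))"

definition euclidean_smooth_on ::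
  "nat \<Rightarrow> nat \<Rightarrow> (nat \<Rightarrow> real) set \<Rightarrow> ((nat \<Rightarrow> real) \<Rightarrow> nat \<Rightarrow> real) \<Rightarrow> bool" where
  "euclidean_smooth_on m n U f \<longleftrightarrow>
     openin (Euclidean_space m) U \<and> f \<in> U \<rightarrow> topspace (Euclidean_space n) \<and>
     (\<forall>j<n. \<forall>k. Ck_on m k U (\<lambda>x. f x j))"

text \<open>The total derivative of \<open>f\<close> at \<open>x\<close> applied to the vector \<open>v\<close> (Jacobian matrix times vector).\<close>

definition jacobian_apply ::
  "nat \<Rightarrow> nat \<Rightarrow> ((nat \<Rightarrow> real) \<Rightarrow> nat \<Rightarrow> real) \<Rightarrow> (nat \<Rightarrow> real) \<Rightarrow> (nat \<Rightarrow> real) \<Rightarrow> nat \<Rightarrow> real" where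
  "jacobian_apply m n f x v =
     (\<lambda>j. if j < n then \<Sum>i<m. partial_deriv i (\<lambda>y. f y j) x * v i else 0)"

section \<open>Smooth manifolds\<close>

datatype 'a chart = Chart (chart_dim: nat) (chart_dom: "'a set") (chart_map: "'a \<Rightarrow> nat \<Rightarrow> real")

text \<open>A topological space with an atlas; see \<open>smooth_manifold\<close> for the axioms. The atlas need not be
  maximal, and dimensions may differ between connected components.\<close>

datatype 'a manifold = Manifold (mtop: "'a topology") (matlas: "'a chart set")

abbreviation mcarrier :: "'a manifold \<Rightarrow> 'a set" where
  "mcarrier M \<equiv> topspace (mtop M)"

definition is_chart :: "'a topology \<Rightarrow> 'a chart \<Rightarrow> bool" where
  "is_chart X c \<longleftrightarrow>
     openin X (chart_dom c) \<and>
     openin (Euclidean_space (chart_dim c)) (chart_map c ` chart_dom c) \<and>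
     homeomorphic_map (subtopology X (chart_dom c))
       (subtopology (Euclidean_space (chart_dim c)) (chart_map c ` chart_dom c)) (chart_map c)"

text \<open>The expression of \<open>f\<close> in the charts \<open>c\<close> (source) and \<open>d\<close> (target), and its domain.\<close>

definition coord_rep :: "'a chart \<Rightarrow> 'b chart \<Rightarrow> ('a \<Rightarrow> 'b) \<Rightarrow> (nat \<Rightarrow> real) \<Rightarrow> nat \<Rightarrow> real" where
  "coord_rep c d f = chart_map d \<circ> f \<circ> inv_into (chart_dom c) (chart_map c)"

definition coord_dom :: "'a chart \<Rightarrow> 'b chart \<Rightarrow> ('a \<Rightarrow> 'b) \<Rightarrow> (nat \<Rightarrow> real) set" where
  "coord_dom c d f = chart_map c ` {x \<in> chart_dom c. f x \<in> chart_dom d}"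

definition smooth_in_charts :: "'a chart \<Rightarrow> 'b chart \<Rightarrow> ('a \<Rightarrow> 'b) \<Rightarrow> bool" where
  "smooth_in_charts c d f \<longleftrightarrow>
     euclidean_smooth_on (chart_dim c) (chart_dim d) (coord_dom c d f) (coord_rep c d f)"

definition smooth_manifold :: "'a manifold \<Rightarrow> bool" where
  "smooth_manifold M \<longleftrightarrow>
     Hausdorff_space (mtop M) \<and> second_countable (mtop M) \<and>
     (\<forall>c\<in>matlas M. is_chart (mtop M) c) \<and>
     (\<Union>c\<in>matlas M. chart_dom c) = mcarrier M \<and>
     (\<forall>c\<in>matlas M. \<forall>d\<in>matlas M. smooth_in_charts c d (\<lambda>x. x))"

definition smooth_map :: "'a manifold \<Rightarrow> 'b manifold \<Rightarrow> ('a \<Rightarrow> 'b) \<Rightarrow> bool" where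
  "smooth_map M N f \<longleftrightarrow>
     continuous_map (mtop M) (mtop N) f \<and>
     (\<forall>c\<in>matlas M. \<forall>d\<in>matlas N. smooth_in_charts c d f)"

definition diffeomorphism :: "'a manifold \<Rightarrow> 'b manifold \<Rightarrow> ('a \<Rightarrow> 'b) \<Rightarrow> bool" where
  "diffeomorphism M N f \<longleftrightarrow>
     smooth_map M N f \<and>
     (\<exists>g. smooth_map N M g \<and> (\<forall>x\<in>mcarrier M. g (f x) = x) \<and> (\<forall>y\<in>mcarrier N. f (g y) = y))"

definition open_submanifold :: "'a manifold \<Rightarrow> 'a set \<Rightarrow> 'a manifold" where
  "open_submanifold M W =
     Manifold (subtopology (mtop M) W)
       ((\<lambda>c. Chart (chart_dim c) (chart_dom c \<inter> W) (chart_map c)) ` matlas M)"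

definition euclidean_open_manifold :: "nat \<Rightarrow> (nat \<Rightarrow> real) set \<Rightarrow> (nat \<Rightarrow> real) manifold" where
  "euclidean_open_manifold n U =
     Manifold (subtopology (Euclidean_space n) U) {Chart n U (\<lambda>x. x)}"

definition prod_chart :: "'a chart \<Rightarrow> 'b chart \<Rightarrow> ('a \<times> 'b) chart" where
  "prod_chart c d =
     Chart (chart_dim c + chart_dim d) (chart_dom c \<times> chart_dom d)
       (\<lambda>(x, y) i. if i < chart_dim c then chart_map c x i else chart_map d y (i - chart_dim c))"

definition prod_manifold :: "'a manifold \<Rightarrow> 'b manifold \<Rightarrow> ('a \<times> 'b) manifold" where
  "prod_manifold M N =
     Manifold (prod_topology (mtop M) (mtop N))
       {prod_chart c d | c d. c \<in> matlas M \<and> d \<in> matlas N}"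

section \<open>Tangent spaces and differentials\<close>

definition charts_at :: "'a manifold \<Rightarrow> 'a \<Rightarrow> 'a chart set" where
  "charts_at M p = {c \<in> matlas M. p \<in> chart_dom c}"

definition diff_in_charts ::
  "'a chart \<Rightarrow> 'b chart \<Rightarrow> ('a \<Rightarrow> 'b) \<Rightarrow> 'a \<Rightarrow> (nat \<Rightarrow> real) \<Rightarrow> nat \<Rightarrow> real" where
  "diff_in_charts c d f p =
     jacobian_apply (chart_dim c) (chart_dim d) (coord_rep c d f) (chart_map c p)"

text \<open>A tangent vector at \<open>p\<close> is the family of its coordinate vectors in the charts around \<open>p\<close>, which
  transform into each other by the derivatives of the changes of charts. The value at any other
  chart is fixed to be 0, so that equality and addition of tangent vectors are those of functions.\<close>

type_synonym 'a tangent = "'a chart \<Rightarrow> nat \<Rightarrow> real"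

definition tangent_space :: "'a manifold \<Rightarrow> 'a \<Rightarrow> 'a tangent set" where
  "tangent_space M p =
     {v. (\<forall>c. c \<notin> charts_at M p \<longrightarrow> v c = (\<lambda>i. 0)) \<and>
         (\<forall>c\<in>charts_at M p. v c \<in> topspace (Euclidean_space (chart_dim c))) \<and>
         (\<forall>c\<in>charts_at M p. \<forall>d\<in>charts_at M p. v d = diff_in_charts c d (\<lambda>x. x) p (v c))}"

definition tangent_add :: "'a tangent \<Rightarrow> 'a tangent \<Rightarrow> 'a tangent" where
  "tangent_add v w = (\<lambda>c i. v c i + w c i)"

text \<open>For smooth \<open>f\<close> and \<open>v \<in> tangent_space M p\<close> this does not depend on the selected chart, by the
  chain rule.\<close>

definition differential :: "'a manifold \<Rightarrow> 'b manifold \<Rightarrow> ('a \<Rightarrow> 'b) \<Rightarrow> 'a \<Rightarrow> 'a tangent \<Rightarrow> 'b tangent" where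
  "differential M N f p v =
     (let c = (SOME c. c \<in> charts_at M p)
      in (\<lambda>d. if d \<in> charts_at N (f p) then diff_in_charts c d f p (v c) else (\<lambda>i. 0)))"

definition etale_map :: "'a manifold \<Rightarrow> 'b manifold \<Rightarrow> ('a \<Rightarrow> 'b) \<Rightarrow> bool" where
  "etale_map M N f \<longleftrightarrow>
     smooth_map M N f \<and>
     (\<forall>p\<in>mcarrier M. \<exists>W. openin (mtop M) W \<and> p \<in> W \<and> openin (mtop N) (f ` W) \<and>
        diffeomorphism (open_submanifold M W) (open_submanifold N (f ` W)) f)"

definition submersion :: "'a manifold \<Rightarrow> 'b manifold \<Rightarrow> ('a \<Rightarrow> 'b) \<Rightarrow> bool" where
  "submersion M N f \<longleftrightarrow>
     smooth_map M N f \<and>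
     (\<forall>p\<in>mcarrier M. differential M N f p ` tangent_space M p = tangent_space N (f p))"

definition immersion :: "'a manifold \<Rightarrow> 'b manifold \<Rightarrow> ('a \<Rightarrow> 'b) \<Rightarrow> bool" where
  "immersion M N f \<longleftrightarrow>
     smooth_map M N f \<and>
     (\<forall>p\<in>mcarrier M. inj_on (differential M N f p) (tangent_space M p))"

definition embedding :: "'a manifold \<Rightarrow> 'b manifold \<Rightarrow> ('a \<Rightarrow> 'b) \<Rightarrow> bool" where
  "embedding M N f \<longleftrightarrow> immersion M N f \<and> embedding_map (mtop M) (mtop N) f"

definition closed_submanifold :: "'a manifold \<Rightarrow> 'a manifold \<Rightarrow> bool" where
  "closed_submanifold N M \<longleftrightarrow>
     smooth_manifold N \<and> closedin (mtop M) (mcarrier N) \<and> embedding N M (\<lambda>x. x)"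

definition transversal :: "'a manifold \<Rightarrow> 'b manifold \<Rightarrow> 'b manifold \<Rightarrow> ('a \<Rightarrow> 'b) \<Rightarrow> bool" where
  "transversal K M N f \<longleftrightarrow>
     (\<forall>x\<in>mcarrier K. f x \<in> mcarrier N \<longrightarrow>
        {tangent_add (differential K M f x v) (differential N M (\<lambda>y. y) (f x) w) | v w.
           v \<in> tangent_space K x \<and> w \<in> tangent_space N (f x)}
        = tangent_space M (f x))"

section \<open>The functional diffeology and the D-topology\<close>

text \<open>The set \<open>C\<^sup>\<infinity>(K, M)\<close>; since HOL functions are total, a map on \<open>K\<close> is represented by the function
  that is \<open>undefined\<close> outside \<open>K\<close>.\<close>

definition smooth_maps :: "'a manifold \<Rightarrow> 'b manifold \<Rightarrow> ('a \<Rightarrow> 'b) set" where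
  "smooth_maps K M = {f \<in> extensional (mcarrier K). smooth_map K M f}"

text \<open>A diffeology is given by its set of plots; \<open>(n, U, P)\<close> stands for the plot \<open>P\<close> with domain the
  open set \<open>U\<close> of \<open>\<real>\<^sup>n\<close>.\<close>

type_synonym 'x plot = "nat \<times> (nat \<Rightarrow> real) set \<times> ((nat \<Rightarrow> real) \<Rightarrow> 'x)"

definition functional_diffeology :: "'a manifold \<Rightarrow> 'b manifold \<Rightarrow> ('a \<Rightarrow> 'b) plot set" where
  "functional_diffeology K M =
     {(n, U, P). openin (Euclidean_space n) U \<and> P \<in> U \<rightarrow> smooth_maps K M \<and>
        smooth_map (prod_manifold (euclidean_open_manifold n U) K) M (\<lambda>(u, x). P u x)}"

definition D_open :: "'x set \<Rightarrow> 'x plot set \<Rightarrow> 'x set \<Rightarrow> bool" where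
  "D_open X \<D> A \<longleftrightarrow>
     A \<subseteq> X \<and> (\<forall>(n, U, P)\<in>\<D>. openin (Euclidean_space n) {u \<in> U. P u \<in> A})"

end

theory Submission
  imports Defs "Jordan_Normal_Form.Determinant" "HOL-Homology.Invariance_of_Domain"
begin

text \<open>
  Along a plot \<open>P\<close> the Jacobian of \<open>P u\<close> at \<open>x\<close> in fixed charts depends continuously on \<open>(u, x)\<close>, and
  injectivity and surjectivity of a matrix are open conditions, being the non-vanishing of a Gram
  determinant. So each pointwise differential condition holds on an open set of pairs \<open>(u, x)\<close>, and the
  tube lemma for the compact \<open>K\<close> makes it open in \<open>u\<close>; this settles immersions and submersions.
  For transversality the Jacobian of the inclusion of \<open>N\<close> is appended to that of \<open>P u\<close>, and the points
  sent outside the closed set \<open>N\<close> are harmless. By the inverse function theorem etale maps are the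
  immersive submersions; it is obtained from secant matrices (mean value theorem, one matrix entry at a
  time), which give local injectivity and the derivative of the inverse, and from invariance of domain.
  The same secant matrices, with the parameter \<open>u\<close> kept fixed, show that an injective immersion stays
  injective on a neighbourhood of \<open>u\<close> (applying the tube lemma to \<open>K \<times> K\<close>), whence embeddings.
  A diffeomorphism is a bijective etale map, and surjectivity persists because the image of an etale map
  on a compact manifold is open and closed.
\<close>

text \<open>Dimensions may differ between components, so the sizes of Jacobians are values and not
  types: matrices are functions of two indices with sizes given separately, and points of R^m are
  functions \<open>nat \<Rightarrow> real\<close> that vanish from m on. Smoothness is given by
  iterated partial derivatives alone. Secant matrices take the place of a total derivative: they
  give an exact equation for an increment, and they tend to the Jacobian when both end points tend
  to one point. Three conditions are not pointwise on \<open>K\<close> as they stand. Injectivity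
  concerns pairs, and its critical case is the diagonal, where local injectivity uniform in the
  parameter is required. Surjectivity is a statement about \<open>M\<close>; it becomes one about
  \<open>K\<close> by asking that the image of \<open>P w\<close> contain \<open>P u y\<close> for
  all \<open>y\<close> in \<open>K\<close>. Transversality involves a Jacobian that exists only over
  points sent into \<open>N\<close>, so openness is first obtained relative to a set that need not
  be open. In each case the condition is brought to an open set of \<open>U \<times> K\<close> or
  \<open>U \<times> (K \<times> K)\<close>, where compactness applies.\<close>

no_notation Exact_Sequence.exact_seq_arrow (\<open>(\<open>indent=3 notation=\<open>mixfix exact_seq\<close>\<close>_ / \<longlongrightarrow>\<index> _)\<close> [1000, 60])

section \<open>Linear algebra with matrices of variable size\<close>

definition mat_inj :: "nat \<Rightarrow> nat \<Rightarrow> (nat \<Rightarrow> nat \<Rightarrow> real) \<Rightarrow> bool" where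
  "mat_inj m k A \<longleftrightarrow> (\<forall>v. (\<forall>j<m. (\<Sum>i<k. A j i * v i) = 0) \<longrightarrow> (\<forall>i<k. v i = 0))"

definition mat_surj :: "nat \<Rightarrow> nat \<Rightarrow> (nat \<Rightarrow> nat \<Rightarrow> real) \<Rightarrow> bool" where
  "mat_surj m k A \<longleftrightarrow> (\<forall>w. \<exists>v. \<forall>j<m. (\<Sum>i<k. A j i * v i) = w j)"

text \<open>The Leibniz formula written out: as a sum of products of entries it visibly inherits
  limits, continuity and differentiability from the entries of a matrix that depends on a
  parameter.\<close>

definition fdet :: "nat \<Rightarrow> (nat \<Rightarrow> nat \<Rightarrow> real) \<Rightarrow> real" where
  "fdet n A = (\<Sum>p | p permutes {0..<n}. signof p * (\<Prod>i = 0..<n. A i (p i)))"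

text \<open>The adjugate: entry (i, j) is the cofactor at (j, i), and the two conditionals skip row
  j and column i. Being built from \<open>fdet\<close>, it too depends polynomially on the
  entries.\<close>

definition fadj :: "nat \<Rightarrow> (nat \<Rightarrow> nat \<Rightarrow> real) \<Rightarrow> nat \<Rightarrow> nat \<Rightarrow> real" where
  "fadj n A i j = (-1) ^ (i + j) *
     fdet (n - 1) (\<lambda>a b. A (if a < j then a else Suc a) (if b < i then b else Suc b))"

text \<open>Cramer's rule. For a singular matrix the value is 0 by the convention for
  \<open>inverse\<close> and carries no meaning.\<close>

definition finv :: "nat \<Rightarrow> (nat \<Rightarrow> nat \<Rightarrow> real) \<Rightarrow> nat \<Rightarrow> nat \<Rightarrow> real" where
  "finv n A i j = fadj n A i j * inverse (fdet n A)"

lemma fdet_eq_det: "fdet n A = Determinant.det (Matrix.mat n n (\<lambda>(i, j). A i j))"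
proof -
  have "(\<Prod>i = 0..<n. A i (p i)) = (\<Prod>i = 0..<n. Matrix.mat n n (\<lambda>(i, j). A i j) $$ (i, p i))"
    if "p permutes {0..<n}" for p
    by (rule prod.cong) (use permutes_in_image[OF that] in auto)
  then show ?thesis
    by (simp add: fdet_def Determinant.det_def)
qed

lemma fadj_eq_adj_mat:
  assumes "i < n" "j < n"
  shows "fadj n A i j = adj_mat (Matrix.mat n n (\<lambda>(i, j). A i j)) $$ (i, j)"
proof -
  have eq: "mat_delete (Matrix.mat n n (\<lambda>(i, j). A i j)) j i =
      Matrix.mat (n - 1) (n - 1) (\<lambda>(a, b). A (if a < j then a else Suc a) (if b < i then b else Suc b))"
    by (rule eq_matI) (use assms in \<open>auto simp: mat_delete_def\<close>)
  show ?thesis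
    using assms unfolding adj_mat_def fadj_def fdet_eq_det
    by (simp add: cofactor_def eq add.commute)
qed

lemma fdet_nonzero_iff: "fdet n A \<noteq> 0 \<longleftrightarrow> mat_inj n n A"
proof -
  let ?A = "Matrix.mat n n (\<lambda>(i, j). A i j)"
  have mv: "(?A *\<^sub>v v = 0\<^sub>v n) \<longleftrightarrow> (\<forall>j<n. (\<Sum>i<n. A j i * vec_index v i) = 0)" if "v \<in> carrier_vec n" for v
  proof -
    have "vec_index (?A *\<^sub>v v) j = (\<Sum>i<n. A j i * vec_index v i)" if "j < n" for j
      using that \<open>v \<in> carrier_vec n\<close> by (auto simp: scalar_prod_def lessThan_atLeast0 intro!: sum.cong)
    then show ?thesis
      by (auto simp: vec_eq_iff)
  qed
  have "fdet n A = 0 \<longleftrightarrow> (\<exists>v. v \<in> carrier_vec n \<and> v \<noteq> 0\<^sub>v n \<and> ?A *\<^sub>v v = 0\<^sub>v n)"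
    unfolding fdet_eq_det by (rule det_0_iff_vec_prod_zero) auto
  also have "\<dots> \<longleftrightarrow> \<not> mat_inj n n A"
  proof
    assume "\<exists>v. v \<in> carrier_vec n \<and> v \<noteq> 0\<^sub>v n \<and> ?A *\<^sub>v v = 0\<^sub>v n"
    then obtain v where v: "v \<in> carrier_vec n" "v \<noteq> 0\<^sub>v n" "\<forall>j<n. (\<Sum>i<n. A j i * vec_index v i) = 0"
      using mv by blast
    moreover from v(1,2) have "\<exists>i<n. vec_index v i \<noteq> 0"
      by (auto simp: vec_eq_iff)
    ultimately show "\<not> mat_inj n n A"
      unfolding mat_inj_def by blast
  next
    assume "\<not> mat_inj n n A"
    then obtain v i where v: "\<forall>j<n. (\<Sum>i<n. A j i * v i) = 0" "i < n" "v i \<noteq> 0"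
      unfolding mat_inj_def by blast
    define w where "w = Matrix.vec n v"
    have "w \<in> carrier_vec n" "w \<noteq> 0\<^sub>v n"
      using v by (auto simp: w_def vec_eq_iff)
    moreover have "?A *\<^sub>v w = 0\<^sub>v n"
      using v mv[OF \<open>w \<in> carrier_vec n\<close>] by (simp add: w_def)
    ultimately show "\<exists>v. v \<in> carrier_vec n \<and> v \<noteq> 0\<^sub>v n \<and> ?A *\<^sub>v v = 0\<^sub>v n"
      by blast
  qed
  finally show ?thesis by blast
qed

lemma finv_left:
  assumes "mat_inj n n A" "i < n" "j < n"
  shows "(\<Sum>l<n. finv n A i l * A l j) = (if i = j then 1 else 0)"
proof -
  let ?A = "Matrix.mat n n (\<lambda>(i, j). A i j)"
  have carr: "?A \<in> carrier_mat n n" by simp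
  have "(\<Sum>l<n. fadj n A i l * A l j) = (adj_mat ?A * ?A) $$ (i, j)"
    using assms adj_mat(1)[OF carr]
    by (auto simp: scalar_prod_def lessThan_atLeast0 fadj_eq_adj_mat intro!: sum.cong)
  also have "\<dots> = (if i = j then fdet n A else 0)"
    using assms by (simp add: adj_mat(3)[OF carr] fdet_eq_det)
  finally have "(\<Sum>l<n. fadj n A i l * A l j) = (if i = j then fdet n A else 0)" .
  moreover have "(\<Sum>l<n. finv n A i l * A l j) = inverse (fdet n A) * (\<Sum>l<n. fadj n A i l * A l j)"
    by (simp add: finv_def sum_distrib_left mult_ac)
  ultimately show ?thesis
    using assms fdet_nonzero_iff by auto
qed

lemma finv_right:
  assumes "mat_inj n n A" "i < n" "j < n"
  shows "(\<Sum>l<n. A i l * finv n A l j) = (if i = j then 1 else 0)"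
proof -
  let ?A = "Matrix.mat n n (\<lambda>(i, j). A i j)"
  have carr: "?A \<in> carrier_mat n n" by simp
  have "(\<Sum>l<n. A i l * fadj n A l j) = (?A * adj_mat ?A) $$ (i, j)"
    using assms adj_mat(1)[OF carr]
    by (auto simp: scalar_prod_def lessThan_atLeast0 fadj_eq_adj_mat intro!: sum.cong)
  also have "\<dots> = (if i = j then fdet n A else 0)"
    using assms by (simp add: adj_mat(2)[OF carr] fdet_eq_det)
  finally have "(\<Sum>l<n. A i l * fadj n A l j) = (if i = j then fdet n A else 0)" .
  moreover have "(\<Sum>l<n. A i l * finv n A l j) = inverse (fdet n A) * (\<Sum>l<n. A i l * fadj n A l j)"
    by (simp add: finv_def sum_distrib_left mult_ac)
  ultimately show ?thesis
    using assms fdet_nonzero_iff by auto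
qed

lemma sum_finv_solve:
  assumes "mat_inj n n A" "i < n"
  shows "(\<Sum>l<n. finv n A i l * (\<Sum>j<n. A l j * v j)) = v i"
proof -
  have "(\<Sum>l<n. finv n A i l * (\<Sum>j<n. A l j * v j)) = (\<Sum>j<n. (\<Sum>l<n. finv n A i l * A l j) * v j)"
    by (simp add: sum_distrib_left sum_distrib_right mult.assoc) (rule sum.swap)
  also have "\<dots> = (\<Sum>j<n. if j = i then v i else 0)"
    using assms by (intro sum.cong) (auto simp: finv_left)
  finally show ?thesis
    using assms by simp
qed

lemma sum_solve_finv:
  assumes "mat_inj n n A" "i < n"
  shows "(\<Sum>l<n. A i l * (\<Sum>j<n. finv n A l j * w j)) = w i"
proof -
  have "(\<Sum>l<n. A i l * (\<Sum>j<n. finv n A l j * w j)) = (\<Sum>j<n. (\<Sum>l<n. A i l * finv n A l j) * w j)"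
    by (simp add: sum_distrib_left sum_distrib_right mult.assoc) (rule sum.swap)
  also have "\<dots> = (\<Sum>j<n. if j = i then w i else 0)"
    using assms by (intro sum.cong) (auto simp: finv_right)
  finally show ?thesis
    using assms by simp
qed

section \<open>Gram matrices, and the shape of injective and surjective matrices\<close>

definition gram :: "nat \<Rightarrow> (nat \<Rightarrow> nat \<Rightarrow> real) \<Rightarrow> nat \<Rightarrow> nat \<Rightarrow> real" where
  "gram m A = (\<lambda>i i'. \<Sum>j<m. A j i * A j i')"

lemma gram_apply: "(\<Sum>i'<k. gram m A i i' * v i') = (\<Sum>j<m. A j i * (\<Sum>i'<k. A j i' * v i'))"
  unfolding gram_def by (simp add: sum_distrib_left sum_distrib_right mult.assoc) (rule sum.swap)

text \<open>v^T (A^T A) v is the squared norm of A v, so A^T A and A have the same kernel.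
  Injectivity of a rectangular matrix thereby becomes the non-vanishing of one determinant.\<close>

lemma mat_inj_gram_iff: "mat_inj k k (gram m A) \<longleftrightarrow> mat_inj m k A"
proof
  assume "mat_inj k k (gram m A)"
  then show "mat_inj m k A"
    unfolding mat_inj_def gram_apply by simp
next
  assume inj: "mat_inj m k A"
  have "\<forall>j<m. (\<Sum>i'<k. A j i' * v i') = 0"
    if "\<forall>i<k. (\<Sum>i'<k. gram m A i i' * v i') = 0" for v
  proof -
    have "(\<Sum>j<m. (\<Sum>i<k. A j i * v i)\<^sup>2) = (\<Sum>j<m. \<Sum>i<k. v i * (A j i * (\<Sum>i'<k. A j i' * v i')))"
      by (simp add: power2_eq_square sum_distrib_right mult_ac)
    also have "\<dots> = (\<Sum>i<k. \<Sum>j<m. v i * (A j i * (\<Sum>i'<k. A j i' * v i')))"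
      by (rule sum.swap)
    also have "\<dots> = (\<Sum>i<k. v i * (\<Sum>i'<k. gram m A i i' * v i'))"
      by (simp add: gram_apply sum_distrib_left)
    also have "\<dots> = 0"
      using that by simp
    finally show ?thesis
      by (subst (asm) sum_nonneg_eq_0_iff) auto
  qed
  with inj show "mat_inj k k (gram m A)"
    unfolding mat_inj_def by blast
qed

text \<open>A vector in the kernel of the transpose is orthogonal to the image of A; if A is onto,
  it is orthogonal to itself. Conversely, injectivity of the transpose makes A A^T invertible, and
  A^T (A A^T)^(-1) is a right inverse of A.\<close>

lemma mat_surj_iff_transpose_inj: "mat_surj m k A \<longleftrightarrow> mat_inj k m (\<lambda>i j. A j i)"
proof
  assume surj: "mat_surj m k A"
  show "mat_inj k m (\<lambda>i j. A j i)"
    unfolding mat_inj_def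
  proof (intro allI impI)
    fix w j assume w: "\<forall>i<k. (\<Sum>j<m. A j i * w j) = 0" and j: "j < m"
    obtain v where v: "\<forall>j<m. (\<Sum>i<k. A j i * v i) = w j"
      using surj unfolding mat_surj_def by blast
    have "(\<Sum>j<m. (w j)\<^sup>2) = (\<Sum>j<m. w j * (\<Sum>i<k. A j i * v i))"
      using v by (simp add: power2_eq_square)
    also have "\<dots> = (\<Sum>i<k. v i * (\<Sum>j<m. A j i * w j))"
      by (simp add: sum_distrib_left mult_ac) (rule sum.swap)
    also have "\<dots> = 0"
      using w by simp
    finally show "w j = 0"
      using j by (subst (asm) sum_nonneg_eq_0_iff) auto
  qed
next
  assume "mat_inj k m (\<lambda>i j. A j i)"
  then have inj: "mat_inj m m (gram k (\<lambda>i j. A j i))"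
    by (simp add: mat_inj_gram_iff)
  show "mat_surj m k A"
    unfolding mat_surj_def
  proof
    fix w
    define u where "u j = (\<Sum>l<m. finv m (gram k (\<lambda>i j. A j i)) j l * w l)" for j
    have "(\<Sum>i<k. A j i * (\<Sum>l<m. A l i * u l)) = w j" if "j < m" for j
      using sum_solve_finv[OF inj that, of w] unfolding gram_apply u_def .
    then show "\<exists>v. \<forall>j<m. (\<Sum>i<k. A j i * v i) = w j"
      by (intro exI[of _ "\<lambda>i. \<Sum>l<m. A l i * u l"]) auto
  qed
qed

text \<open>With fewer rows than columns, zero rows can be added to make the matrix square without
  enlarging its kernel, and then the determinant vanishes.\<close>

lemma mat_inj_imp_le:
  assumes "mat_inj m k A"
  shows "k \<le> m"
proof (rule ccontr)
  assume "\<not> k \<le> m"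
  then have mk: "m < k" by simp
  define B where "B = (\<lambda>j i. if j < m then A j i else 0)"
  have "mat_inj k k B"
    unfolding mat_inj_def
  proof (intro allI impI)
    fix v i assume v: "\<forall>j<k. (\<Sum>i<k. B j i * v i) = 0" and "i < k"
    have "(\<Sum>i<k. A j i * v i) = 0" if "j < m" for j
      using v[rule_format, of j] that mk by (simp add: B_def)
    then show "v i = 0"
      using assms \<open>i < k\<close> unfolding mat_inj_def by blast
  qed
  moreover have "fdet k B = 0"
    unfolding fdet_def
  proof (rule sum.neutral, intro ballI)
    fix p
    \<comment> \<open>Since \<open>m < k\<close>, row \<open>m\<close> is one of the added rows and
      puts a zero factor into every term of the Leibniz formula.\<close>
    have "(\<Prod>i = 0..<k. B i (p i)) = 0"
      by (rule prod_zero) (use mk in \<open>auto simp: B_def intro!: bexI[of _ m]\<close>)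
    then show "signof p * (\<Prod>i = 0..<k. B i (p i)) = 0" by simp
  qed
  ultimately show False
    using fdet_nonzero_iff by blast
qed

text \<open>This is how charts related by a map with bijective differential are known to have equal
  dimensions, which invariance of domain and matrix inversion both presuppose.\<close>

lemma mat_bij_imp_eq:
  assumes "mat_inj m k A" "mat_surj m k A"
  shows "k = m"
  using assms mat_inj_imp_le mat_surj_iff_transpose_inj by (metis le_antisym)

section \<open>Matrices depending on a parameter\<close>

lemma tendsto_fdet:
  assumes "\<And>i j. i < n \<Longrightarrow> j < n \<Longrightarrow> ((\<lambda>t. A t i j) \<longlongrightarrow> B i j) F"
  shows "((\<lambda>t. fdet n (A t)) \<longlongrightarrow> fdet n B) F"
  unfolding fdet_def
proof (intro tendsto_intros)
  fix p i assume "p \<in> {p. p permutes {0..<n}}" "i \<in> {0..<n}"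
  then show "((\<lambda>t. A t i (p i)) \<longlongrightarrow> B i (p i)) F"
    using permutes_in_image[of p "{0..<n}" i] by (intro assms) auto
qed

lemma tendsto_finv:
  assumes "\<And>i j. i < n \<Longrightarrow> j < n \<Longrightarrow> ((\<lambda>t. A t i j) \<longlongrightarrow> B i j) F"
    and "mat_inj n n B" "i < n" "j < n"
  shows "((\<lambda>t. finv n (A t) i j) \<longlongrightarrow> finv n B i j) F"
  unfolding finv_def fadj_def using assms(2-)
  by (intro tendsto_intros tendsto_fdet assms(1)) (auto simp: fdet_nonzero_iff)

text \<open>The version along filters serves secant matrices, which depend on a choice and come with
  a limit but without continuity; the topological version below serves Jacobians.\<close>

lemma eventually_mat_inj:
  assumes "\<And>j i. j < m \<Longrightarrow> i < k \<Longrightarrow> ((\<lambda>t. A t j i) \<longlongrightarrow> B j i) F"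
    and "mat_inj m k B"
  shows "eventually (\<lambda>t. mat_inj m k (A t)) F"
proof -
  have "((\<lambda>t. fdet k (gram m (A t))) \<longlongrightarrow> fdet k (gram m B)) F"
    unfolding gram_def by (intro tendsto_fdet tendsto_intros assms(1)) auto
  then have "eventually (\<lambda>t. fdet k (gram m (A t)) \<noteq> 0) F"
    by (rule tendsto_imp_eventually_ne) (use assms(2) in \<open>simp add: fdet_nonzero_iff mat_inj_gram_iff\<close>)
  then show ?thesis
    by (simp add: fdet_nonzero_iff mat_inj_gram_iff)
qed

lemma openin_mat_inj:
  assumes "\<And>j i. j < m \<Longrightarrow> i < k \<Longrightarrow> continuous_map X euclideanreal (\<lambda>x. A x j i)"
  shows "openin X {x \<in> topspace X. mat_inj m k (A x)}"
proof -
  have "continuous_map X euclideanreal (\<lambda>x. fdet k (gram m (A x)))"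
    unfolding fdet_def gram_def
  proof (intro continuous_map_sum continuous_map_real_mult continuous_map_prod)
    fix p i j assume "p \<in> {p. p permutes {0..<k}}" "i \<in> {0..<k}" "j \<in> {..<m}"
    then show "continuous_map X euclideanreal (\<lambda>x. A x j i)"
      "continuous_map X euclideanreal (\<lambda>x. A x j (p i))"
      using permutes_in_image[of p "{0..<k}" i] by (auto intro!: assms)
  qed (auto simp: finite_permutations)
  then have "openin X {x \<in> topspace X. fdet k (gram m (A x)) \<in> - {0}}"
    by (rule openin_continuous_map_preimage) auto
  then show ?thesis
    by (simp add: fdet_nonzero_iff mat_inj_gram_iff)
qed

lemma openin_mat_surj:
  assumes "\<And>j i. j < m \<Longrightarrow> i < k \<Longrightarrow> continuous_map X euclideanreal (\<lambda>x. A x j i)"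
  shows "openin X {x \<in> topspace X. mat_surj m k (A x)}"
  unfolding mat_surj_iff_transpose_inj by (rule openin_mat_inj) (use assms in auto)

section \<open>Calculus on open subsets of Euclidean spaces\<close>

text \<open>Gives access to \<open>continuous_on\<close>, \<open>open\<close> and limits in the
  function type: its topology is the product topology, of which \<open>Euclidean_space n\<close> is
  a subspace.\<close>

lemma Euclidean_space_eq_top_of_set:
  "Euclidean_space n = top_of_set (topspace (Euclidean_space n))"
  by (simp add: Euclidean_space_def euclidean_product_topology)

lemma subtopology_Euclidean_space_eq_top_of_set:
  assumes "U \<subseteq> topspace (Euclidean_space m)"
  shows "subtopology (Euclidean_space m) U = top_of_set U"
  using assms
  by (subst Euclidean_space_eq_top_of_set) (simp add: subtopology_subtopology inf.absorb2)

lemma continuous_map_Euclidean_subtopology_iff: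
  fixes f :: "(nat \<Rightarrow> real) \<Rightarrow> 'b::topological_space"
  assumes "U \<subseteq> topspace (Euclidean_space m)"
  shows "continuous_map (subtopology (Euclidean_space m) U) euclidean f \<longleftrightarrow> continuous_on U f"
  by (simp add: subtopology_Euclidean_space_eq_top_of_set[OF assms])

lemma tendsto_fun_iff:
  fixes f :: "'t \<Rightarrow> 'i \<Rightarrow> 'b::topological_space"
  shows "(f \<longlongrightarrow> l) F \<longleftrightarrow> (\<forall>i. ((\<lambda>t. f t i) \<longlongrightarrow> l i) F)"
  using limitin_componentwise[of "\<lambda>_. euclidean" UNIV f l F]
  by (simp add: euclidean_product_topology)

lemma openin_Euclidean_box:
  assumes "openin (Euclidean_space m) U" "a \<in> U"
  obtains e where "e > 0"
    "\<And>z. z \<in> topspace (Euclidean_space m) \<Longrightarrow> (\<And>i. i < m \<Longrightarrow> \<bar>z i - a i\<bar> < e) \<Longrightarrow> z \<in> U"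
proof -
  obtain T where T: "openin (powertop_real UNIV) T" "U = T \<inter> topspace (Euclidean_space m)"
    using assms(1) unfolding topspace_Euclidean_space
    by (auto simp: Euclidean_space_def openin_subtopology)
  then obtain X where X: "a \<in> Pi\<^sub>E UNIV X" "\<And>i. openin euclideanreal (X i)" "Pi\<^sub>E UNIV X \<subseteq> T"
    using product_topology_open_contains_basis[of "\<lambda>_. euclideanreal" UNIV T a] assms(2) by auto
  have "\<exists>e>0. ball (a i) e \<subseteq> X i" for i
    using X(1) X(2)[of i] by (meson PiE_mem UNIV_I open_contains_ball open_openin)
  then obtain e where e: "\<And>i. e i > 0" "\<And>i. ball (a i) (e i) \<subseteq> X i"
    by metis
  have aE: "a \<in> topspace (Euclidean_space m)"
    using assms openin_subset by blast
  show thesis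
  proof
    \<comment> \<open>The 1 keeps the set non-empty when \<open>m = 0\<close>; coordinates from
      \<open>m\<close> on are pinned to 0 and ask for no radius.\<close>
    let ?e = "Min (insert 1 (e ` {..<m}))"
    show "?e > 0"
      using e(1) by (subst Min_gr_iff) auto
    fix z assume z: "z \<in> topspace (Euclidean_space m)" "\<And>i. i < m \<Longrightarrow> \<bar>z i - a i\<bar> < ?e"
    have "z i \<in> X i" for i
    proof (cases "i < m")
      case True
      then have "?e \<le> e i" by (intro Min_le) auto
      then have "z i \<in> ball (a i) (e i)"
        using z(2)[OF True] unfolding mem_ball dist_real_def by linarith
      then show ?thesis using e(2) by blast
    next
      case False
      then have "z i = a i"
        using z(1) aE by (auto simp: topspace_Euclidean_space)
      then show ?thesis using X(1) by auto
    qed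
    then show "z \<in> U" using X(3) T(2) z(1) by auto
  qed
qed

text \<open>An open set of R^m is the trace of an open set of the function type and in general not
  open there itself. Convergence alone therefore does not force \<open>X t\<close> into
  \<open>U\<close>; membership in R^m closes the gap.\<close>

lemma eventually_in_openin_Euclidean:
  assumes "openin (Euclidean_space m) U" "a \<in> U" "(X \<longlongrightarrow> a) F"
    and "\<forall>\<^sub>F t in F. X t \<in> topspace (Euclidean_space m)"
  shows "\<forall>\<^sub>F t in F. X t \<in> U"
proof -
  obtain T where "open T" "U = T \<inter> topspace (Euclidean_space m)"
    using assms(1) by (subst (asm) Euclidean_space_eq_top_of_set) (auto simp: openin_open)
  moreover from this have "\<forall>\<^sub>F t in F. X t \<in> T"
    using assms(2,3) by (intro topological_tendstoD) auto
  ultimately show ?thesis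
    using assms(4) by (auto elim: eventually_elim2)
qed

lemma fun_upd_in_Euclidean_space:
  assumes "x \<in> topspace (Euclidean_space m)" "i < m"
  shows "x(i := t) \<in> topspace (Euclidean_space m)"
  using assms by (auto simp: topspace_Euclidean_space)

lemma tendsto_fun_upd:
  fixes x :: "'i \<Rightarrow> 'b::topological_space"
  shows "((\<lambda>t. x(i := t)) \<longlongrightarrow> x) (nhds (x i))"
  unfolding tendsto_fun_iff
proof
  show "((\<lambda>t. (x(i := t)) j) \<longlongrightarrow> x j) (nhds (x i))" for j
    by (cases "j = i") (auto simp: filterlim_ident)
qed

lemma eventually_fun_upd:
  assumes "openin (Euclidean_space m) U" "x \<in> U" "i < m"
  shows "\<forall>\<^sub>F t in nhds (x i). x(i := t) \<in> U"
proof (rule eventually_in_openin_Euclidean[OF assms(1,2) tendsto_fun_upd])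
  have "x \<in> topspace (Euclidean_space m)"
    using assms openin_subset by blast
  then show "\<forall>\<^sub>F t in nhds (x i). x(i := t) \<in> topspace (Euclidean_space m)"
    using assms(3) by (intro always_eventually allI fun_upd_in_Euclidean_space)
qed

section \<open>Mean value theorem, secants and the chain rule\<close>

lemma has_partial_deriv_DERIV:
  "has_partial_deriv i f x \<Longrightarrow>
   ((\<lambda>t. f (x(i := t))) has_field_derivative partial_deriv i f x) (at (x i))"
  by (simp add: has_partial_deriv_def partial_deriv_def DERIV_deriv_iff_field_differentiable)

lemma DERIV_has_partial_deriv:
  assumes "((\<lambda>t. f (x(i := t))) has_field_derivative D) (at (x i))"
  shows "has_partial_deriv i f x" "partial_deriv i f x = D"
  using assms by (auto simp: has_partial_deriv_def partial_deriv_def field_differentiable_def DERIV_imp_deriv)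

text \<open>The way from \<open>x\<close> to \<open>y\<close> is an edge path of their box that
  changes one coordinate at a time, and the mean value theorem in one variable is used on each edge.
  This is why existence of the partial derivatives on the box is the only demand on
  \<open>f\<close>.\<close>

lemma partial_MVT:
  assumes x: "x \<in> topspace (Euclidean_space m)" and y: "y \<in> topspace (Euclidean_space m)"
    and f: "\<And>z i. (\<And>j. z j \<in> closed_segment (x j) (y j)) \<Longrightarrow> i < m \<Longrightarrow> has_partial_deriv i f z"
  obtains \<xi> where "\<And>i j. \<xi> i j \<in> closed_segment (x j) (y j)"
    and "f y - f x = (\<Sum>i<m. partial_deriv i f (\<xi> i) * (y i - x i))"
proof -
  \<comment> \<open>The vertices of the path: \<open>z 0\<close> is \<open>x\<close>, and
    \<open>z m\<close> is \<open>y\<close> because both points vanish from \<open>m\<close>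
    on.\<close>
  define z where "z i = (\<lambda>j. if j < i then y j else x j)" for i
  have "\<exists>\<xi>. (\<forall>j. \<xi> j \<in> closed_segment (x j) (y j)) \<and>
      f (z (Suc i)) - f (z i) = partial_deriv i f \<xi> * (y i - x i)" if "i < m" for i
  proof (cases "x i = y i")
    \<comment> \<open>A degenerate edge leaves no open interval for the mean value theorem; its
      coefficient \<open>y i - x i\<close> is 0, so any point of the box serves.\<close>
    case True
    then have "z (Suc i) = z i"
      by (auto simp: z_def fun_eq_iff less_Suc_eq)
    then show ?thesis
      using True by (intro exI[of _ x]) auto
  next
    case False
    define h where "h t = f ((z i)(i := t))" for t
    have upd: "((z i)(i := t)) j \<in> closed_segment (x j) (y j)" if "t \<in> closed_segment (x i) (y i)" for t j
      using that by (auto simp: z_def)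
    have der: "(h has_field_derivative partial_deriv i f ((z i)(i := t))) (at t)"
      if "t \<in> closed_segment (x i) (y i)" for t
      using has_partial_deriv_DERIV[OF f[of "(z i)(i := t)", OF upd[OF that] \<open>i < m\<close>]]
      by (simp add: h_def[abs_def])
    have "(z i)(i := x i) = z i" "(z i)(i := y i) = z (Suc i)"
      by (simp_all add: z_def fun_eq_iff less_Suc_eq)
    then have zi: "h (x i) = f (z i)" "h (y i) = f (z (Suc i))"
      by (simp_all add: h_def)
    have "\<exists>t. t \<in> closed_segment (x i) (y i) \<and> h (y i) - h (x i) = partial_deriv i f ((z i)(i := t)) * (y i - x i)"
    proof (cases "x i < y i")
      case True
      have "\<exists>t. x i < t \<and> t < y i \<and> h (y i) - h (x i) = (y i - x i) * partial_deriv i f ((z i)(i := t))"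
        by (rule MVT2[OF True]) (use True in \<open>auto intro!: der simp: closed_segment_eq_real_ivl\<close>)
      then obtain t where "x i < t" "t < y i"
        "h (y i) - h (x i) = (y i - x i) * partial_deriv i f ((z i)(i := t))"
        by blast
      then show ?thesis
        by (intro exI[of _ t] conjI) (auto simp: closed_segment_eq_real_ivl mult.commute)
    next
      case nlt: False
      then have less: "y i < x i" using False by simp
      have "\<exists>t. y i < t \<and> t < x i \<and> h (x i) - h (y i) = (x i - y i) * partial_deriv i f ((z i)(i := t))"
        by (rule MVT2[OF less]) (use less in \<open>auto intro!: der simp: closed_segment_eq_real_ivl\<close>)
      then obtain t where t: "y i < t" "t < x i"
        "h (x i) - h (y i) = (x i - y i) * partial_deriv i f ((z i)(i := t))"
        by blast
      have neg: "b - a = e * (d - c)" if "a - b = (c - d) * e" for a b c d e :: real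
      proof -
        have "b - a = - ((c - d) * e)" using that by simp
        then show ?thesis by (simp add: algebra_simps)
      qed
      show ?thesis
        using t(1,2) less neg[OF t(3)]
        by (intro exI[of _ t] conjI) (auto simp: closed_segment_eq_real_ivl)
    qed
    then obtain t where "t \<in> closed_segment (x i) (y i)"
      "h (y i) - h (x i) = partial_deriv i f ((z i)(i := t)) * (y i - x i)"
      by blast
    then show ?thesis
      using upd unfolding zi by (intro exI[of _ "(z i)(i := t)"]) blast
  qed
  then have "\<forall>i\<in>{..<m}. \<exists>\<xi>. (\<forall>j. \<xi> j \<in> closed_segment (x j) (y j)) \<and>
      f (z (Suc i)) - f (z i) = partial_deriv i f \<xi> * (y i - x i)"
    by simp
  from bchoice[OF this] obtain \<xi> where "\<forall>i\<in>{..<m}. (\<forall>j. \<xi> i j \<in> closed_segment (x j) (y j)) \<and>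
      f (z (Suc i)) - f (z i) = partial_deriv i f (\<xi> i) * (y i - x i)"
    by blast
  then have \<xi>: "\<And>i j. i < m \<Longrightarrow> \<xi> i j \<in> closed_segment (x j) (y j)"
      "\<And>i. i < m \<Longrightarrow> f (z (Suc i)) - f (z i) = partial_deriv i f (\<xi> i) * (y i - x i)"
    by auto
  have "(\<Sum>i<m. f (z (Suc i)) - f (z i)) = f (z m) - f (z 0)"
    by (rule sum_lessThan_telescope)
  moreover have "z m = y" "z 0 = x"
    using x y by (auto simp: z_def fun_eq_iff topspace_Euclidean_space)
  ultimately have eq: "f y - f x = (\<Sum>i<m. partial_deriv i f (\<xi> i) * (y i - x i))"
    using \<xi>(2) by simp
  \<comment> \<open>The box condition is demanded for every index, so indices from \<open>m\<close>
    on get the corner \<open>x\<close>.\<close>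
  define \<zeta> where "\<zeta> i = (if i < m then \<xi> i else x)" for i
  show thesis
  proof
    show "\<zeta> i j \<in> closed_segment (x j) (y j)" for i j
      using \<xi>(1) by (auto simp: \<zeta>_def)
    show "f y - f x = (\<Sum>i<m. partial_deriv i f (\<zeta> i) * (y i - x i))"
      unfolding eq by (rule sum.cong) (auto simp: \<zeta>_def)
  qed
qed

definition secant_points ::
  "nat \<Rightarrow> ((nat \<Rightarrow> real) \<Rightarrow> real) \<Rightarrow> (nat \<Rightarrow> real) \<Rightarrow> (nat \<Rightarrow> real) \<Rightarrow> (nat \<Rightarrow> nat \<Rightarrow> real) \<Rightarrow> bool" where
  "secant_points m f x y \<xi> \<longleftrightarrow>
     (\<forall>i j. \<xi> i j \<in> closed_segment (x j) (y j)) \<and>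
     f y - f x = (\<Sum>i<m. partial_deriv i f (\<xi> i) * (y i - x i))"

text \<open>Meaningful only if \<open>f\<close> has partial derivatives on the whole box spanned by \<open>x\<close> and \<open>y\<close>; otherwise
  the choice of points may be void.\<close>

definition secant ::
  "nat \<Rightarrow> ((nat \<Rightarrow> real) \<Rightarrow> real) \<Rightarrow> (nat \<Rightarrow> real) \<Rightarrow> (nat \<Rightarrow> real) \<Rightarrow> nat \<Rightarrow> real" where
  "secant m f x y i = partial_deriv i f ((SOME \<xi>. secant_points m f x y \<xi>) i)"

text \<open>Once both points lie in a box around \<open>a\<close> contained in \<open>U\<close>, so
  does the whole box that they span, since intervals are convex; \<open>partial_MVT\<close> then
  shows that \<open>SOME\<close> has something to select.\<close>

lemma eventually_secant_points:
  assumes U: "openin (Euclidean_space m) U" "a \<in> U"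
    and f: "\<forall>i<m. \<forall>x\<in>U. has_partial_deriv i f x"
    and X: "(X \<longlongrightarrow> a) F" "\<forall>\<^sub>F t in F. X t \<in> topspace (Euclidean_space m)"
    and Y: "(Y \<longlongrightarrow> a) F" "\<forall>\<^sub>F t in F. Y t \<in> topspace (Euclidean_space m)"
  shows "\<forall>\<^sub>F t in F. secant_points m f (X t) (Y t) (SOME \<xi>. secant_points m f (X t) (Y t) \<xi>)"
proof -
  obtain e where e: "e > 0"
    "\<And>z. z \<in> topspace (Euclidean_space m) \<Longrightarrow> (\<And>i. i < m \<Longrightarrow> \<bar>z i - a i\<bar> < e) \<Longrightarrow> z \<in> U"
    using openin_Euclidean_box[OF U] by blast
  have "\<forall>\<^sub>F t in F. \<forall>i\<in>{..<m}. dist (X t i) (a i) < e"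
    using X(1) e(1) unfolding tendsto_fun_iff by (intro eventually_ball_finite ballI tendstoD) auto
  moreover have "\<forall>\<^sub>F t in F. \<forall>i\<in>{..<m}. dist (Y t i) (a i) < e"
    using Y(1) e(1) unfolding tendsto_fun_iff by (intro eventually_ball_finite ballI tendstoD) auto
  ultimately show ?thesis
    using X(2) Y(2)
  proof eventually_elim
    case (elim t)
    have "has_partial_deriv i f z"
      if z: "\<And>j. z j \<in> closed_segment (X t j) (Y t j)" and "i < m" for z i
    proof (rule f[rule_format, OF \<open>i < m\<close>], rule e(2))
      show "z \<in> topspace (Euclidean_space m)"
        unfolding topspace_Euclidean_space
      proof (safe)
        fix j assume "m \<le> j"
        then show "z j = 0"
          using z[of j] elim(3,4) by (auto simp: topspace_Euclidean_space)
      qed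
      fix j assume "j < m"
      have "closed_segment (X t j) (Y t j) \<subseteq> ball (a j) e"
        using elim(1,2) \<open>j < m\<close> by (intro closed_segment_subset) (auto simp: dist_commute)
      then show "\<bar>z j - a j\<bar> < e"
        using z[of j] by (auto simp: dist_real_def)
    qed
    then obtain \<xi> where "secant_points m f (X t) (Y t) \<xi>"
      using partial_MVT[OF elim(3,4), of f] unfolding secant_points_def by metis
    then have "\<exists>\<xi>. secant_points m f (X t) (Y t) \<xi>" by blast
    then show ?case by (rule someI_ex)
  qed
qed

lemma eventually_secant:
  assumes "openin (Euclidean_space m) U" "a \<in> U"
    and "\<forall>i<m. \<forall>x\<in>U. has_partial_deriv i f x"
    and "(X \<longlongrightarrow> a) F" "\<forall>\<^sub>F t in F. X t \<in> topspace (Euclidean_space m)"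
    and "(Y \<longlongrightarrow> a) F" "\<forall>\<^sub>F t in F. Y t \<in> topspace (Euclidean_space m)"
  shows "\<forall>\<^sub>F t in F. f (Y t) - f (X t) = (\<Sum>i<m. secant m f (X t) (Y t) i * (Y t i - X t i))"
  using eventually_secant_points[OF assms]
  by eventually_elim (simp add: secant_points_def secant_def)

text \<open>Whatever points are selected, their coordinates lie between those of \<open>X t\<close>
  and \<open>Y t\<close>, which squeezes them to \<open>a\<close>; continuity of the partial
  derivative does the rest.\<close>

lemma tendsto_secant:
  assumes U: "openin (Euclidean_space m) U" "a \<in> U"
    and f: "\<forall>i<m. \<forall>x\<in>U. has_partial_deriv i f x"
    and X: "(X \<longlongrightarrow> a) F" "\<forall>\<^sub>F t in F. X t \<in> topspace (Euclidean_space m)"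
    and Y: "(Y \<longlongrightarrow> a) F" "\<forall>\<^sub>F t in F. Y t \<in> topspace (Euclidean_space m)"
    and cont: "continuous_on U (partial_deriv i f)"
  shows "((\<lambda>t. secant m f (X t) (Y t) i) \<longlongrightarrow> partial_deriv i f a) F"
proof -
  define \<xi> where "\<xi> t = (SOME \<xi>. secant_points m f (X t) (Y t) \<xi>)" for t
  have ev: "\<forall>\<^sub>F t in F. secant_points m f (X t) (Y t) (\<xi> t)"
    unfolding \<xi>_def by (rule eventually_secant_points[OF U f X Y])
  have "((\<lambda>t. \<xi> t i) \<longlongrightarrow> a) F"
    unfolding tendsto_fun_iff
  proof
    fix j
    have lim: "((\<lambda>t. X t j) \<longlongrightarrow> a j) F" "((\<lambda>t. Y t j) \<longlongrightarrow> a j) F"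
      using X(1) Y(1) by (auto simp: tendsto_fun_iff)
    show "((\<lambda>t. \<xi> t i j) \<longlongrightarrow> a j) F"
    proof (rule tendsto_sandwich)
      show "((\<lambda>t. min (X t j) (Y t j)) \<longlongrightarrow> a j) F" "((\<lambda>t. max (X t j) (Y t j)) \<longlongrightarrow> a j) F"
        using tendsto_min[OF lim] tendsto_max[OF lim] by auto
      have seg: "min (X t j) (Y t j) \<le> \<xi> t i j \<and> \<xi> t i j \<le> max (X t j) (Y t j)"
        if "secant_points m f (X t) (Y t) (\<xi> t)" for t
      proof -
        have "\<xi> t i j \<in> closed_segment (X t j) (Y t j)"
          using that by (simp add: secant_points_def)
        then show ?thesis
          by (auto simp: closed_segment_eq_real_ivl split: if_splits)
      qed
      show "\<forall>\<^sub>F t in F. min (X t j) (Y t j) \<le> \<xi> t i j" "\<forall>\<^sub>F t in F. \<xi> t i j \<le> max (X t j) (Y t j)"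
        using seg by (auto intro: eventually_mono[OF ev])
    qed
  qed
  moreover have "\<forall>\<^sub>F t in F. \<xi> t i \<in> topspace (Euclidean_space m)"
    using ev X(2) Y(2)
  proof eventually_elim
    case (elim t)
    show ?case
      unfolding topspace_Euclidean_space
    proof safe
      fix j assume "m \<le> j"
      moreover have "\<xi> t i j \<in> closed_segment (X t j) (Y t j)"
        using elim(1) by (simp add: secant_points_def)
      ultimately show "\<xi> t i j = 0"
        using elim(2,3) by (auto simp: topspace_Euclidean_space)
    qed
  qed
  ultimately have "\<forall>\<^sub>F t in F. \<xi> t i \<in> U"
    by (rule eventually_in_openin_Euclidean[OF U])
  then show ?thesis
    unfolding secant_def \<xi>_def[symmetric]
    by (intro continuous_on_tendsto_compose[OF cont \<open>((\<lambda>t. \<xi> t i) \<longlongrightarrow> a) F\<close> U(2)])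
qed

text \<open>The secant equation divided by \<open>t - t\<^sub>0\<close> writes the difference
  quotient of the composite as a sum of secants times difference quotients of the coordinates.
  Continuity of the partial derivatives of \<open>f\<close> makes the secants converge.\<close>

lemma DERIV_compose_curve:
  assumes U: "openin (Euclidean_space m) U" "g t\<^sub>0 \<in> U"
    and f: "\<forall>i<m. \<forall>x\<in>U. has_partial_deriv i f x"
      "\<forall>i<m. continuous_on U (partial_deriv i f)"
    and g: "\<forall>\<^sub>F t in nhds t\<^sub>0. g t \<in> topspace (Euclidean_space m)"
      "\<And>i. i < m \<Longrightarrow> ((\<lambda>t. g t i) has_field_derivative g' i) (at t\<^sub>0)"
  shows "((\<lambda>t. f (g t)) has_field_derivative (\<Sum>i<m. partial_deriv i f (g t\<^sub>0) * g' i)) (at t\<^sub>0)"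
proof -
  have gE: "\<forall>\<^sub>F t in at t\<^sub>0. g t \<in> topspace (Euclidean_space m)"
    using g(1) by (auto simp: eventually_nhds_conv_at)
  have g0: "g t\<^sub>0 \<in> topspace (Euclidean_space m)"
    using U openin_subset by blast
  have lim: "(g \<longlongrightarrow> g t\<^sub>0) (at t\<^sub>0)"
    unfolding tendsto_fun_iff
  proof
    fix i
    show "((\<lambda>t. g t i) \<longlongrightarrow> g t\<^sub>0 i) (at t\<^sub>0)"
    proof (cases "i < m")
      case True
      then show ?thesis using g(2) DERIV_isCont isCont_def by blast
    next
      case False
      then have "\<forall>\<^sub>F t in at t\<^sub>0. g t i = g t\<^sub>0 i"
        using gE g0 by (auto elim!: eventually_mono simp: topspace_Euclidean_space)
      then show ?thesis by (rule tendsto_eventually)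
    qed
  qed
  have const: "((\<lambda>_. g t\<^sub>0) \<longlongrightarrow> g t\<^sub>0) (at t\<^sub>0)" "\<forall>\<^sub>F t in at t\<^sub>0. g t\<^sub>0 \<in> topspace (Euclidean_space m)"
    using g0 by auto
  have ev: "\<forall>\<^sub>F t in at t\<^sub>0. (\<Sum>i<m. secant m f (g t\<^sub>0) (g t) i * ((g t i - g t\<^sub>0 i) / (t - t\<^sub>0)))
      = (f (g t) - f (g t\<^sub>0)) / (t - t\<^sub>0)"
    using eventually_secant[OF U f(1) const lim gE]
    by eventually_elim (simp add: sum_divide_distrib)
  have "((\<lambda>t. \<Sum>i<m. secant m f (g t\<^sub>0) (g t) i * ((g t i - g t\<^sub>0 i) / (t - t\<^sub>0))) \<longlongrightarrow>
      (\<Sum>i<m. partial_deriv i f (g t\<^sub>0) * g' i)) (at t\<^sub>0)"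
    using g(2) f(2) by (intro tendsto_intros tendsto_secant[OF U f(1) const lim gE])
      (simp_all add: has_field_derivative_iff)
  then have "((\<lambda>t. (f (g t) - f (g t\<^sub>0)) / (t - t\<^sub>0)) \<longlongrightarrow> (\<Sum>i<m. partial_deriv i f (g t\<^sub>0) * g' i)) (at t\<^sub>0)"
    by (rule Lim_transform_eventually[OF _ ev])
  then show ?thesis
    by (simp add: has_field_derivative_iff)
qed

section \<open>C^k functions: locality, algebra and composition\<close>

lemma Ck_on_imp_continuous_on:
  assumes "openin (Euclidean_space m) U" "Ck_on m k U f"
  shows "continuous_on U f"
  using assms openin_subset[OF assms(1)]
  by (cases k) (auto simp: continuous_map_Euclidean_subtopology_iff)

lemma Ck_on_0_iff:
  assumes "openin (Euclidean_space m) U"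
  shows "Ck_on m 0 U f \<longleftrightarrow> continuous_on U f"
  using openin_subset[OF assms] by (simp add: continuous_map_Euclidean_subtopology_iff)

lemma Ck_on_Suc_iff:
  assumes "openin (Euclidean_space m) U"
  shows "Ck_on m (Suc k) U f \<longleftrightarrow> continuous_on U f \<and>
    (\<forall>i<m. (\<forall>x\<in>U. has_partial_deriv i f x) \<and> Ck_on m k U (partial_deriv i f))"
  using openin_subset[OF assms] by (simp add: continuous_map_Euclidean_subtopology_iff)

lemma Ck_on_SucD: "Ck_on m (Suc k) U f \<Longrightarrow> Ck_on m k U f"
  by (induction k arbitrary: f) auto

lemma partial_deriv_cong:
  assumes "openin (Euclidean_space m) U" "x \<in> U" "i < m" "\<And>y. y \<in> U \<Longrightarrow> f y = g y"
  shows "has_partial_deriv i f x \<longleftrightarrow> has_partial_deriv i g x"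
    and "partial_deriv i f x = partial_deriv i g x"
proof -
  have ev: "\<forall>\<^sub>F t in nhds (x i). f (x(i := t)) = g (x(i := t))"
    using eventually_fun_upd[OF assms(1-3)] by (rule eventually_mono) (rule assms(4))
  show "has_partial_deriv i f x \<longleftrightarrow> has_partial_deriv i g x"
    unfolding has_partial_deriv_def field_differentiable_def
    by (intro ex_cong1 DERIV_cong_ev ev refl)
  show "partial_deriv i f x = partial_deriv i g x"
    unfolding partial_deriv_def by (rule deriv_cong_ev[OF ev refl])
qed

lemma Ck_on_cong:
  assumes U: "openin (Euclidean_space m) U" and "\<And>x. x \<in> U \<Longrightarrow> f x = g x"
  shows "Ck_on m k U f \<longleftrightarrow> Ck_on m k U g"
  using assms(2)
proof (induction k arbitrary: f g)
  case 0
  then show ?case unfolding Ck_on_0_iff[OF U] by (simp cong: continuous_on_cong)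
next
  case (Suc k)
  have "Ck_on m k U (partial_deriv i f) \<longleftrightarrow> Ck_on m k U (partial_deriv i g)" if "i < m" for i
    using partial_deriv_cong(2)[OF U _ that] Suc.prems by (intro Suc.IH) blast
  moreover have "(\<forall>x\<in>U. has_partial_deriv i f x) \<longleftrightarrow> (\<forall>x\<in>U. has_partial_deriv i g x)" if "i < m" for i
    using partial_deriv_cong(1)[OF U _ that] Suc.prems by blast
  moreover have "continuous_on U f \<longleftrightarrow> continuous_on U g"
    using Suc.prems by (simp cong: continuous_on_cong)
  ultimately show ?case
    unfolding Ck_on_Suc_iff[OF U] by blast
qed

lemma Ck_on_subset:
  assumes "openin (Euclidean_space m) U" "openin (Euclidean_space m) V" "V \<subseteq> U" "Ck_on m k U f"
  shows "Ck_on m k V f"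
  using assms(4)
proof (induction k arbitrary: f)
  case 0
  then show ?case
    using assms(3) continuous_on_subset unfolding Ck_on_0_iff[OF assms(1)] Ck_on_0_iff[OF assms(2)]
    by blast
next
  case (Suc k)
  then show ?case
    using assms continuous_on_subset unfolding Ck_on_Suc_iff[OF assms(1)] Ck_on_Suc_iff[OF assms(2)]
    by blast
qed

text \<open>Candidates \<open>D\<close> for the derivatives are compared with
  \<open>partial_deriv\<close> on \<open>U\<close> only, where they agree by uniqueness of
  derivatives; this is the induction step common to the closure properties that follow.\<close>

lemma Ck_on_SucI:
  assumes U: "openin (Euclidean_space m) U" and "continuous_on U f"
    and der: "\<And>i x. i < m \<Longrightarrow> x \<in> U \<Longrightarrow> ((\<lambda>t. f (x(i := t))) has_field_derivative D i x) (at (x i))"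
    and D: "\<And>i. i < m \<Longrightarrow> Ck_on m k U (D i)"
  shows "Ck_on m (Suc k) U f"
proof -
  have "Ck_on m k U (partial_deriv i f)" if "i < m" for i
  proof -
    have "partial_deriv i f x = D i x" if "x \<in> U" for x
      by (rule DERIV_has_partial_deriv(2)[OF der[OF \<open>i < m\<close> that]])
    then show ?thesis
      using D[OF that] Ck_on_cong[OF U, of "partial_deriv i f" "D i"] by blast
  qed
  moreover have "has_partial_deriv i f x" if "i < m" "x \<in> U" for i x
    by (rule DERIV_has_partial_deriv(1)[OF der[OF that]])
  ultimately show ?thesis
    using assms(2) unfolding Ck_on_Suc_iff[OF U] by blast
qed

lemma Ck_on_DERIV:
  assumes "Ck_on m (Suc k) U f" "i < m" "x \<in> U"
  shows "((\<lambda>t. f (x(i := t))) has_field_derivative partial_deriv i f x) (at (x i))"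
  using assms by (intro has_partial_deriv_DERIV) auto

lemma Ck_on_const:
  assumes U: "openin (Euclidean_space m) U"
  shows "Ck_on m k U (\<lambda>_. c)"
proof (induction k arbitrary: c)
  case 0
  show ?case unfolding Ck_on_0_iff[OF U] by simp
next
  case (Suc k)
  show ?case by (rule Ck_on_SucI[OF U, where D = "\<lambda>_ _. 0"]) (auto intro: Suc)
qed

lemma Ck_on_add:
  assumes U: "openin (Euclidean_space m) U" and "Ck_on m k U f" "Ck_on m k U g"
  shows "Ck_on m k U (\<lambda>x. f x + g x)"
  using assms(2,3)
proof (induction k arbitrary: f g)
  case 0
  then show ?case unfolding Ck_on_0_iff[OF U] by (intro continuous_intros)
next
  case (Suc k)
  show ?case
  proof (rule Ck_on_SucI[OF U, where D = "\<lambda>i x. partial_deriv i f x + partial_deriv i g x"])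
    show "continuous_on U (\<lambda>x. f x + g x)"
      using Suc.prems Ck_on_imp_continuous_on[OF U] by (intro continuous_intros)
    show "((\<lambda>t. f (x(i := t)) + g (x(i := t))) has_real_derivative
        partial_deriv i f x + partial_deriv i g x) (at (x i))" if "i < m" "x \<in> U" for i x
      by (intro DERIV_add Ck_on_DERIV[OF Suc.prems(1) that] Ck_on_DERIV[OF Suc.prems(2) that])
  qed (use Suc in auto)
qed

lemma Ck_on_mult:
  assumes U: "openin (Euclidean_space m) U" and "Ck_on m k U f" "Ck_on m k U g"
  shows "Ck_on m k U (\<lambda>x. f x * g x)"
  using assms(2,3)
proof (induction k arbitrary: f g)
  case 0
  then show ?case unfolding Ck_on_0_iff[OF U] by (intro continuous_intros)
next
  case (Suc k)
  show ?case
  proof (rule Ck_on_SucI[OF U, where D = "\<lambda>i x. partial_deriv i f x * g x + partial_deriv i g x * f x"])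
    show "continuous_on U (\<lambda>x. f x * g x)"
      using Suc.prems Ck_on_imp_continuous_on[OF U] by (intro continuous_intros)
    show "((\<lambda>t. f (x(i := t)) * g (x(i := t))) has_real_derivative
        partial_deriv i f x * g x + partial_deriv i g x * f x) (at (x i))" if "i < m" "x \<in> U" for i x
      by (rule DERIV_cong[OF DERIV_mult[OF Ck_on_DERIV[OF Suc.prems(1) that] Ck_on_DERIV[OF Suc.prems(2) that]]])
        simp
    \<comment> \<open>In each term of the product rule one factor has lost an order of smoothness;
      the other is weakened to that order before the induction hypothesis applies.\<close>
    show "Ck_on m k U (\<lambda>x. partial_deriv i f x * g x + partial_deriv i g x * f x)" if "i < m" for i
      using Suc.prems that Suc.prems[THEN Ck_on_SucD] by (intro Ck_on_add[OF U] Suc.IH) auto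
  qed
qed

lemma Ck_on_sum:
  assumes U: "openin (Euclidean_space m) U" and "\<And>a. a \<in> I \<Longrightarrow> Ck_on m k U (f a)"
  shows "Ck_on m k U (\<lambda>x. \<Sum>a\<in>I. f a x)"
  using assms(2)
  by (induction I rule: infinite_finite_induct) (auto intro: Ck_on_const[OF U] Ck_on_add[OF U])

lemma Ck_on_prod:
  assumes U: "openin (Euclidean_space m) U" and "\<And>a. a \<in> I \<Longrightarrow> Ck_on m k U (f a)"
  shows "Ck_on m k U (\<lambda>x. \<Prod>a\<in>I. f a x)"
  using assms(2)
  by (induction I rule: infinite_finite_induct) (auto intro: Ck_on_const[OF U] Ck_on_mult[OF U])

lemma Ck_on_inverse:
  assumes U: "openin (Euclidean_space m) U" and "Ck_on m k U f" and nz: "\<And>x. x \<in> U \<Longrightarrow> f x \<noteq> 0"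
  shows "Ck_on m k U (\<lambda>x. inverse (f x))"
  using assms(2)
proof (induction k)
  case 0
  then show ?case unfolding Ck_on_0_iff[OF U] by (intro continuous_intros) (use nz in auto)
next
  case (Suc k)
  show ?case
  \<comment> \<open>-f'/f^2 is grouped so that, apart from the derivative of \<open>f\<close>, only
    \<open>inverse (f x)\<close> itself recurs; to it the induction hypothesis applies at the lower
    order.\<close>
  proof (rule Ck_on_SucI[OF U,
        where D = "\<lambda>i x. (- 1) * (inverse (f x) * (partial_deriv i f x * inverse (f x)))"])
    show "continuous_on U (\<lambda>x. inverse (f x))"
      using Ck_on_imp_continuous_on[OF U Suc.prems] nz by (intro continuous_intros) auto
    show "((\<lambda>t. inverse (f (x(i := t)))) has_real_derivative
        (- 1) * (inverse (f x) * (partial_deriv i f x * inverse (f x)))) (at (x i))"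
      if "i < m" "x \<in> U" for i x
      by (rule DERIV_cong[OF DERIV_inverse'[OF Ck_on_DERIV[OF Suc.prems that]]])
        (use nz[OF that(2)] in simp_all)
    show "Ck_on m k U (\<lambda>x. (- 1) * (inverse (f x) * (partial_deriv i f x * inverse (f x))))"
      if "i < m" for i
      using Suc.prems that Suc.IH[OF Ck_on_SucD[OF Suc.prems]]
      by (intro Ck_on_mult[OF U] Ck_on_const[OF U]) auto
  qed
qed

lemma continuous_on_into_Euclidean_space:
  assumes "g \<in> V \<rightarrow> topspace (Euclidean_space n)" "\<And>j. j < n \<Longrightarrow> continuous_on V (\<lambda>x. g x j)"
  shows "continuous_on V g"
proof (rule continuous_on_coordinatewise_then_product)
  fix j
  show "continuous_on V (\<lambda>x. g x j)"
  proof (cases "j < n")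
    case False
    then have "continuous_on V (\<lambda>x. g x j) \<longleftrightarrow> continuous_on V (\<lambda>_. 0 :: real)"
      using assms(1) by (intro continuous_on_cong) (auto simp: topspace_Euclidean_space Pi_iff)
    then show ?thesis by simp
  qed (rule assms(2))
qed

lemma DERIV_compose_partial:
  assumes U: "openin (Euclidean_space n) U" and V: "openin (Euclidean_space m) V"
    and g: "g \<in> V \<rightarrow> U" "\<And>j. j < n \<Longrightarrow> has_partial_deriv i (\<lambda>x. g x j) x"
    and f: "Ck_on n (Suc k) U f" and x: "x \<in> V" "i < m"
  shows "((\<lambda>t. f (g (x(i := t)))) has_field_derivative
      (\<Sum>j<n. partial_deriv j f (g x) * partial_deriv i (\<lambda>x. g x j) x)) (at (x i))"
proof -
  have "((\<lambda>t. f (g (x(i := t)))) has_field_derivative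
      (\<Sum>j<n. partial_deriv j f (g (x(i := x i))) * partial_deriv i (\<lambda>x. g x j) x)) (at (x i))"
  proof (rule DERIV_compose_curve[OF U])
    show "g (x(i := x i)) \<in> U" using g x by auto
    show "\<forall>j<n. \<forall>x\<in>U. has_partial_deriv j f x" using f by simp
    show "\<forall>j<n. continuous_on U (partial_deriv j f)"
      using f unfolding Ck_on.simps by (blast intro: Ck_on_imp_continuous_on[OF U])
    show "\<forall>\<^sub>F t in nhds (x i). g (x(i := t)) \<in> topspace (Euclidean_space n)"
      using eventually_fun_upd[OF V x]
      by (rule eventually_mono) (use g(1) openin_subset[OF U] in blast)
    show "((\<lambda>t. g (x(i := t)) j) has_real_derivative partial_deriv i (\<lambda>x. g x j) x) (at (x i))"
      if "j < n" for j
      by (rule has_partial_deriv_DERIV[OF g(2)[OF that]])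
  qed
  then show ?thesis by simp
qed

text \<open>The induction varies \<open>f\<close> while \<open>g\<close> stays: the chain rule
  leaves \<open>partial_deriv j f\<close> composed with the same \<open>g\<close>, multiplied by
  derivatives of \<open>g\<close>.\<close>

lemma Ck_on_compose:
  assumes U: "openin (Euclidean_space n) U" and V: "openin (Euclidean_space m) V"
    and g: "g \<in> V \<rightarrow> U" "\<And>j. j < n \<Longrightarrow> Ck_on m k V (\<lambda>x. g x j)" and "Ck_on n k U f"
  shows "Ck_on m k V (\<lambda>x. f (g x))"
  using assms(4,5)
proof (induction k arbitrary: f)
  case (0 f)
  have "continuous_on V g"
    using g(1) openin_subset[OF U] 0(1) Ck_on_0_iff[OF V]
    by (intro continuous_on_into_Euclidean_space[where n = n]) auto
  then show ?case
    using 0(2) g(1) unfolding Ck_on_0_iff[OF V] Ck_on_0_iff[OF U]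
    by (intro continuous_on_compose2[of U f V g]) auto
next
  case (Suc k f)
  have cont: "continuous_on V g"
    using g(1) openin_subset[OF U] Ck_on_imp_continuous_on[OF V Suc.prems(1)]
    by (intro continuous_on_into_Euclidean_space[where n = n]) auto
  show ?case
  proof (rule Ck_on_SucI[OF V, where
        D = "\<lambda>i x. \<Sum>j<n. partial_deriv j f (g x) * partial_deriv i (\<lambda>x. g x j) x"])
    show "continuous_on V (\<lambda>x. f (g x))"
      using continuous_on_compose2[OF Ck_on_imp_continuous_on[OF U Suc.prems(2)] cont] g(1) by auto
    show "((\<lambda>t. f (g (x(i := t)))) has_real_derivative
        (\<Sum>j<n. partial_deriv j f (g x) * partial_deriv i (\<lambda>x. g x j) x)) (at (x i))"
      if "i < m" "x \<in> V" for i x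
    proof (rule DERIV_compose_partial[OF U V g(1) _ Suc.prems(2) that(2,1)])
      fix j assume "j < n"
      then have "Ck_on m (Suc k) V (\<lambda>x. g x j)" by (rule Suc.prems(1))
      then show "has_partial_deriv i (\<lambda>x. g x j) x"
        using that unfolding Ck_on.simps by blast
    qed
    show "Ck_on m k V (\<lambda>x. \<Sum>j<n. partial_deriv j f (g x) * partial_deriv i (\<lambda>x. g x j) x)"
      if "i < m" for i
    proof (rule Ck_on_sum[OF V])
      fix j assume "j \<in> {..<n}"
      have "Ck_on m k V (\<lambda>x. partial_deriv j f (g x))"
      proof (rule Suc.IH)
        show "Ck_on m k V (\<lambda>x. g x a)" if "a < n" for a
          by (rule Ck_on_SucD[OF Suc.prems(1)[OF that]])
        show "Ck_on n k U (partial_deriv j f)"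
          using Suc.prems(2) \<open>j \<in> {..<n}\<close> by simp
      qed
      moreover have "Ck_on m k V (\<lambda>x. partial_deriv i (\<lambda>x. g x j) x)"
        using Suc.prems(1)[of j] \<open>j \<in> {..<n}\<close> that by simp
      ultimately show "Ck_on m k V (\<lambda>x. partial_deriv j f (g x) * partial_deriv i (\<lambda>x. g x j) x)"
        by (rule Ck_on_mult[OF V])
    qed
  qed
qed

lemma Ck_on_fdet:
  assumes U: "openin (Euclidean_space m) U"
    and "\<And>i j. i < n \<Longrightarrow> j < n \<Longrightarrow> Ck_on m k U (\<lambda>x. A x i j)"
  shows "Ck_on m k U (\<lambda>x. fdet n (A x))"
  unfolding fdet_def
proof (intro Ck_on_sum[OF U] Ck_on_mult[OF U] Ck_on_prod[OF U] Ck_on_const[OF U])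
  fix p i assume "p \<in> {p. p permutes {0..<n}}" "i \<in> {0..<n}"
  then show "Ck_on m k U (\<lambda>x. A x i (p i))"
    using permutes_in_image[of p "{0..<n}" i] by (intro assms) auto
qed

lemma Ck_on_finv:
  assumes U: "openin (Euclidean_space m) U"
    and "\<And>i j. i < n \<Longrightarrow> j < n \<Longrightarrow> Ck_on m k U (\<lambda>x. A x i j)"
    and "\<And>x. x \<in> U \<Longrightarrow> mat_inj n n (A x)" "i < n" "j < n"
  shows "Ck_on m k U (\<lambda>x. finv n (A x) i j)"
  unfolding finv_def fadj_def using assms(3-)
  by (intro Ck_on_mult[OF U] Ck_on_const[OF U] Ck_on_inverse[OF U] Ck_on_fdet[OF U] assms(2))
    (auto simp: fdet_nonzero_iff)

section \<open>Jacobians, local injectivity and the smooth inverse\<close>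

definition jac :: "((nat \<Rightarrow> real) \<Rightarrow> nat \<Rightarrow> real) \<Rightarrow> (nat \<Rightarrow> real) \<Rightarrow> nat \<Rightarrow> nat \<Rightarrow> real" where
  "jac f x j i = partial_deriv i (\<lambda>y. f y j) x"

lemma euclidean_smooth_onD:
  assumes "euclidean_smooth_on m n U f"
  shows "openin (Euclidean_space m) U" "U \<subseteq> topspace (Euclidean_space m)"
    "f \<in> U \<rightarrow> topspace (Euclidean_space n)" "continuous_on U f"
    "\<And>j k. j < n \<Longrightarrow> Ck_on m k U (\<lambda>x. f x j)"
    "\<And>j i k. j < n \<Longrightarrow> i < m \<Longrightarrow> Ck_on m k U (\<lambda>x. jac f x j i)"
    "\<And>j i. j < n \<Longrightarrow> i < m \<Longrightarrow> continuous_on U (\<lambda>x. jac f x j i)"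
    "\<And>j. j < n \<Longrightarrow> \<forall>i<m. \<forall>x\<in>U. has_partial_deriv i (\<lambda>x. f x j) x"
proof -
  show U: "openin (Euclidean_space m) U" and fU: "f \<in> U \<rightarrow> topspace (Euclidean_space n)"
    and Ck: "\<And>j k. j < n \<Longrightarrow> Ck_on m k U (\<lambda>x. f x j)"
    using assms by (auto simp: euclidean_smooth_on_def)
  show "U \<subseteq> topspace (Euclidean_space m)" by (rule openin_subset[OF U])
  show "continuous_on U f"
    using fU Ck_on_imp_continuous_on[OF U Ck] by (rule continuous_on_into_Euclidean_space)
  show Ck1: "Ck_on m k U (\<lambda>x. jac f x j i)" if "j < n" "i < m" for i j k
    using Ck[OF that(1), of "Suc k"] that(2) by (simp add: jac_def[abs_def])
  show "continuous_on U (\<lambda>x. jac f x j i)" if "j < n" "i < m" for i j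
    using Ck_on_imp_continuous_on[OF U Ck1[OF that]] .
  show "\<forall>i<m. \<forall>x\<in>U. has_partial_deriv i (\<lambda>x. f x j) x" if "j < n" for j
    using Ck[OF that, of "Suc 0"] by simp
qed

lemma euclidean_smooth_on_subset:
  assumes "euclidean_smooth_on m n U f" "openin (Euclidean_space m) V" "V \<subseteq> U"
  shows "euclidean_smooth_on m n V f"
  using assms euclidean_smooth_onD(1)[OF assms(1)] unfolding euclidean_smooth_on_def
  by (auto intro: Ck_on_subset)

lemma euclidean_smooth_on_cong:
  assumes "euclidean_smooth_on m n U f" "\<And>x. x \<in> U \<Longrightarrow> f x = g x"
  shows "euclidean_smooth_on m n U g"
proof -
  have "Ck_on m k U (\<lambda>x. f x j) \<longleftrightarrow> Ck_on m k U (\<lambda>x. g x j)" for j k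
    by (rule Ck_on_cong[OF euclidean_smooth_onD(1)[OF assms(1)]]) (simp add: assms(2))
  moreover have "g x \<in> topspace (Euclidean_space n)" if "x \<in> U" for x
    using euclidean_smooth_onD(3)[OF assms(1)] assms(2)[OF that] that by (metis PiE)
  ultimately show ?thesis
    using assms(1) unfolding euclidean_smooth_on_def by auto
qed

lemma jacobian_chain:
  assumes f: "euclidean_smooth_on n l U f" and g: "euclidean_smooth_on m n V g" and gV: "g \<in> V \<rightarrow> U"
    and x: "x \<in> V" "i < m" "j < l"
  shows "jac (\<lambda>x. f (g x)) x j i = (\<Sum>a<n. jac f (g x) j a * jac g x a i)"
  unfolding jac_def
proof (rule DERIV_has_partial_deriv(2), rule DERIV_compose_partial[OF
      euclidean_smooth_onD(1)[OF f] euclidean_smooth_onD(1)[OF g] gV _ euclidean_smooth_onD(5)[OF f x(3)] x(1,2)])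
  show "has_partial_deriv i (\<lambda>x. g x a) x" if "a < n" for a
    using euclidean_smooth_onD(8)[OF g that] x by blast
qed

lemma sum_lessThan_add: "(\<Sum>i<n + k. h i) = (\<Sum>i<n. h i) + (\<Sum>i<k. h (n + i))"
  for h :: "nat \<Rightarrow> 'a::comm_monoid_add"
  by (induction k) (simp_all add: add.assoc)

text \<open>Two points of the fibre are joined by a secant matrix whose entries are partial derivatives
  at nearby points, so it is injective along with the Jacobian.\<close>

lemma locally_injective_fibrewise:
  assumes f: "euclidean_smooth_on (n + k) m U f" and a: "a \<in> U"
    and inj: "mat_inj m k (\<lambda>j i. jac f a j (n + i))"
  obtains V where "openin (Euclidean_space (n + k)) V" "a \<in> V" "V \<subseteq> U"
    "\<And>x y. x \<in> V \<Longrightarrow> y \<in> V \<Longrightarrow> (\<And>i. i < n \<Longrightarrow> x i = y i) \<Longrightarrow> f x = f y \<Longrightarrow> x = y"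
proof -
  let ?E = "topspace (Euclidean_space (n + k))"
  \<comment> \<open>The filter of pairs of points of R^(n + k) that approach (a, a) independently of
    each other, so that one limit controls all pairs of nearby points.\<close>
  define F where "F = inf (nhds (a, a)) (principal (?E \<times> ?E))"
  note U = euclidean_smooth_onD(1)[OF f]
  have "filterlim (\<lambda>z. z) (nhds (a, a)) F"
    unfolding F_def filterlim_def by (simp add: filtermap_ident)
  then have lim: "(fst \<longlongrightarrow> a) F" "(snd \<longlongrightarrow> a) F"
    using tendsto_fst[of "\<lambda>z. z" "(a, a)" F] tendsto_snd[of "\<lambda>z. z" "(a, a)" F] by simp_all
  have ev: "\<forall>\<^sub>F z in F. z \<in> ?E \<times> ?E"
    by (simp add: F_def eventually_inf_principal)
  have evE: "\<forall>\<^sub>F z in F. fst z \<in> ?E" "\<forall>\<^sub>F z in F. snd z \<in> ?E"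
    using ev by (auto elim: eventually_mono)
  define S where "S z j i = secant (n + k) (\<lambda>x. f x j) (fst z) (snd z) i" for z j i
  have "\<forall>\<^sub>F z in F. f (snd z) j - f (fst z) j = (\<Sum>i<n + k. S z j i * (snd z i - fst z i))" if "j < m" for j
    unfolding S_def by (rule eventually_secant[OF U a euclidean_smooth_onD(8)[OF f that] lim(1) evE(1) lim(2) evE(2)])
  then have sec: "\<forall>\<^sub>F z in F. \<forall>j\<in>{..<m}. f (snd z) j - f (fst z) j = (\<Sum>i<n + k. S z j i * (snd z i - fst z i))"
    by (intro eventually_ball_finite) auto
  have "((\<lambda>z. S z j i) \<longlongrightarrow> jac f a j i) F" if "j < m" "i < n + k" for j i
    unfolding S_def jac_def
    by (rule tendsto_secant[OF U a euclidean_smooth_onD(8)[OF f that(1)] lim(1) evE(1) lim(2) evE(2)])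
      (use euclidean_smooth_onD(7)[OF f that] in \<open>simp add: jac_def\<close>)
  then have injS: "\<forall>\<^sub>F z in F. mat_inj m k (\<lambda>j i. S z j (n + i))"
    by (intro eventually_mat_inj[OF _ inj]) auto
  have evU: "\<forall>\<^sub>F z in F. fst z \<in> U" "\<forall>\<^sub>F z in F. snd z \<in> U"
    using eventually_in_openin_Euclidean[OF U a] lim evE by auto
  have "\<forall>\<^sub>F z in F. (\<forall>i<n. fst z i = snd z i) \<longrightarrow> f (fst z) = f (snd z) \<longrightarrow> fst z = snd z"
    using sec injS ev
  proof eventually_elim
    case (elim z)
    show ?case
    proof (intro impI)
      assume eq: "\<forall>i<n. fst z i = snd z i" "f (fst z) = f (snd z)"
      \<comment> \<open>Equal parameters kill the first \<open>n\<close> terms of the secant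
        equation; what remains is the fibre block of the secant matrix applied to the difference of
        the fibre coordinates.\<close>
      have "(\<Sum>i<k. S z j (n + i) * (snd z (n + i) - fst z (n + i))) = 0" if "j < m" for j
      proof -
        have "(\<Sum>i<n + k. S z j i * (snd z i - fst z i)) =
            (\<Sum>i<n. S z j i * (snd z i - fst z i)) + (\<Sum>i<k. S z j (n + i) * (snd z (n + i) - fst z (n + i)))"
          by (rule sum_lessThan_add)
        moreover have "(\<Sum>i<n + k. S z j i * (snd z i - fst z i)) = 0"
          using elim(1) that eq(2) by simp
        moreover have "(\<Sum>i<n. S z j i * (snd z i - fst z i)) = 0"
          using eq(1) by simp
        ultimately show ?thesis by simp
      qed
      then have eqk: "\<forall>i<k. snd z (n + i) - fst z (n + i) = 0"
        using elim(2)[unfolded mat_inj_def, rule_format, of "\<lambda>i. snd z (n + i) - fst z (n + i)"] by blast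
      show "fst z = snd z"
      proof
        fix i
        consider "i < n" | "n \<le> i" "i < n + k" | "n + k \<le> i" by linarith
        then show "fst z i = snd z i"
        proof cases
          case 2
          then show ?thesis using eqk[rule_format, of "i - n"] by simp
        next
          case 3
          then show ?thesis using elim(3) by (auto simp: topspace_Euclidean_space)
        qed (use eq(1) in simp)
      qed
    qed
  qed
  with evU have "\<forall>\<^sub>F z in nhds (a, a). z \<in> ?E \<times> ?E \<longrightarrow> fst z \<in> U \<and> snd z \<in> U \<and>
      ((\<forall>i<n. fst z i = snd z i) \<longrightarrow> f (fst z) = f (snd z) \<longrightarrow> fst z = snd z)"
    unfolding F_def eventually_inf_principal by eventually_elim blast
  from this[unfolded eventually_nhds]
  obtain W where W: "open W" "(a, a) \<in> W" "\<forall>z\<in>W. z \<in> ?E \<times> ?E \<longrightarrow> fst z \<in> U \<and> snd z \<in> U \<and>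
      ((\<forall>i<n. fst z i = snd z i) \<longrightarrow> f (fst z) = f (snd z) \<longrightarrow> fst z = snd z)"
    by blast
  \<comment> \<open>Intersecting the two factors will give a neighbourhood of \<open>a\<close> whose
    square lies in \<open>W\<close>.\<close>
  obtain A B where AB: "open A" "open B" "(a, a) \<in> A \<times> B" "A \<times> B \<subseteq> W"
    using open_prod_elim[OF W(1,2)] by blast
  show thesis
  proof
    show "openin (Euclidean_space (n + k)) (?E \<inter> (A \<inter> B))"
      using AB(1,2) by (subst Euclidean_space_eq_top_of_set) (intro openin_open_Int open_Int)
    show "a \<in> ?E \<inter> (A \<inter> B)" using a AB openin_subset[OF U] by auto
    have W': "x \<in> U \<and> ((\<forall>i<n. x i = y i) \<longrightarrow> f x = f y \<longrightarrow> x = y)"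
      if "x \<in> ?E \<inter> (A \<inter> B)" "y \<in> ?E \<inter> (A \<inter> B)" for x y
    proof -
      have "(x, y) \<in> W" using that AB(4) by auto
      then show ?thesis using bspec[OF W(3)] that by fastforce
    qed
    then show "?E \<inter> (A \<inter> B) \<subseteq> U" by blast
    show "x = y" if "x \<in> ?E \<inter> (A \<inter> B)" "y \<in> ?E \<inter> (A \<inter> B)" "\<And>i. i < n \<Longrightarrow> x i = y i" "f x = f y" for x y
      using W'[OF that(1,2)] that(3,4) by blast
  qed
qed

text \<open>Injectivity makes the inverse continuous by invariance of domain. Continuity lets the
  secant matrices converge, and inverting them yields the Jacobian of the inverse as
  \<open>finv\<close> of \<open>jac f\<close>, evaluated at the inverse. Each use of this formula
  raises the order of smoothness by one.\<close>

theorem euclidean_inverse_smooth: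
  assumes f: "euclidean_smooth_on n n U f" and inj: "inj_on f U"
    and reg: "\<And>x. x \<in> U \<Longrightarrow> mat_inj n n (jac f x)"
  shows "euclidean_smooth_on n n (f ` U) (inv_into U f)"
proof -
  let ?E = "topspace (Euclidean_space n)"
  define g where "g = inv_into U f"
  note U = euclidean_smooth_onD(1)[OF f] and sub = euclidean_smooth_onD(2)[OF f]
  have cmf: "continuous_map (subtopology (Euclidean_space n) U) (Euclidean_space n) f"
    unfolding cm_Euclidean_space_iff_continuous_on using euclidean_smooth_onD(3,4)[OF f] sub
    by (auto simp: inf.absorb2)
  have V: "openin (Euclidean_space n) (f ` U)"
    by (rule invariance_of_domain_Euclidean_space[OF U cmf inj])
  have gf: "g (f x) = x" if "x \<in> U" for x
    using inj that by (simp add: g_def)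
  have fg: "f (g y) = y" and gU: "g y \<in> U" if "y \<in> f ` U" for y
    using that gf by auto
  have cont: "continuous_on (f ` U) g"
  proof (rule continuous_on_open_invariant[THEN iffD2], intro allI impI)
    fix B :: "(nat \<Rightarrow> real) set" assume "open B"
    have opn: "openin (Euclidean_space n) (U \<inter> B)"
      using U \<open>open B\<close> by (subst Euclidean_space_eq_top_of_set, subst (asm) Euclidean_space_eq_top_of_set)
        (auto intro: openin_Int_open)
    \<comment> \<open>Invariance of domain is used on every smaller open set: the preimage of
      \<open>B\<close> under \<open>g\<close> is the image of \<open>U \<inter> B\<close> under
      \<open>f\<close>.\<close>
    have "openin (Euclidean_space n) (f ` (U \<inter> B))"
      by (rule invariance_of_domain_Euclidean_space[OF opn])
        (use cmf inj in \<open>auto intro: continuous_map_from_subtopology_mono inj_on_subset\<close>)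
    then obtain T where "open T" "f ` (U \<inter> B) = ?E \<inter> T"
      by (subst (asm) Euclidean_space_eq_top_of_set) (auto simp: openin_open)
    moreover have "f ` U \<subseteq> ?E" using euclidean_smooth_onD(3)[OF f] by auto
    moreover have "g -` B \<inter> f ` U = f ` (U \<inter> B)" using gf by force
    ultimately show "\<exists>A. open A \<and> A \<inter> f ` U = g -` B \<inter> f ` U"
      by (intro exI[of _ T]) auto
  qed
  have der: "((\<lambda>t. g (y(i := t)) j) has_field_derivative finv n (jac f (g y)) j i) (at (y i))"
    if y: "y \<in> f ` U" and i: "i < n" and j: "j < n" for y i j
  proof -
    define X where "X t = g (y(i := t))" for t
    define S where "S t l = secant n (\<lambda>x. f x l) (g y) (X t)" for t l
    have evV: "\<forall>\<^sub>F t in at (y i). y(i := t) \<in> f ` U"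
      using eventually_fun_upd[OF V y i] by (simp add: eventually_nhds_conv_at)
    have limy: "((\<lambda>t. y(i := t)) \<longlongrightarrow> y) (at (y i))"
      using tendsto_fun_upd[of y i] tendsto_mono[OF at_within_le_nhds] by blast
    have limX: "(X \<longlongrightarrow> g y) (at (y i))"
      unfolding X_def by (rule continuous_on_tendsto_compose[OF cont limy y evV])
    have evX: "\<forall>\<^sub>F t in at (y i). X t \<in> ?E"
      using evV by (rule eventually_mono) (use gU sub X_def in auto)
    have const: "((\<lambda>_. g y) \<longlongrightarrow> g y) (at (y i))" "\<forall>\<^sub>F t in at (y i). g y \<in> ?E"
      using gU[OF y] sub by auto
    have S: "((\<lambda>t. S t a b) \<longlongrightarrow> jac f (g y) a b) (at (y i))" if "a < n" "b < n" for a b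
      unfolding S_def jac_def
      by (rule tendsto_secant[OF U gU[OF y] euclidean_smooth_onD(8)[OF f that(1)] const limX evX])
        (use euclidean_smooth_onD(7)[OF f that] in \<open>simp add: jac_def\<close>)
    have "\<forall>\<^sub>F t in at (y i). f (X t) l - f (g y) l = (\<Sum>b<n. S t l b * (X t b - g y b))" if "l < n" for l
      unfolding S_def
      by (rule eventually_secant[OF U gU[OF y] euclidean_smooth_onD(8)[OF f that] const limX evX])
    then have sec: "\<forall>\<^sub>F t in at (y i). \<forall>l\<in>{..<n}. f (X t) l - f (g y) l = (\<Sum>b<n. S t l b * (X t b - g y b))"
      by (intro eventually_ball_finite) auto
    have inv: "\<forall>\<^sub>F t in at (y i). mat_inj n n (S t)"
      by (rule eventually_mat_inj[OF S reg]) (use gU[OF y] in auto)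
    have ne: "\<forall>\<^sub>F t in at (y i). t \<noteq> y i"
      by (rule eventually_neq_at_within)
    \<comment> \<open>The secant equation is solved for the increment of \<open>g\<close>: the
      corresponding increment of \<open>f\<close> is \<open>t - y i\<close> in direction
      \<open>i\<close> and 0 in all others.\<close>
    have "\<forall>\<^sub>F t in at (y i). finv n (S t) j i = (g (y(i := t)) j - g (y(i := y i)) j) / (t - y i)"
      using sec inv evV ne
    proof eventually_elim
      case (elim t)
      have "X t j - g y j = (\<Sum>l<n. finv n (S t) j l * (\<Sum>b<n. S t l b * (X t b - g y b)))"
        by (rule sum_finv_solve[OF elim(2) j, symmetric])
      also have "\<dots> = (\<Sum>l<n. finv n (S t) j l * (f (X t) l - f (g y) l))"
        using elim(1) by simp
      also have "\<dots> = (\<Sum>l<n. if l = i then finv n (S t) j i * (t - y i) else 0)"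
        using fg[OF y] fg[OF elim(3)] by (intro sum.cong) (auto simp: X_def)
      also have "\<dots> = finv n (S t) j i * (t - y i)"
        using i by simp
      finally show ?case using elim(4) by (simp add: X_def)
    qed
    moreover have "((\<lambda>t. finv n (S t) j i) \<longlongrightarrow> finv n (jac f (g y)) j i) (at (y i))"
      by (rule tendsto_finv[OF S reg j i]) (use gU[OF y] in auto)
    ultimately show ?thesis
      unfolding has_field_derivative_iff by (rule Lim_transform_eventually[rotated])
  qed
  have "Ck_on n k (f ` U) (\<lambda>y. g y j)" if "j < n" for j k
    using that
  proof (induction k arbitrary: j)
    case 0
    show ?case
      unfolding Ck_on_0_iff[OF V] by (rule continuous_on_product_then_coordinatewise[OF cont])
  next
    case (Suc k)
    show ?case
    proof (rule Ck_on_SucI[OF V, where D = "\<lambda>i y. finv n (jac f (g y)) j i"])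
      show "continuous_on (f ` U) (\<lambda>y. g y j)"
        by (rule continuous_on_product_then_coordinatewise[OF cont])
      \<comment> \<open>The induction hypothesis says that all coordinates of \<open>g\<close> are
        of class C^k, hence so is the formula for its derivatives.\<close>
      show "Ck_on n k (f ` U) (\<lambda>y. finv n (jac f (g y)) j i)" if "i < n" for i
      proof (rule Ck_on_compose[OF U V, of g])
        show "g \<in> f ` U \<rightarrow> U" using gU by blast
        show "Ck_on n k U (\<lambda>x. finv n (jac f x) j i)"
          using that Suc.prems by (intro Ck_on_finv[OF U] euclidean_smooth_onD(6)[OF f] reg)
      qed (rule Suc.IH)
      show "((\<lambda>t. g (y(i := t)) j) has_real_derivative finv n (jac f (g y)) j i) (at (y i))"
        if "i < n" "y \<in> f ` U" for i y
        by (rule der[OF that(2,1) Suc.prems])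
    qed
  qed
  then show ?thesis
    using V gU sub unfolding euclidean_smooth_on_def g_def[symmetric] by blast
qed

section \<open>Differentials in charts\<close>

lemma is_chartD:
  assumes "is_chart X c"
  shows "openin X (chart_dom c)" "chart_dom c \<subseteq> topspace X"
    "inj_on (chart_map c) (chart_dom c)"
    "openin (Euclidean_space (chart_dim c)) (chart_map c ` chart_dom c)"
    "\<And>x. x \<in> chart_dom c \<Longrightarrow> chart_map c x \<in> topspace (Euclidean_space (chart_dim c))"
    "continuous_map (subtopology X (chart_dom c)) (Euclidean_space (chart_dim c)) (chart_map c)"
    "\<And>W. openin X W \<Longrightarrow> W \<subseteq> chart_dom c \<Longrightarrow> openin (Euclidean_space (chart_dim c)) (chart_map c ` W)"
proof -
  show X: "openin X (chart_dom c)" and E: "openin (Euclidean_space (chart_dim c)) (chart_map c ` chart_dom c)"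
    using assms by (auto simp: is_chart_def)
  have hom: "homeomorphic_map (subtopology X (chart_dom c))
       (subtopology (Euclidean_space (chart_dim c)) (chart_map c ` chart_dom c)) (chart_map c)"
    using assms by (auto simp: is_chart_def)
  show sub: "chart_dom c \<subseteq> topspace X" by (rule openin_subset[OF X])
  show "inj_on (chart_map c) (chart_dom c)"
    using homeomorphic_imp_injective_map[OF hom] sub by (simp add: inf.absorb2)
  show "chart_map c x \<in> topspace (Euclidean_space (chart_dim c))" if "x \<in> chart_dom c" for x
    using openin_subset[OF E] that by blast
  show "continuous_map (subtopology X (chart_dom c)) (Euclidean_space (chart_dim c)) (chart_map c)"
    using homeomorphic_imp_continuous_map[OF hom] by (simp add: continuous_map_in_subtopology)
  show "openin (Euclidean_space (chart_dim c)) (chart_map c ` W)" if "openin X W" "W \<subseteq> chart_dom c" for W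
  proof -
    have "openin (subtopology X (chart_dom c)) W"
      using that X by (simp add: openin_open_subtopology)
    then have "openin (subtopology (Euclidean_space (chart_dim c)) (chart_map c ` chart_dom c)) (chart_map c ` W)"
      using homeomorphic_map_openness_eq[OF hom] by blast
    then show ?thesis using E by (rule openin_trans_full)
  qed
qed

lemma coord_rep_apply:
  assumes "inj_on (chart_map c) (chart_dom c)" "x \<in> chart_dom c"
  shows "coord_rep c d f (chart_map c x) = chart_map d (f x)"
  using assms by (simp add: coord_rep_def)

lemma chart_map_in_coord_dom: "x \<in> chart_dom c \<Longrightarrow> f x \<in> chart_dom d \<Longrightarrow> chart_map c x \<in> coord_dom c d f"
  by (auto simp: coord_dom_def)

definition chart_jac :: "'a chart \<Rightarrow> 'b chart \<Rightarrow> ('a \<Rightarrow> 'b) \<Rightarrow> 'a \<Rightarrow> nat \<Rightarrow> nat \<Rightarrow> real" where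
  "chart_jac c d f p = jac (coord_rep c d f) (chart_map c p)"

lemma diff_in_charts_eq:
  "diff_in_charts c d f p v =
    (\<lambda>j. if j < chart_dim d then \<Sum>i<chart_dim c. chart_jac c d f p j i * v i else 0)"
  unfolding diff_in_charts_def jacobian_apply_def chart_jac_def jac_def ..

lemma diff_in_charts_in_Euclidean_space:
  "diff_in_charts c d f p v \<in> topspace (Euclidean_space (chart_dim d))"
  by (simp add: diff_in_charts_eq topspace_Euclidean_space)

text \<open>Partial derivatives see the coordinate expression only near one point, so expressions in
  different charts can be compared; this serves the passage to restricted charts.\<close>

lemma chart_jac_cong:
  assumes "inj_on (chart_map c) (chart_dom c)" "smooth_in_charts c d f"
    and "\<And>x. x \<in> chart_dom c \<Longrightarrow> f x \<in> chart_dom d \<Longrightarrow> coord_rep c' d' g (chart_map c x) = chart_map d (f x)"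
    and "chart_map c' p' = chart_map c p" "p \<in> chart_dom c" "f p \<in> chart_dom d" "i < chart_dim c"
  shows "chart_jac c' d' g p' j i = chart_jac c d f p j i"
proof -
  have "coord_rep c' d' g y j = coord_rep c d f y j" if "y \<in> coord_dom c d f" for y
  proof -
    obtain x where x: "x \<in> chart_dom c" "f x \<in> chart_dom d" "y = chart_map c x"
      using \<open>y \<in> coord_dom c d f\<close> by (auto simp: coord_dom_def)
    show ?thesis
      unfolding x(3) assms(3)[OF x(1,2)] coord_rep_apply[OF assms(1) x(1)] ..
  qed
  then show ?thesis
    unfolding chart_jac_def jac_def assms(4)
    using euclidean_smooth_onD(1)[OF assms(2)[unfolded smooth_in_charts_def]] assms(5-7)
    by (intro partial_deriv_cong(2)) (auto intro: chart_map_in_coord_dom)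
qed

lemma chart_jac_compose:
  assumes f: "smooth_in_charts c d f" and g: "smooth_in_charts d e g"
    and inj: "inj_on (chart_map c) (chart_dom c)" "inj_on (chart_map d) (chart_dom d)"
    and p: "p \<in> chart_dom c" "f p \<in> chart_dom d" "g (f p) \<in> chart_dom e"
    and i: "i < chart_dim c" and j: "j < chart_dim e"
  shows "chart_jac c e (\<lambda>x. g (f x)) p j i =
    (\<Sum>a<chart_dim d. chart_jac d e g (f p) j a * chart_jac c d f p a i)"
proof -
  define F G where "F = coord_rep c d f" and "G = coord_rep d e g"
  define A B where "A = coord_dom c d f" and "B = coord_dom d e g"
  have F: "euclidean_smooth_on (chart_dim c) (chart_dim d) A F"
    and G: "euclidean_smooth_on (chart_dim d) (chart_dim e) B G"
    using f g by (auto simp: smooth_in_charts_def F_def G_def A_def B_def)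
  \<comment> \<open>The coordinate expressions can be composed only where \<open>F\<close> takes
    values in the domain of \<open>G\<close>; this set is open and contains the point in
    question.\<close>
  define V where "V = {x \<in> A. F x \<in> B}"
  have cm: "continuous_map (subtopology (Euclidean_space (chart_dim c)) A) (Euclidean_space (chart_dim d)) F"
    using euclidean_smooth_onD(2,3,4)[OF F] by (simp add: cm_Euclidean_space_iff_continuous_on inf.absorb2)
  have V: "openin (Euclidean_space (chart_dim c)) V"
    using openin_continuous_map_preimage[OF cm euclidean_smooth_onD(1)[OF G]]
      euclidean_smooth_onD(1,2)[OF F]
    by (simp add: V_def inf.absorb2 openin_trans_full)
  have FV: "euclidean_smooth_on (chart_dim c) (chart_dim d) V F"
    by (rule euclidean_smooth_on_subset[OF F V]) (auto simp: V_def)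
  have Fp: "F (chart_map c p) = chart_map d (f p)"
    unfolding F_def by (rule coord_rep_apply[OF inj(1) p(1)])
  have pV: "chart_map c p \<in> V"
    using p by (auto simp: V_def Fp A_def B_def intro: chart_map_in_coord_dom)
  have eq: "coord_rep c e (\<lambda>x. g (f x)) y = G (F y)" if "y \<in> V" for y
  proof -
    obtain q where q: "q \<in> chart_dom c" "f q \<in> chart_dom d" "y = chart_map c q"
      using \<open>y \<in> V\<close> by (auto simp: V_def A_def coord_dom_def)
    show ?thesis
      unfolding q(3) F_def G_def coord_rep_apply[OF inj(1) q(1)] coord_rep_apply[OF inj(2) q(2)] ..
  qed
  have "chart_jac c e (\<lambda>x. g (f x)) p j i = jac (\<lambda>y. G (F y)) (chart_map c p) j i"
    unfolding chart_jac_def jac_def by (rule partial_deriv_cong(2)[OF V pV i]) (simp add: eq)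
  also have "\<dots> = (\<Sum>a<chart_dim d. jac G (F (chart_map c p)) j a * jac F (chart_map c p) a i)"
    by (rule jacobian_chain[OF G FV _ pV i j]) (simp add: V_def)
  finally show ?thesis
    by (simp add: chart_jac_def Fp F_def[symmetric] G_def[symmetric])
qed

lemma diff_in_charts_compose:
  assumes "smooth_in_charts c d f" "smooth_in_charts d e g"
    and "inj_on (chart_map c) (chart_dom c)" "inj_on (chart_map d) (chart_dom d)"
    and "p \<in> chart_dom c" "f p \<in> chart_dom d" "g (f p) \<in> chart_dom e"
  shows "diff_in_charts d e g (f p) (diff_in_charts c d f p v) = diff_in_charts c e (\<lambda>x. g (f x)) p v"
proof
  fix j
  show "diff_in_charts d e g (f p) (diff_in_charts c d f p v) j = diff_in_charts c e (\<lambda>x. g (f x)) p v j"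
  proof (cases "j < chart_dim e")
    case True
    have "(\<Sum>i<chart_dim c. chart_jac c e (\<lambda>x. g (f x)) p j i * v i)
        = (\<Sum>i<chart_dim c. \<Sum>a<chart_dim d. chart_jac d e g (f p) j a * (chart_jac c d f p a i * v i))"
      using True by (simp add: chart_jac_compose[OF assms] sum_distrib_right mult.assoc)
    also have "\<dots> = (\<Sum>a<chart_dim d. chart_jac d e g (f p) j a * (\<Sum>i<chart_dim c. chart_jac c d f p a i * v i))"
      by (subst sum.swap) (simp add: sum_distrib_left)
    finally show ?thesis
      using True by (simp add: diff_in_charts_eq)
  qed (simp add: diff_in_charts_eq)
qed

lemma chart_jac_id:
  assumes c: "is_chart X c" and p: "p \<in> chart_dom c" and i: "i < chart_dim c"
    and f: "\<And>x. x \<in> chart_dom c \<Longrightarrow> f x = x"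
  shows "chart_jac c c f p j i = (if i = j then 1 else 0)"
proof -
  let ?V = "chart_map c ` chart_dom c"
  note V = is_chartD(4)[OF c]
  have "chart_jac c c f p j i = partial_deriv i (\<lambda>y. y j) (chart_map c p)"
    unfolding chart_jac_def jac_def
    using p f by (intro partial_deriv_cong(2)[OF V _ i]) (auto simp: coord_rep_apply[OF is_chartD(3)[OF c]])
  also have "\<dots> = (if i = j then 1 else 0)"
    by (rule DERIV_has_partial_deriv(2)) (cases "i = j"; simp)
  finally show ?thesis .
qed

lemma diff_in_charts_id:
  assumes "is_chart X c" "p \<in> chart_dom c" "\<And>x. x \<in> chart_dom c \<Longrightarrow> f x = x"
    and "v \<in> topspace (Euclidean_space (chart_dim c))"
  shows "diff_in_charts c c f p v = v"
proof
  fix j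
  have "(\<Sum>i<chart_dim c. chart_jac c c f p j i * v i) = (\<Sum>i<chart_dim c. if i = j then v j else 0)"
    by (rule sum.cong) (auto simp: chart_jac_id[OF assms(1,2) _ assms(3)])
  then show "diff_in_charts c c f p v j = v j"
    using assms(4) by (auto simp: diff_in_charts_eq topspace_Euclidean_space)
qed

lemma smooth_manifoldD:
  assumes "smooth_manifold M"
  shows "Hausdorff_space (mtop M)" "\<And>c. c \<in> matlas M \<Longrightarrow> is_chart (mtop M) c"
    "\<And>p. p \<in> mcarrier M \<Longrightarrow> charts_at M p \<noteq> {}"
    "\<And>c d. c \<in> matlas M \<Longrightarrow> d \<in> matlas M \<Longrightarrow> smooth_in_charts c d (\<lambda>x. x)"
  using assms by (auto simp: smooth_manifold_def charts_at_def)

lemma charts_atD: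
  assumes "smooth_manifold M" "c \<in> charts_at M p"
  shows "c \<in> matlas M" "p \<in> chart_dom c" "is_chart (mtop M) c" "inj_on (chart_map c) (chart_dom c)"
    "p \<in> mcarrier M"
proof -
  show c: "c \<in> matlas M" and p: "p \<in> chart_dom c"
    using assms(2) by (auto simp: charts_at_def)
  show chart: "is_chart (mtop M) c"
    by (rule smooth_manifoldD(2)[OF assms(1) c])
  show "inj_on (chart_map c) (chart_dom c)" "p \<in> mcarrier M"
    using is_chartD(2,3)[OF chart] p by auto
qed

section \<open>Tangent vectors and differentials in coordinates\<close>

lemma tangent_space_nth:
  assumes "v \<in> tangent_space M p" "c \<in> charts_at M p"
  shows "v c \<in> topspace (Euclidean_space (chart_dim c))"
    "\<And>d. d \<in> charts_at M p \<Longrightarrow> v d = diff_in_charts c d (\<lambda>x. x) p (v c)"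
  using assms unfolding tangent_space_def by blast+

lemma tangent_space_eqI:
  assumes "v \<in> tangent_space M p" "w \<in> tangent_space M p" "c \<in> charts_at M p" "v c = w c"
  shows "v = w"
proof
  fix d
  show "v d = w d"
  proof (cases "d \<in> charts_at M p")
    case True
    then show ?thesis
      using tangent_space_nth(2)[OF assms(1,3)] tangent_space_nth(2)[OF assms(2,3)] assms(4) by simp
  next
    case False
    then have "v d = (\<lambda>i. 0)" "w d = (\<lambda>i. 0)"
      using assms(1,2) unfolding tangent_space_def by blast+
    then show ?thesis by simp
  qed
qed

text \<open>A coordinate vector in one chart is carried to the others by the Jacobians of the
  coordinate changes, and the chain rule gives the required compatibility. With
  \<open>tangent_space_eqI\<close>, evaluation at one chart identifies the tangent space with a
  Euclidean space.\<close>

lemma tangent_space_exists: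
  assumes M: "smooth_manifold M" and c: "c \<in> charts_at M p"
    and w: "w \<in> topspace (Euclidean_space (chart_dim c))"
  obtains v where "v \<in> tangent_space M p" "v c = w"
proof
  let ?v = "\<lambda>d. if d \<in> charts_at M p then diff_in_charts c d (\<lambda>x. x) p w else (\<lambda>i. 0)"
  note cD = charts_atD[OF M]
  show "?v \<in> tangent_space M p"
    unfolding tangent_space_def
  proof (safe)
    fix d e assume d: "d \<in> charts_at M p" and e: "e \<in> charts_at M p"
    have "diff_in_charts d e (\<lambda>x. x) p (diff_in_charts c d (\<lambda>x. x) p w) = diff_in_charts c e (\<lambda>x. x) p w"
      using cD[OF c] cD[OF d] cD[OF e]
      by (intro diff_in_charts_compose smooth_manifoldD(4)[OF M])
    then show "?v e = diff_in_charts d e (\<lambda>x. x) p (?v d)"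
      using d e by simp
  qed (auto simp: diff_in_charts_in_Euclidean_space)
  show "?v c = w"
    using c diff_in_charts_id[OF cD(3,2)[OF c] _ w] by simp
qed

lemma smooth_mapD:
  assumes "smooth_map M N f"
  shows "continuous_map (mtop M) (mtop N) f"
    "\<And>c d. c \<in> matlas M \<Longrightarrow> d \<in> matlas N \<Longrightarrow> smooth_in_charts c d f"
    "\<And>p. p \<in> mcarrier M \<Longrightarrow> f p \<in> mcarrier N"
proof -
  show cont: "continuous_map (mtop M) (mtop N) f"
    using assms by (simp add: smooth_map_def)
  show "f p \<in> mcarrier N" if "p \<in> mcarrier M" for p
    using continuous_map_image_subset_topspace[OF cont] that by blast
qed (use assms in \<open>simp add: smooth_map_def\<close>)

text \<open>\<open>differential\<close> uses a chart picked by \<open>SOME\<close>. Any other chart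
  at the point gives the same vector, because the two coordinate vectors differ by the Jacobian of
  the change of charts, which the chain rule absorbs.\<close>

lemma differential_in_charts:
  assumes M: "smooth_manifold M" and N: "smooth_manifold N" and f: "smooth_map M N f"
    and c: "c \<in> charts_at M p" and v: "v \<in> tangent_space M p"
  shows "d \<in> charts_at N (f p) \<Longrightarrow> differential M N f p v d = diff_in_charts c d f p (v c)"
    and "differential M N f p v \<in> tangent_space N (f p)"
proof -
  define c\<^sub>0 where "c\<^sub>0 = (SOME c. c \<in> charts_at M p)"
  have c0: "c\<^sub>0 \<in> charts_at M p"
    unfolding c\<^sub>0_def using c by (rule someI)
  have dif: "differential M N f p v =
      (\<lambda>d. if d \<in> charts_at N (f p) then diff_in_charts c\<^sub>0 d f p (v c\<^sub>0) else (\<lambda>i. 0))"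
    unfolding differential_def c\<^sub>0_def Let_def ..
  show "differential M N f p v d = diff_in_charts c d f p (v c)" if d: "d \<in> charts_at N (f p)" for d
  proof -
    have "diff_in_charts c\<^sub>0 d f p (diff_in_charts c c\<^sub>0 (\<lambda>x. x) p (v c)) = diff_in_charts c d f p (v c)"
      using charts_atD[OF M c] charts_atD[OF M c0] charts_atD[OF N d]
      by (intro diff_in_charts_compose smooth_manifoldD(4)[OF M] smooth_mapD(2)[OF f])
    then show ?thesis
      using tangent_space_nth(2)[OF v c c0] d by (simp add: dif)
  qed
  show "differential M N f p v \<in> tangent_space N (f p)"
    unfolding tangent_space_def
  proof safe
    fix d e assume d: "d \<in> charts_at N (f p)" and e: "e \<in> charts_at N (f p)"
    have "diff_in_charts d e (\<lambda>x. x) (f p) (diff_in_charts c\<^sub>0 d f p (v c\<^sub>0)) = diff_in_charts c\<^sub>0 e f p (v c\<^sub>0)"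
      using charts_atD[OF M c0] charts_atD[OF N d] charts_atD[OF N e]
      by (intro diff_in_charts_compose smooth_manifoldD(4)[OF N] smooth_mapD(2)[OF f])
    then show "differential M N f p v e = diff_in_charts d e (\<lambda>x. x) (f p) (differential M N f p v d)"
      using d e by (simp add: dif)
  qed (auto simp: dif diff_in_charts_in_Euclidean_space)
qed

lemma differential_inj_iff:
  assumes M: "smooth_manifold M" and N: "smooth_manifold N" and f: "smooth_map M N f"
    and c: "c \<in> charts_at M p" and d: "d \<in> charts_at N (f p)"
  shows "inj_on (differential M N f p) (tangent_space M p) \<longleftrightarrow>
    mat_inj (chart_dim d) (chart_dim c) (chart_jac c d f p)"
proof
  assume inj: "inj_on (differential M N f p) (tangent_space M p)"
  show "mat_inj (chart_dim d) (chart_dim c) (chart_jac c d f p)"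
    unfolding mat_inj_def
  proof (intro allI impI)
    fix w i assume w: "\<forall>j<chart_dim d. (\<Sum>i<chart_dim c. chart_jac c d f p j i * w i) = 0" and i: "i < chart_dim c"
    \<comment> \<open>\<open>mat_inj\<close> speaks of vectors with arbitrary entries beyond the
      size, whereas coordinates of tangent vectors vanish there; hence the truncation.\<close>
    define w' where "w' i = (if i < chart_dim c then w i else 0)" for i
    have "w' \<in> topspace (Euclidean_space (chart_dim c))" by (simp add: w'_def topspace_Euclidean_space)
    then obtain v where v: "v \<in> tangent_space M p" "v c = w'"
      using tangent_space_exists[OF M c] by blast
    obtain z where z: "z \<in> tangent_space M p" "z c = (\<lambda>_. 0)"
      using tangent_space_exists[OF M c, of "\<lambda>_. 0"] by (auto simp: topspace_Euclidean_space)
    have "(\<Sum>i<chart_dim c. chart_jac c d f p j i * w' i) = (\<Sum>i<chart_dim c. chart_jac c d f p j i * w i)" for j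
      by (rule sum.cong) (auto simp: w'_def)
    then have "diff_in_charts c d f p (v c) = diff_in_charts c d f p (z c)"
      using w by (simp add: v z diff_in_charts_eq fun_eq_iff)
    then have "differential M N f p v = differential M N f p z"
      using differential_in_charts[OF M N f c] v z d by (intro tangent_space_eqI[OF _ _ d]) auto
    then have "v = z"
      using inj v(1) z(1) by (simp add: inj_on_eq_iff)
    then have "w' = (\<lambda>_. 0)" using v(2) z(2) by metis
    then have "w' i = 0" by simp
    then show "w i = 0" using i by (simp add: w'_def)
  qed
next
  assume inj: "mat_inj (chart_dim d) (chart_dim c) (chart_jac c d f p)"
  show "inj_on (differential M N f p) (tangent_space M p)"
  proof (rule inj_onI)
    fix v w assume v: "v \<in> tangent_space M p" and w: "w \<in> tangent_space M p"
      and eq: "differential M N f p v = differential M N f p w"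
    have "diff_in_charts c d f p (v c) = diff_in_charts c d f p (w c)"
      using differential_in_charts(1)[OF M N f c v d] differential_in_charts(1)[OF M N f c w d] eq by simp
    then have "(\<Sum>i<chart_dim c. chart_jac c d f p j i * v c i) = (\<Sum>i<chart_dim c. chart_jac c d f p j i * w c i)"
      if "j < chart_dim d" for j
      using that unfolding diff_in_charts_eq by (auto dest: fun_cong[of _ _ j])
    then have "\<forall>j<chart_dim d. (\<Sum>i<chart_dim c. chart_jac c d f p j i * (v c i - w c i)) = 0"
      by (simp add: right_diff_distrib sum_subtractf)
    then have "\<forall>i<chart_dim c. v c i - w c i = 0"
      using inj[unfolded mat_inj_def, rule_format, of "\<lambda>i. v c i - w c i"] by blast
    moreover have "v c i = w c i" if "\<not> i < chart_dim c" for i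
      using tangent_space_nth(1)[OF v c] tangent_space_nth(1)[OF w c] that
      by (simp add: topspace_Euclidean_space)
    ultimately have "v c i = w c i" for i by (cases "i < chart_dim c") simp_all
    then have "v c = w c" ..
    then show "v = w" by (rule tangent_space_eqI[OF v w c])
  qed
qed

definition mat_append :: "nat \<Rightarrow> (nat \<Rightarrow> nat \<Rightarrow> real) \<Rightarrow> (nat \<Rightarrow> nat \<Rightarrow> real) \<Rightarrow> nat \<Rightarrow> nat \<Rightarrow> real" where
  "mat_append k A B = (\<lambda>j i. if i < k then A j i else B j (i - k))"

lemma mat_surj_append_iff:
  "mat_surj m (k + l) (mat_append k A B) \<longleftrightarrow>
    (\<forall>w. \<exists>v v'. \<forall>j<m. (\<Sum>i<k. A j i * v i) + (\<Sum>i<l. B j i * v' i) = w j)"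
proof -
  have "(\<exists>v. \<forall>j<m. (\<Sum>i<k + l. mat_append k A B j i * v i) = w j) \<longleftrightarrow>
      (\<exists>v v'. \<forall>j<m. (\<Sum>i<k. A j i * v i) + (\<Sum>i<l. B j i * v' i) = w j)" for w
  proof
    assume "\<exists>v. \<forall>j<m. (\<Sum>i<k + l. mat_append k A B j i * v i) = w j"
    then obtain v where "\<forall>j<m. (\<Sum>i<k + l. mat_append k A B j i * v i) = w j" by blast
    then show "\<exists>v v'. \<forall>j<m. (\<Sum>i<k. A j i * v i) + (\<Sum>i<l. B j i * v' i) = w j"
      by (intro exI[of _ v] exI[of _ "\<lambda>i. v (k + i)"]) (simp add: sum_lessThan_add mat_append_def)
  next
    assume "\<exists>v v'. \<forall>j<m. (\<Sum>i<k. A j i * v i) + (\<Sum>i<l. B j i * v' i) = w j"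
    then obtain v v' where "\<forall>j<m. (\<Sum>i<k. A j i * v i) + (\<Sum>i<l. B j i * v' i) = w j" by blast
    then show "\<exists>v. \<forall>j<m. (\<Sum>i<k + l. mat_append k A B j i * v i) = w j"
      by (intro exI[of _ "\<lambda>i. if i < k then v i else v' (i - k)"]) (simp add: sum_lessThan_add mat_append_def)
  qed
  then show ?thesis by (simp add: mat_surj_def)
qed

text \<open>The sum of two subspaces becomes the image of a single block matrix, to which the
  openness of surjectivity applies. The inclusion appears as an arbitrary map \<open>g\<close> with
  its own base point \<open>q\<close>, so that both summands are treated alike.\<close>

lemma tangent_sum_eq_iff:
  assumes K: "smooth_manifold K" and N: "smooth_manifold N" and M: "smooth_manifold M"
    and f: "smooth_map K M f" and g: "smooth_map N M g" and q: "f p = g q"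
    and c: "c \<in> charts_at K p" and e: "e \<in> charts_at N q" and d: "d \<in> charts_at M (f p)"
  shows "{tangent_add (differential K M f p v) (differential N M g q w) | v w.
           v \<in> tangent_space K p \<and> w \<in> tangent_space N q} = tangent_space M (f p) \<longleftrightarrow>
    mat_surj (chart_dim d) (chart_dim c + chart_dim e)
      (mat_append (chart_dim c) (chart_jac c d f p) (chart_jac e d g q))"
    (is "?S = ?T \<longleftrightarrow> ?R")
proof -
  have add_in: "tangent_add v w \<in> ?T" if v: "v \<in> ?T" and w: "w \<in> ?T" for v w
    unfolding tangent_space_def tangent_add_def
  proof (safe)
    fix c assume "c \<notin> charts_at M (f p)"
    then show "(\<lambda>i. v c i + w c i) = (\<lambda>i. 0)"
      using v w unfolding tangent_space_def by simp
  next
    fix c assume "c \<in> charts_at M (f p)"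
    then show "(\<lambda>i. v c i + w c i) \<in> topspace (Euclidean_space (chart_dim c))"
      using tangent_space_nth(1)[OF v] tangent_space_nth(1)[OF w] by (simp add: topspace_Euclidean_space)
  next
    fix c d assume c: "c \<in> charts_at M (f p)" and d: "d \<in> charts_at M (f p)"
    show "(\<lambda>i. v d i + w d i) = diff_in_charts c d (\<lambda>x. x) (f p) (\<lambda>i. v c i + w c i)"
      unfolding tangent_space_nth(2)[OF v c d] tangent_space_nth(2)[OF w c d]
      by (simp add: diff_in_charts_eq fun_eq_iff distrib_left sum.distrib)
  qed
  have d': "d \<in> charts_at M (g q)" using d q by simp
  have sum_d: "tangent_add (differential K M f p v) (differential N M g q w) d =
      (\<lambda>j. if j < chart_dim d then (\<Sum>i<chart_dim c. chart_jac c d f p j i * v c i)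
         + (\<Sum>i<chart_dim e. chart_jac e d g q j i * w e i) else 0)"
    if "v \<in> tangent_space K p" "w \<in> tangent_space N q" for v w
    using differential_in_charts(1)[OF K M f c that(1) d] differential_in_charts(1)[OF N M g e that(2) d']
    by (auto simp: tangent_add_def diff_in_charts_eq fun_eq_iff)
  have sub: "?S \<subseteq> ?T"
    using differential_in_charts(2)[OF K M f c] differential_in_charts(2)[OF N M g e] q add_in by auto
  show ?thesis
  proof
    assume eq: "?S = ?T"
    show ?R
      unfolding mat_surj_append_iff
    proof
      fix y :: "nat \<Rightarrow> real"
      obtain z where z: "z \<in> ?T" "z d = (\<lambda>j. if j < chart_dim d then y j else 0)"
        using tangent_space_exists[OF M d, of "\<lambda>j. if j < chart_dim d then y j else 0"]
        by (auto simp: topspace_Euclidean_space)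
      then obtain v w where vw: "v \<in> tangent_space K p" "w \<in> tangent_space N q"
        "z = tangent_add (differential K M f p v) (differential N M g q w)"
        using eq by blast
      have "(\<Sum>i<chart_dim c. chart_jac c d f p j i * v c i) + (\<Sum>i<chart_dim e. chart_jac e d g q j i * w e i) = y j"
        if "j < chart_dim d" for j
        using fun_cong[OF sum_d[OF vw(1,2)], of j] fun_cong[OF z(2), of j] vw(3) that by simp
      then show "\<exists>v v'. \<forall>j<chart_dim d. (\<Sum>i<chart_dim c. chart_jac c d f p j i * v i)
          + (\<Sum>i<chart_dim e. chart_jac e d g q j i * v' i) = y j"
        by blast
    qed
  next
    assume R: ?R
    have "z \<in> ?S" if z: "z \<in> ?T" for z
    proof -
      obtain x x' where x: "\<forall>j<chart_dim d. (\<Sum>i<chart_dim c. chart_jac c d f p j i * x i)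
          + (\<Sum>i<chart_dim e. chart_jac e d g q j i * x' i) = z d j"
        using R unfolding mat_surj_append_iff by blast
      obtain v where v: "v \<in> tangent_space K p" "v c = (\<lambda>i. if i < chart_dim c then x i else 0)"
        using tangent_space_exists[OF K c, of "\<lambda>i. if i < chart_dim c then x i else 0"]
        by (auto simp: topspace_Euclidean_space)
      obtain w where w: "w \<in> tangent_space N q" "w e = (\<lambda>i. if i < chart_dim e then x' i else 0)"
        using tangent_space_exists[OF N e, of "\<lambda>i. if i < chart_dim e then x' i else 0"]
        by (auto simp: topspace_Euclidean_space)
      let ?z = "tangent_add (differential K M f p v) (differential N M g q w)"
      have inS: "?z \<in> ?S" using v(1) w(1) by blast
      have "(\<Sum>i<chart_dim c. chart_jac c d f p j i * v c i) = (\<Sum>i<chart_dim c. chart_jac c d f p j i * x i)" for j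
        by (rule sum.cong) (auto simp: v)
      moreover have "(\<Sum>i<chart_dim e. chart_jac e d g q j i * w e i) = (\<Sum>i<chart_dim e. chart_jac e d g q j i * x' i)" for j
        by (rule sum.cong) (auto simp: w)
      ultimately have "?z d = z d"
        using tangent_space_nth(1)[OF z d] x
        unfolding sum_d[OF v(1) w(1)] by (auto simp: fun_eq_iff topspace_Euclidean_space)
      then have "?z = z"
        using inS sub z by (intro tangent_space_eqI[OF _ _ d]) auto
      then show "z \<in> ?S" using inS by simp
    qed
    then show "?S = ?T" using sub by blast
  qed
qed

lemma differential_surj_iff:
  assumes M: "smooth_manifold M" and N: "smooth_manifold N" and f: "smooth_map M N f"
    and c: "c \<in> charts_at M p" and d: "d \<in> charts_at N (f p)"
  shows "differential M N f p ` tangent_space M p = tangent_space N (f p) \<longleftrightarrow>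
    mat_surj (chart_dim d) (chart_dim c) (chart_jac c d f p)"
proof
  assume eq: "differential M N f p ` tangent_space M p = tangent_space N (f p)"
  show "mat_surj (chart_dim d) (chart_dim c) (chart_jac c d f p)"
    unfolding mat_surj_def
  proof
    fix y :: "nat \<Rightarrow> real"
    obtain z where z: "z \<in> tangent_space N (f p)" "z d = (\<lambda>j. if j < chart_dim d then y j else 0)"
      using tangent_space_exists[OF N d, of "\<lambda>j. if j < chart_dim d then y j else 0"]
      by (auto simp: topspace_Euclidean_space)
    then obtain v where v: "v \<in> tangent_space M p" "z = differential M N f p v"
      using eq by blast
    have "(\<Sum>i<chart_dim c. chart_jac c d f p j i * v c i) = y j" if "j < chart_dim d" for j
      using differential_in_charts(1)[OF M N f c v(1) d] z(2) v(2) that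
      by (simp add: diff_in_charts_eq fun_eq_iff split: if_splits)
    then show "\<exists>v. \<forall>j<chart_dim d. (\<Sum>i<chart_dim c. chart_jac c d f p j i * v i) = y j"
      by blast
  qed
next
  assume R: "mat_surj (chart_dim d) (chart_dim c) (chart_jac c d f p)"
  have "z \<in> differential M N f p ` tangent_space M p" if z: "z \<in> tangent_space N (f p)" for z
  proof -
    obtain x where x: "\<forall>j<chart_dim d. (\<Sum>i<chart_dim c. chart_jac c d f p j i * x i) = z d j"
      using R unfolding mat_surj_def by blast
    obtain v where v: "v \<in> tangent_space M p" "v c = (\<lambda>i. if i < chart_dim c then x i else 0)"
      using tangent_space_exists[OF M c, of "\<lambda>i. if i < chart_dim c then x i else 0"]
      by (auto simp: topspace_Euclidean_space)
    have "(\<Sum>i<chart_dim c. chart_jac c d f p j i * v c i) = (\<Sum>i<chart_dim c. chart_jac c d f p j i * x i)" for j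
      by (rule sum.cong) (auto simp: v)
    then have "differential M N f p v d = z d"
      using tangent_space_nth(1)[OF z d] x
      unfolding differential_in_charts(1)[OF M N f c v(1) d] diff_in_charts_eq
      by (auto simp: fun_eq_iff topspace_Euclidean_space)
    then have "differential M N f p v = z"
      using differential_in_charts(2)[OF M N f c v(1)] z by (intro tangent_space_eqI[OF _ _ d]) auto
    then show ?thesis using v by blast
  qed
  then show "differential M N f p ` tangent_space M p = tangent_space N (f p)"
    using differential_in_charts(2)[OF M N f c] by blast
qed

section \<open>Maps with bijective differentials\<close>

lemma Ck_on_empty: "Ck_on m k {} f"
  by (induction k arbitrary: f) (simp_all add: continuous_map_Euclidean_subtopology_iff)

lemma mat_inj_left_inverse:
  assumes "\<And>i j. i < k \<Longrightarrow> j < k \<Longrightarrow> (\<Sum>a<m. B j a * A a i) = (if i = j then 1 else 0)"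
  shows "mat_inj m k A"
  unfolding mat_inj_def
proof (intro allI impI)
  fix v j assume v: "\<forall>a<m. (\<Sum>i<k. A a i * v i) = 0" and j: "j < k"
  have "v j = (\<Sum>i<k. if i = j then v i else 0)"
    using j by simp
  also have "\<dots> = (\<Sum>i<k. (\<Sum>a<m. B j a * A a i) * v i)"
    using assms j by (intro sum.cong) auto
  also have "\<dots> = (\<Sum>a<m. B j a * (\<Sum>i<k. A a i * v i))"
    by (simp add: sum_distrib_left sum_distrib_right mult.assoc) (rule sum.swap)
  finally show "v j = 0" using v by simp
qed

lemma mat_surj_right_inverse:
  assumes "\<And>i j. i < m \<Longrightarrow> j < m \<Longrightarrow> (\<Sum>a<k. A j a * B a i) = (if i = j then 1 else 0)"
  shows "mat_surj m k A"
  unfolding mat_surj_iff_transpose_inj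
  by (rule mat_inj_left_inverse[where B = "\<lambda>i a. B a i"]) (use assms in \<open>auto simp: mult.commute\<close>)

text \<open>Bijectivity of the differential, stated for every pair of charts at the two points so
  that it can be read off in whichever charts a later argument uses.\<close>

definition regular_in_charts :: "'a manifold \<Rightarrow> 'b manifold \<Rightarrow> ('a \<Rightarrow> 'b) \<Rightarrow> 'a \<Rightarrow> bool" where
  "regular_in_charts M N f p \<longleftrightarrow> (\<forall>c\<in>charts_at M p. \<forall>d\<in>charts_at N (f p).
     mat_inj (chart_dim d) (chart_dim c) (chart_jac c d f p) \<and>
     mat_surj (chart_dim d) (chart_dim c) (chart_jac c d f p))"

lemma immersion_submersion_imp_regular:
  assumes M: "smooth_manifold M" and N: "smooth_manifold N"
    and "immersion M N f" "submersion M N f" "p \<in> mcarrier M"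
  shows "regular_in_charts M N f p"
proof -
  have f: "smooth_map M N f" using assms(3) by (simp add: immersion_def)
  have "inj_on (differential M N f p) (tangent_space M p)"
    "differential M N f p ` tangent_space M p = tangent_space N (f p)"
    using assms(3-5) by (auto simp: immersion_def submersion_def)
  then show ?thesis
    unfolding regular_in_charts_def
    using differential_inj_iff[OF M N f] differential_surj_iff[OF M N f] by blast
qed

text \<open>Both composites with the inverse are identities, so by the chain rule the Jacobians of
  the map and of its inverse are mutually inverse matrices.\<close>

lemma diffeomorphism_imp_regular:
  assumes M: "smooth_manifold M" and N: "smooth_manifold N" and f: "diffeomorphism M N f"
    and p: "p \<in> mcarrier M"
  shows "regular_in_charts M N f p"
  unfolding regular_in_charts_def
proof (intro ballI)
  fix c d assume c: "c \<in> charts_at M p" and d: "d \<in> charts_at N (f p)"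
  obtain g where sf: "smooth_map M N f" and g: "smooth_map N M g"
    and gf: "\<And>x. x \<in> mcarrier M \<Longrightarrow> g (f x) = x" and fg: "\<And>y. y \<in> mcarrier N \<Longrightarrow> f (g y) = y"
    using f unfolding diffeomorphism_def by blast
  note cD = charts_atD[OF M c] and dD = charts_atD[OF N d]
  have 1: "(\<Sum>a<chart_dim d. chart_jac d c g (f p) j a * chart_jac c d f p a i) = (if i = j then 1 else 0)"
    if "i < chart_dim c" "j < chart_dim c" for i j
  proof -
    have "chart_jac c c (\<lambda>x. g (f x)) p j i = (\<Sum>a<chart_dim d. chart_jac d c g (f p) j a * chart_jac c d f p a i)"
      using cD dD gf[OF p] that by (intro chart_jac_compose smooth_mapD(2)[OF sf] smooth_mapD(2)[OF g]) auto
    moreover have "chart_jac c c (\<lambda>x. g (f x)) p j i = (if i = j then 1 else 0)"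
      by (rule chart_jac_id[OF cD(3,2) that(1)]) (use gf is_chartD(2)[OF cD(3)] in blast)
    ultimately show ?thesis by simp
  qed
  have 2: "(\<Sum>a<chart_dim c. chart_jac c d f p j a * chart_jac d c g (f p) a i) = (if i = j then 1 else 0)"
    if "i < chart_dim d" "j < chart_dim d" for i j
  proof -
    have "chart_jac d d (\<lambda>x. f (g x)) (f p) j i =
        (\<Sum>a<chart_dim c. chart_jac c d f (g (f p)) j a * chart_jac d c g (f p) a i)"
      using cD dD gf[OF p] that by (intro chart_jac_compose smooth_mapD(2)[OF sf] smooth_mapD(2)[OF g]) auto
    moreover have "chart_jac d d (\<lambda>x. f (g x)) (f p) j i = (if i = j then 1 else 0)"
      by (rule chart_jac_id[OF dD(3,2) that(1)]) (use fg is_chartD(2)[OF dD(3)] in blast)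
    ultimately show ?thesis using gf[OF p] by simp
  qed
  show "mat_inj (chart_dim d) (chart_dim c) (chart_jac c d f p) \<and>
      mat_surj (chart_dim d) (chart_dim c) (chart_jac c d f p)"
    using mat_inj_left_inverse[OF 1] mat_surj_right_inverse[OF 2] by blast
qed

lemma openin_chart_domains:
  assumes f: "continuous_map X Y f" and "openin X W" "openin Y V"
  shows "openin X {x \<in> W. f x \<in> V}"
proof -
  have "{x \<in> W. f x \<in> V} = W \<inter> {x \<in> topspace X. f x \<in> V}"
    using openin_subset[OF assms(2)] by blast
  then show ?thesis
    using openin_continuous_map_preimage[OF f assms(3)] assms(2) by auto
qed

text \<open>Regularity forces the two charts to have equal dimension; with that, injectivity in
  coordinates gives openness by invariance of domain.\<close>

lemma regular_injective_open_image:
  assumes M: "smooth_manifold M" and N: "smooth_manifold N" and f: "smooth_map M N f"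
    and reg: "\<And>p. p \<in> W \<Longrightarrow> regular_in_charts M N f p"
    and W: "openin (mtop M) W" and inj: "inj_on f W"
  shows "openin (mtop N) (f ` W)"
proof (subst openin_subopen, intro ballI)
  fix y assume "y \<in> f ` W"
  then obtain p where p: "p \<in> W" "y = f p" by blast
  then have pM: "p \<in> mcarrier M" using openin_subset[OF W] by blast
  obtain c d where c: "c \<in> charts_at M p" and d: "d \<in> charts_at N (f p)"
    using smooth_manifoldD(3)[OF M pM] smooth_manifoldD(3)[OF N smooth_mapD(3)[OF f pM]] by blast
  note cD = charts_atD[OF M c] and dD = charts_atD[OF N d]
  have dim: "chart_dim c = chart_dim d"
    using reg[OF p(1)] c d mat_bij_imp_eq unfolding regular_in_charts_def by blast
  define A where "A = {x \<in> chart_dom c \<inter> W. f x \<in> chart_dom d}"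
  have A: "openin (mtop M) A"
    unfolding A_def using smooth_mapD(1)[OF f] is_chartD(1)[OF cD(3)] is_chartD(1)[OF dD(3)] W
    by (intro openin_chart_domains) auto
  define F where "F = coord_rep c d f"
  have F: "F (chart_map c x) = chart_map d (f x)" if "x \<in> A" for x
    using that coord_rep_apply[OF cD(4)] by (auto simp: A_def F_def)
  have FA: "F ` chart_map c ` A = chart_map d ` f ` A"
    using F by (auto simp: image_iff)
  have cA: "openin (Euclidean_space (chart_dim c)) (chart_map c ` A)"
    using is_chartD(7)[OF cD(3) A] by (auto simp: A_def)
  have sub: "chart_map c ` A \<subseteq> coord_dom c d f"
    by (auto simp: A_def coord_dom_def)
  have "euclidean_smooth_on (chart_dim c) (chart_dim d) (coord_dom c d f) F"
    using smooth_mapD(2)[OF f cD(1) dD(1)] by (simp add: smooth_in_charts_def F_def)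
  from euclidean_smooth_on_subset[OF this cA sub]
  have Fs: "euclidean_smooth_on (chart_dim c) (chart_dim d) (chart_map c ` A) F" .
  have "inj_on F (chart_map c ` A)"
  proof (rule inj_onI)
    fix y z assume "y \<in> chart_map c ` A" "z \<in> chart_map c ` A" and eq: "F y = F z"
    then obtain a b where ab: "a \<in> A" "b \<in> A" "y = chart_map c a" "z = chart_map c b" by blast
    then have "f a = f b"
      using eq F dD(4) by (auto simp: A_def dest: inj_onD)
    then show "y = z" using ab inj by (auto simp: A_def dest: inj_onD)
  qed
  moreover have "continuous_map (subtopology (Euclidean_space (chart_dim d)) (chart_map c ` A))
      (Euclidean_space (chart_dim d)) F"
    using euclidean_smooth_onD(2,3,4)[OF Fs] by (simp add: cm_Euclidean_space_iff_continuous_on dim inf.absorb2)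
  ultimately have O: "openin (Euclidean_space (chart_dim d)) (chart_map d ` f ` A)"
    using cA unfolding FA[symmetric] by (intro invariance_of_domain_Euclidean_space) (auto simp: dim)
  \<comment> \<open>The image of \<open>A\<close> is recovered as the preimage of its coordinate
    image, so that openness comes back through continuity of the chart.\<close>
  have img: "f ` A = {y \<in> topspace (subtopology (mtop N) (chart_dom d)). chart_map d y \<in> chart_map d ` f ` A}"
    using is_chartD(2,3)[OF dD(3)] by (auto simp: A_def dest: inj_onD)
  have "openin (subtopology (mtop N) (chart_dom d)) (f ` A)"
    by (subst img) (rule openin_continuous_map_preimage[OF is_chartD(6)[OF dD(3)] O])
  then have "openin (mtop N) (f ` A)"
    using is_chartD(1)[OF dD(3)] by (rule openin_trans_full)
  then show "\<exists>T. openin (mtop N) T \<and> y \<in> T \<and> T \<subseteq> f ` W"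
    using p cD dD by (intro exI[of _ "f ` A"]) (auto simp: A_def)
qed

text \<open>Open images make the inverse continuous; in charts it is the inverse of the coordinate
  expression, whose Jacobian is invertible everywhere, so \<open>euclidean_inverse_smooth\<close>
  applies.\<close>

lemma regular_bijection_imp_diffeomorphism:
  assumes M: "smooth_manifold M" and N: "smooth_manifold N" and f: "smooth_map M N f"
    and reg: "\<And>p. p \<in> mcarrier M \<Longrightarrow> regular_in_charts M N f p"
    and bij: "bij_betw f (mcarrier M) (mcarrier N)"
  shows "diffeomorphism M N f"
proof -
  define g where "g = inv_into (mcarrier M) f"
  have gf: "g (f x) = x" if "x \<in> mcarrier M" for x
    using bij that by (simp add: g_def bij_betw_inv_into_left)
  have fg: "f (g y) = y" if "y \<in> mcarrier N" for y
    using bij that by (simp add: g_def bij_betw_inv_into_right)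
  have gM: "g y \<in> mcarrier M" if "y \<in> mcarrier N" for y
    using bij_betw_inv_into[OF bij] that by (auto simp: g_def bij_betw_def)
  have cont: "continuous_map (mtop N) (mtop M) g"
    unfolding continuous_map_def
  proof (intro conjI allI impI)
    show "g \<in> mcarrier N \<rightarrow> mcarrier M" using gM by blast
    fix W assume W: "openin (mtop M) W"
    then have WM: "W \<subseteq> mcarrier M" by (rule openin_subset)
    then have "{y \<in> mcarrier N. g y \<in> W} = f ` W"
      using gf fg smooth_mapD(3)[OF f] by force
    moreover have "openin (mtop N) (f ` W)"
      using bij WM by (intro regular_injective_open_image[OF M N f reg W])
        (auto simp: bij_betw_def intro: inj_on_subset)
    ultimately show "openin (mtop N) {y \<in> mcarrier N. g y \<in> W}" by simp
  qed
  have "smooth_in_charts d c g" if d: "d \<in> matlas N" and c: "c \<in> matlas M" for c d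
  \<comment> \<open>Charts that the map does not relate may have different dimensions, so they
    cannot be handled by inverting a Jacobian.\<close>
  proof (cases "coord_dom d c g = {}")
    case True
    then show ?thesis
      unfolding smooth_in_charts_def euclidean_smooth_on_def by (simp add: Ck_on_empty)
  next
    case False
    note cc = smooth_manifoldD(2)[OF M c] and cd = smooth_manifoldD(2)[OF N d]
    have at: "c \<in> charts_at M p" "d \<in> charts_at N (f p)" if "p \<in> chart_dom c" "f p \<in> chart_dom d" for p
      using that c d by (auto simp: charts_at_def)
    have regc: "mat_inj (chart_dim d) (chart_dim c) (chart_jac c d f p)"
      "mat_surj (chart_dim d) (chart_dim c) (chart_jac c d f p)"
      if "p \<in> chart_dom c" "f p \<in> chart_dom d" for p
      using reg[of p] at[OF that] is_chartD(2)[OF cc] that(1) unfolding regular_in_charts_def by blast+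
    define F where "F = coord_rep c d f"
    define U where "U = coord_dom c d f"
    have F: "F (chart_map c x) = chart_map d (f x)" if "x \<in> chart_dom c" for x
      using coord_rep_apply[OF is_chartD(3)[OF cc] that] by (simp add: F_def)
    have dom: "coord_dom d c g = F ` U"
    proof -
      have "{y \<in> chart_dom d. g y \<in> chart_dom c} = f ` {x \<in> chart_dom c. f x \<in> chart_dom d}"
        using gf fg is_chartD(2)[OF cc] is_chartD(2)[OF cd] by force
      then have "coord_dom d c g = chart_map d ` f ` {x \<in> chart_dom c. f x \<in> chart_dom d}"
        by (simp add: coord_dom_def)
      also have "\<dots> = F ` U"
        unfolding U_def coord_dom_def image_image by (rule image_cong) (auto simp: F)
      finally show ?thesis .
    qed
    have "U \<noteq> {}" using False dom by simp
    then obtain p where p: "p \<in> chart_dom c" "f p \<in> chart_dom d"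
      by (auto simp: U_def coord_dom_def)
    have dim: "chart_dim c = chart_dim d"
      using mat_bij_imp_eq regc[OF p] by blast
    have Fs: "euclidean_smooth_on (chart_dim d) (chart_dim d) U F"
      using smooth_mapD(2)[OF f c d] by (simp add: smooth_in_charts_def F_def U_def dim)
    have injF: "inj_on F U"
    proof (rule inj_onI)
      fix y z assume "y \<in> U" "z \<in> U" and eq: "F y = F z"
      then obtain a b where ab: "a \<in> chart_dom c" "f a \<in> chart_dom d" "b \<in> chart_dom c" "f b \<in> chart_dom d"
        "y = chart_map c a" "z = chart_map c b" by (auto simp: U_def coord_dom_def)
      then have "f a = f b"
        using eq F inj_onD[OF is_chartD(3)[OF cd]] by simp
      moreover have "a \<in> mcarrier M" "b \<in> mcarrier M"
        using ab is_chartD(2)[OF cc] by blast+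
      ultimately have "a = b"
        using inj_onD[OF bij_betw_imp_inj_on[OF bij]] by blast
      then show "y = z" using ab by simp
    qed
    have "euclidean_smooth_on (chart_dim d) (chart_dim d) (F ` U) (inv_into U F)"
    proof (rule euclidean_inverse_smooth[OF Fs injF])
      fix x assume "x \<in> U"
      then obtain a where "a \<in> chart_dom c" "f a \<in> chart_dom d" "x = chart_map c a"
        by (auto simp: U_def coord_dom_def)
      then show "mat_inj (chart_dim d) (chart_dim d) (jac F x)"
        using regc(1)[of a] by (simp add: dim chart_jac_def F_def)
    qed
    moreover have "inv_into U F y = coord_rep d c g y" if "y \<in> F ` U" for y
    proof -
      obtain x where x: "x \<in> U" "y = F x" using \<open>y \<in> F ` U\<close> by blast
      then obtain a where a: "a \<in> chart_dom c" "f a \<in> chart_dom d" "x = chart_map c a"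
        by (auto simp: U_def coord_dom_def)
      have "coord_rep d c g y = chart_map c (g (f a))"
        unfolding x(2) a(3) F[OF a(1)] by (rule coord_rep_apply[OF is_chartD(3)[OF cd] a(2)])
      also have "\<dots> = x" using gf[of a] a is_chartD(2)[OF cc] by auto
      finally show ?thesis using x injF by simp
    qed
    ultimately have "euclidean_smooth_on (chart_dim d) (chart_dim d) (F ` U) (coord_rep d c g)"
      by (rule euclidean_smooth_on_cong)
    then show ?thesis
      by (simp add: smooth_in_charts_def dom dim)
  qed
  then have "smooth_map N M g"
    using cont by (simp add: smooth_map_def)
  then show ?thesis
    unfolding diffeomorphism_def using f gf fg by blast
qed

section \<open>Restriction to open submanifolds, and etale maps\<close>

definition restrict_chart :: "'a chart \<Rightarrow> 'a set \<Rightarrow> 'a chart" where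
  "restrict_chart c W = Chart (chart_dim c) (chart_dom c \<inter> W) (chart_map c)"

lemma restrict_chart_sel [simp]:
  "chart_dim (restrict_chart c W) = chart_dim c" "chart_dom (restrict_chart c W) = chart_dom c \<inter> W"
  "chart_map (restrict_chart c W) = chart_map c"
  by (simp_all add: restrict_chart_def)

lemma open_submanifold_sel [simp]:
  "mtop (open_submanifold M W) = subtopology (mtop M) W"
  "matlas (open_submanifold M W) = (\<lambda>c. restrict_chart c W) ` matlas M"
  by (simp_all add: open_submanifold_def restrict_chart_def)

lemma coord_rep_restrict_chart:
  assumes "inj_on (chart_map c) (chart_dom c)" "x \<in> chart_dom c \<inter> W"
  shows "coord_rep (restrict_chart c W) (restrict_chart d V) f (chart_map c x) = chart_map d (f x)"
  using coord_rep_apply[of "restrict_chart c W" x "restrict_chart d V" f] assms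
  by (auto intro: inj_on_subset)

lemma smooth_in_charts_restrict:
  assumes c: "is_chart X c" and f: "smooth_in_charts c d f"
    and W: "openin X {x \<in> chart_dom c \<inter> W. f x \<in> chart_dom d \<inter> V}"
  shows "smooth_in_charts (restrict_chart c W) (restrict_chart d V) f"
proof -
  let ?A = "{x \<in> chart_dom c \<inter> W. f x \<in> chart_dom d \<inter> V}"
  have "openin (Euclidean_space (chart_dim c)) (chart_map c ` ?A)"
    by (rule is_chartD(7)[OF c W]) auto
  then have "euclidean_smooth_on (chart_dim c) (chart_dim d) (chart_map c ` ?A) (coord_rep c d f)"
    by (rule euclidean_smooth_on_subset[OF f[unfolded smooth_in_charts_def]]) (auto simp: coord_dom_def)
  moreover have "coord_rep c d f y = coord_rep (restrict_chart c W) (restrict_chart d V) f y"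
    if "y \<in> chart_map c ` ?A" for y
  proof -
    obtain x where x: "x \<in> chart_dom c \<inter> W" "y = chart_map c x"
      using \<open>y \<in> chart_map c ` ?A\<close> by blast
    show ?thesis
      unfolding x(2) coord_rep_restrict_chart[OF is_chartD(3)[OF c] x(1)]
      by (rule coord_rep_apply[OF is_chartD(3)[OF c]]) (use x(1) in blast)
  qed
  ultimately have "euclidean_smooth_on (chart_dim c) (chart_dim d) (chart_map c ` ?A)
      (coord_rep (restrict_chart c W) (restrict_chart d V) f)"
    by (rule euclidean_smooth_on_cong)
  then show ?thesis
    by (simp add: smooth_in_charts_def coord_dom_def)
qed

lemma is_chart_restrict:
  assumes c: "is_chart X c" and W: "openin X W"
  shows "is_chart (subtopology X W) (restrict_chart c W)"
proof -
  let ?D = "chart_dom c \<inter> W"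
  have D: "openin X ?D" using is_chartD(1)[OF c] W by blast
  have O: "openin (Euclidean_space (chart_dim c)) (chart_map c ` ?D)"
    by (rule is_chartD(7)[OF c D]) auto
  have "homeomorphic_map (subtopology X (chart_dom c))
      (subtopology (Euclidean_space (chart_dim c)) (chart_map c ` chart_dom c)) (chart_map c)"
    using c by (simp add: is_chart_def)
  moreover have "chart_map c ` (topspace (subtopology X (chart_dom c)) \<inter> ?D) =
      topspace (subtopology (Euclidean_space (chart_dim c)) (chart_map c ` chart_dom c)) \<inter> chart_map c ` ?D"
    using is_chartD(2,5)[OF c] by (auto; blast)
  ultimately have "homeomorphic_map (subtopology (subtopology X (chart_dom c)) ?D)
     (subtopology (subtopology (Euclidean_space (chart_dim c)) (chart_map c ` chart_dom c)) (chart_map c ` ?D))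
     (chart_map c)"
    by (rule homeomorphic_map_subtopologies)
  moreover have "chart_map c ` chart_dom c \<inter> chart_map c ` ?D = chart_map c ` ?D" by blast
  ultimately have "homeomorphic_map (subtopology X ?D)
      (subtopology (Euclidean_space (chart_dim c)) (chart_map c ` ?D)) (chart_map c)"
    by (simp add: subtopology_subtopology)
  then show ?thesis
    using O D W unfolding is_chart_def
    by (simp add: subtopology_subtopology openin_open_subtopology inf.absorb2 Int_commute inf_left_commute)
qed

lemma smooth_manifold_open_submanifold:
  assumes M: "smooth_manifold M" and W: "openin (mtop M) W"
  shows "smooth_manifold (open_submanifold M W)"
  unfolding smooth_manifold_def
proof (intro conjI ballI)
  show "Hausdorff_space (mtop (open_submanifold M W))"
    using smooth_manifoldD(1)[OF M] by (simp add: Hausdorff_space_subtopology)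
  show "second_countable (mtop (open_submanifold M W))"
    using M by (simp add: smooth_manifold_def second_countable_subtopology)
  show "is_chart (mtop (open_submanifold M W)) c" if "c \<in> matlas (open_submanifold M W)" for c
    using that smooth_manifoldD(2)[OF M] W by (auto intro: is_chart_restrict)
  have "(\<Union>c\<in>matlas M. chart_dom c) = mcarrier M"
    using M by (simp add: smooth_manifold_def)
  then show "(\<Union>c\<in>matlas (open_submanifold M W). chart_dom c) = mcarrier (open_submanifold M W)"
    by auto
  fix c' d' assume "c' \<in> matlas (open_submanifold M W)" "d' \<in> matlas (open_submanifold M W)"
  then obtain c d where c: "c \<in> matlas M" "c' = restrict_chart c W" and d: "d \<in> matlas M" "d' = restrict_chart d W"
    by auto
  have "{x \<in> chart_dom c \<inter> W. x \<in> chart_dom d \<inter> W} = chart_dom c \<inter> W \<inter> chart_dom d" by blast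
  then have "openin (mtop M) {x \<in> chart_dom c \<inter> W. x \<in> chart_dom d \<inter> W}"
    using W is_chartD(1)[OF smooth_manifoldD(2)[OF M c(1)]] is_chartD(1)[OF smooth_manifoldD(2)[OF M d(1)]]
    by auto
  then show "smooth_in_charts c' d' (\<lambda>x. x)"
    unfolding c(2) d(2)
    by (rule smooth_in_charts_restrict[OF smooth_manifoldD(2)[OF M c(1)] smooth_manifoldD(4)[OF M c(1) d(1)]])
qed

lemma smooth_map_open_submanifold:
  assumes M: "smooth_manifold M" and N: "smooth_manifold N" and f: "smooth_map M N f"
    and W: "openin (mtop M) W" and V: "openin (mtop N) V" and fW: "f ` W \<subseteq> V"
  shows "smooth_map (open_submanifold M W) (open_submanifold N V) f"
  unfolding smooth_map_def
proof (intro conjI ballI)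
  show "continuous_map (mtop (open_submanifold M W)) (mtop (open_submanifold N V)) f"
    using smooth_mapD(1)[OF f] fW
    by (auto simp: continuous_map_in_subtopology continuous_map_from_subtopology)
  fix c' d' assume "c' \<in> matlas (open_submanifold M W)" "d' \<in> matlas (open_submanifold N V)"
  then obtain c d where c: "c \<in> matlas M" "c' = restrict_chart c W" and d: "d \<in> matlas N" "d' = restrict_chart d V"
    by auto
  have "openin (mtop M) {x \<in> chart_dom c \<inter> W. f x \<in> chart_dom d \<inter> V}"
    using W V is_chartD(1)[OF smooth_manifoldD(2)[OF M c(1)]] is_chartD(1)[OF smooth_manifoldD(2)[OF N d(1)]]
    by (intro openin_chart_domains[OF smooth_mapD(1)[OF f]]) auto
  then show "smooth_in_charts c' d' f"
    unfolding c(2) d(2)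
    by (rule smooth_in_charts_restrict[OF smooth_manifoldD(2)[OF M c(1)] smooth_mapD(2)[OF f c(1) d(1)]])
qed

lemma regular_open_submanifold_iff:
  assumes M: "smooth_manifold M" and N: "smooth_manifold N" and f: "smooth_map M N f"
    and W: "openin (mtop M) W" and p: "p \<in> W" and V: "f p \<in> V"
  shows "regular_in_charts (open_submanifold M W) (open_submanifold N V) f p \<longleftrightarrow> regular_in_charts M N f p"
proof -
  have at: "charts_at (open_submanifold M W) p = (\<lambda>c. restrict_chart c W) ` charts_at M p"
    "charts_at (open_submanifold N V) (f p) = (\<lambda>d. restrict_chart d V) ` charts_at N (f p)"
    using p V by (auto simp: charts_at_def)
  have jac: "chart_jac (restrict_chart c W) (restrict_chart d V) f p j i = chart_jac c d f p j i"
    if c: "c \<in> charts_at M p" and d: "d \<in> charts_at N (f p)" and i: "i < chart_dim c" for c d i j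
  proof -
    note cD = charts_atD[OF M c] and dD = charts_atD[OF N d]
    \<comment> \<open>\<open>V\<close> is not assumed open, so smoothness is established with the
      target cut down to \<open>UNIV\<close>; the coordinate expression, and hence the Jacobian,
      does not depend on that cut.\<close>
    have "openin (mtop M) {x \<in> chart_dom c \<inter> W. f x \<in> chart_dom d \<inter> UNIV}"
      using W is_chartD(1)[OF cD(3)] is_chartD(1)[OF dD(3)]
      by (intro openin_chart_domains[OF smooth_mapD(1)[OF f]]) auto
    from smooth_in_charts_restrict[OF cD(3) smooth_mapD(2)[OF f cD(1) dD(1)] this]
    have sm: "smooth_in_charts (restrict_chart c W) (restrict_chart d UNIV) f" .
    have "chart_jac (restrict_chart c W) (restrict_chart d V) f p j i =
        chart_jac (restrict_chart c W) (restrict_chart d UNIV) f p j i"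
    proof (rule chart_jac_cong[OF _ sm])
      show "coord_rep (restrict_chart c W) (restrict_chart d V) f (chart_map (restrict_chart c W) x) =
          chart_map (restrict_chart d UNIV) (f x)" if "x \<in> chart_dom (restrict_chart c W)" for x
        using coord_rep_restrict_chart[OF cD(4), of x W d V f] that by simp
    qed (use cD dD p i in \<open>auto intro: inj_on_subset\<close>)
    moreover have "chart_jac c d f p j i = chart_jac (restrict_chart c W) (restrict_chart d UNIV) f p j i"
    proof (rule chart_jac_cong[OF _ sm])
      show "coord_rep c d f (chart_map (restrict_chart c W) x) =
          chart_map (restrict_chart d UNIV) (f x)" if "x \<in> chart_dom (restrict_chart c W)" for x
        using coord_rep_apply[OF cD(4), of x d f] that by simp
    qed (use cD dD p i in \<open>auto intro: inj_on_subset\<close>)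
    ultimately show ?thesis by simp
  qed
  have cong: "mat_inj m k A \<longleftrightarrow> mat_inj m k B" "mat_surj m k A \<longleftrightarrow> mat_surj m k B"
    if "\<And>j i. i < k \<Longrightarrow> A j i = B j i" for m k and A B :: "nat \<Rightarrow> nat \<Rightarrow> real"
    using that by (auto simp: mat_inj_def mat_surj_def)
  show ?thesis
    unfolding regular_in_charts_def at by (simp add: cong[OF jac])
qed

lemma immersive_imp_locally_injective:
  assumes M: "smooth_manifold M" and N: "smooth_manifold N" and f: "smooth_map M N f"
    and c: "c \<in> charts_at M p" and d: "d \<in> charts_at N (f p)"
    and inj: "mat_inj (chart_dim d) (chart_dim c) (chart_jac c d f p)"
  obtains W where "openin (mtop M) W" "p \<in> W" "inj_on f W"
proof -
  note cD = charts_atD[OF M c] and dD = charts_atD[OF N d]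
  \<comment> \<open>The fibrewise statement is used with no parameters, that is with
    \<open>n = 0\<close>.\<close>
  have F: "euclidean_smooth_on (0 + chart_dim c) (chart_dim d) (coord_dom c d f) (coord_rep c d f)"
    using smooth_mapD(2)[OF f cD(1) dD(1)] by (simp add: smooth_in_charts_def)
  obtain V where V: "openin (Euclidean_space (0 + chart_dim c)) V" "chart_map c p \<in> V" "V \<subseteq> coord_dom c d f"
    "\<And>x y. x \<in> V \<Longrightarrow> y \<in> V \<Longrightarrow> (\<And>i. i < 0 \<Longrightarrow> x i = y i) \<Longrightarrow> coord_rep c d f x = coord_rep c d f y \<Longrightarrow> x = y"
    using locally_injective_fibrewise[OF F chart_map_in_coord_dom[of p c f d, OF cD(2) dD(2)]] inj
    unfolding chart_jac_def add_0 by blast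
  let ?W = "{x \<in> topspace (subtopology (mtop M) (chart_dom c)). chart_map c x \<in> V}"
  have W: "openin (subtopology (mtop M) (chart_dom c)) ?W"
    using V(1) by (intro openin_continuous_map_preimage[OF is_chartD(6)[OF cD(3)]]) simp
  show thesis
  proof
    show "openin (mtop M) ?W"
      using W is_chartD(1)[OF cD(3)] by (rule openin_trans_full)
    show "p \<in> ?W" using cD V(2) by simp
    show "inj_on f ?W"
    proof (rule inj_onI)
      fix x y assume xy: "x \<in> ?W" "y \<in> ?W" "f x = f y"
      then have "coord_rep c d f (chart_map c x) = coord_rep c d f (chart_map c y)"
        by (simp add: coord_rep_apply[OF cD(4)])
      then have "chart_map c x = chart_map c y"
        using V(4) xy by simp
      then show "x = y" using xy cD(4) by (auto dest: inj_onD)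
    qed
  qed
qed

text \<open>Regularity passes between a manifold and its open parts. On an open set where the map is
  injective its image is open, and the result on regular bijections applies to the
  restriction.\<close>

theorem etale_iff_immersion_submersion:
  assumes M: "smooth_manifold M" and N: "smooth_manifold N"
  shows "etale_map M N f \<longleftrightarrow> immersion M N f \<and> submersion M N f"
proof
  assume et: "etale_map M N f"
  then have f: "smooth_map M N f" by (simp add: etale_map_def)
  have "inj_on (differential M N f p) (tangent_space M p) \<and>
      differential M N f p ` tangent_space M p = tangent_space N (f p)" if p: "p \<in> mcarrier M" for p
  proof -
    obtain W where W: "openin (mtop M) W" "p \<in> W" "openin (mtop N) (f ` W)"
      "diffeomorphism (open_submanifold M W) (open_submanifold N (f ` W)) f"
      using et p unfolding etale_map_def by blast
    have "regular_in_charts (open_submanifold M W) (open_submanifold N (f ` W)) f p"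
      using p W(2) by (intro diffeomorphism_imp_regular smooth_manifold_open_submanifold M N W) auto
    then have reg: "regular_in_charts M N f p"
      using regular_open_submanifold_iff[OF M N f W(1,2)] W(2) by blast
    obtain c d where c: "c \<in> charts_at M p" and d: "d \<in> charts_at N (f p)"
      using smooth_manifoldD(3)[OF M p] smooth_manifoldD(3)[OF N smooth_mapD(3)[OF f p]] by blast
    then show ?thesis
      using reg differential_inj_iff[OF M N f c d] differential_surj_iff[OF M N f c d]
      unfolding regular_in_charts_def by blast
  qed
  then show "immersion M N f \<and> submersion M N f"
    using f by (simp add: immersion_def submersion_def)
next
  assume imsub: "immersion M N f \<and> submersion M N f"
  then have f: "smooth_map M N f" by (simp add: immersion_def)
  have reg: "regular_in_charts M N f p" if "p \<in> mcarrier M" for p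
    using imsub that by (intro immersion_submersion_imp_regular[OF M N]) auto
  show "etale_map M N f"
    unfolding etale_map_def
  proof (intro conjI ballI f)
    fix p assume p: "p \<in> mcarrier M"
    obtain c d where c: "c \<in> charts_at M p" and d: "d \<in> charts_at N (f p)"
      using smooth_manifoldD(3)[OF M p] smooth_manifoldD(3)[OF N smooth_mapD(3)[OF f p]] by blast
    obtain W where W: "openin (mtop M) W" "p \<in> W" "inj_on f W"
      using immersive_imp_locally_injective[OF M N f c d] reg[OF p] c d
      unfolding regular_in_charts_def by blast
    have WM: "W \<subseteq> mcarrier M" using W(1) by (rule openin_subset)
    have fW: "openin (mtop N) (f ` W)"
      using WM by (intro regular_injective_open_image[OF M N f reg W(1,3)]) auto
    have "diffeomorphism (open_submanifold M W) (open_submanifold N (f ` W)) f"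
    proof (rule regular_bijection_imp_diffeomorphism)
      show "smooth_manifold (open_submanifold M W)" "smooth_manifold (open_submanifold N (f ` W))"
        by (intro smooth_manifold_open_submanifold M N W fW)+
      show "smooth_map (open_submanifold M W) (open_submanifold N (f ` W)) f"
        by (rule smooth_map_open_submanifold[OF M N f W(1) fW]) simp
      show "regular_in_charts (open_submanifold M W) (open_submanifold N (f ` W)) f q"
        if "q \<in> mcarrier (open_submanifold M W)" for q
        using regular_open_submanifold_iff[OF M N f W(1), of q "f ` W"] reg[of q] that by auto
      show "bij_betw f (mcarrier (open_submanifold M W)) (mcarrier (open_submanifold N (f ` W)))"
        using W(3) WM openin_subset[OF fW] by (simp add: bij_betw_def inf.absorb2)
    qed
    then show "\<exists>W. openin (mtop M) W \<and> p \<in> W \<and> openin (mtop N) (f ` W) \<and>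
        diffeomorphism (open_submanifold M W) (open_submanifold N (f ` W)) f"
      using W fW by blast
  qed
qed

section \<open>Plots of the functional diffeology\<close>

text \<open>The union of all open witnesses is open and covers the slice over \<open>u\<close>. The
  space \<open>Y\<close> is kept general because it is \<open>K\<close> for pointwise conditions and
  \<open>K \<times> K\<close> for injectivity.\<close>

lemma tube_nbhd:
  assumes Y: "compact_space Y" and u: "u \<in> topspace X"
    and nbhd: "\<And>y. y \<in> topspace Y \<Longrightarrow>
      \<exists>\<Theta>. openin (prod_topology X Y) \<Theta> \<and> (u, y) \<in> \<Theta> \<and> (\<forall>w z. (w, z) \<in> \<Theta> \<longrightarrow> R w z)"
  obtains V where "openin X V" "u \<in> V" "\<And>w y. w \<in> V \<Longrightarrow> y \<in> topspace Y \<Longrightarrow> R w y"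
proof -
  define W where "W = \<Union>{\<Theta>. openin (prod_topology X Y) \<Theta> \<and> (\<forall>w z. (w, z) \<in> \<Theta> \<longrightarrow> R w z)}"
  have "openin (prod_topology X Y) W"
    unfolding W_def by (rule openin_Union) blast
  moreover have "{u} \<times> topspace Y \<subseteq> W"
    using nbhd unfolding W_def by blast
  ultimately obtain V V' where V: "openin X V" "u \<in> V" "topspace Y \<subseteq> V'" "V \<times> V' \<subseteq> W"
    using tube_lemma_right[of X Y W "topspace Y" u] Y u by (auto simp: compact_space_def)
  show thesis
  proof
    show "R w y" if "w \<in> V" "y \<in> topspace Y" for w y
    proof -
      have "(w, y) \<in> W" using that V(3,4) by blast
      then show ?thesis unfolding W_def by blast
    qed
  qed (use V in auto)
qed

text \<open>Neighbourhoods are taken relative to \<open>U\<close>, the form in which the tube lemma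
  returns them; since \<open>U\<close> is open, they are open in R^n as well.\<close>

lemma D_openI:
  assumes "A \<subseteq> X"
    and "\<And>n U P u. (n, U, P) \<in> \<D> \<Longrightarrow> u \<in> U \<Longrightarrow> P u \<in> A \<Longrightarrow>
      \<exists>V. openin (subtopology (Euclidean_space n) U) V \<and> u \<in> V \<and> (\<forall>w\<in>V. P w \<in> A)"
    and "\<And>n U P. (n, U, P) \<in> \<D> \<Longrightarrow> openin (Euclidean_space n) U"
  shows "D_open X \<D> A"
proof -
  have "openin (Euclidean_space n) {u \<in> U. P u \<in> A}" if D: "(n, U, P) \<in> \<D>" for n U P
  proof (subst openin_subopen, intro ballI)
    fix u assume "u \<in> {u \<in> U. P u \<in> A}"
    then obtain V where V: "openin (subtopology (Euclidean_space n) U) V" "u \<in> V" "\<forall>w\<in>V. P w \<in> A"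
      using assms(2)[OF D] by blast
    have "openin (Euclidean_space n) V"
      using V(1) assms(3)[OF D] by (rule openin_trans_full)
    moreover have "V \<subseteq> U" using openin_subset[OF V(1)] by auto
    ultimately show "\<exists>T. openin (Euclidean_space n) T \<and> u \<in> T \<and> T \<subseteq> {u \<in> U. P u \<in> A}"
      using V by blast
  qed
  then show ?thesis using assms(1) by (auto simp: D_open_def)
qed

text \<open>A small box in a chart is a product of intervals, hence connected. The surjectivity
  argument compares such neighbourhoods with images that are open and closed.\<close>

lemma ex_connected_nbhd:
  assumes M: "smooth_manifold M" and y: "y \<in> mcarrier M"
  obtains W where "openin (mtop M) W" "y \<in> W" "connectedin (mtop M) W"
proof -
  obtain d where d: "d \<in> charts_at M y" using smooth_manifoldD(3)[OF M y] by blast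
  note dD = charts_atD[OF M d]
  let ?m = "chart_dim d" and ?I = "chart_map d ` chart_dom d"
  define a where "a = chart_map d y"
  have aI: "a \<in> ?I" using dD by (simp add: a_def)
  then have aE: "a \<in> topspace (Euclidean_space ?m)"
    using is_chartD(5)[OF dD(3,2)] by (simp add: a_def)
  obtain e where e: "e > 0"
    "\<And>z. z \<in> topspace (Euclidean_space ?m) \<Longrightarrow> (\<And>i. i < ?m \<Longrightarrow> \<bar>z i - a i\<bar> < e) \<Longrightarrow> z \<in> ?I"
    using openin_Euclidean_box[OF is_chartD(4)[OF dD(3)] aI] by blast
  define B where "B = topspace (Euclidean_space ?m) \<inter> (\<Inter>i\<in>{..<?m}. {z. z i \<in> ball (a i) e})"
  \<comment> \<open>Written as a product over all indices, with factor \<open>{0}\<close> from the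
    dimension on, the box falls under connectedness of products.\<close>
  have BE: "B = Pi\<^sub>E UNIV (\<lambda>i. if i < ?m then ball (a i) e else {0})"
  proof (intro equalityI subsetI)
    fix z assume "z \<in> B"
    then show "z \<in> Pi\<^sub>E UNIV (\<lambda>i. if i < ?m then ball (a i) e else {0})"
      by (auto simp: B_def topspace_Euclidean_space)
  next
    fix z assume z: "z \<in> Pi\<^sub>E UNIV (\<lambda>i. if i < ?m then ball (a i) e else {0})"
    have z': "z i \<in> (if i < ?m then ball (a i) e else {0})" for i
      using PiE_mem[OF z, of i] by simp
    have "z i \<in> ball (a i) e" if "i < ?m" for i
      using z'[of i] that by simp
    moreover have "z i = 0" if "i \<ge> ?m" for i
      using z'[of i] that by simp
    ultimately show "z \<in> B"
      unfolding B_def topspace_Euclidean_space by blast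
  qed
  have BI: "B \<subseteq> ?I"
  proof
    fix z assume z: "z \<in> B"
    show "z \<in> ?I"
      by (rule e(2)) (use z in \<open>auto simp: B_def dist_real_def abs_minus_commute\<close>)
  qed
  have Bopen: "openin (Euclidean_space ?m) B"
  proof -
    have "open (\<Inter>i\<in>{..<?m}. {z :: nat \<Rightarrow> real. z i \<in> ball (a i) e})"
    proof (intro open_INT ballI)
      fix i
      have "open ((\<lambda>z :: nat \<Rightarrow> real. z i) -` ball (a i) e)"
        by (intro open_vimage open_ball continuous_on_product_coordinates)
      then show "open {z :: nat \<Rightarrow> real. z i \<in> ball (a i) e}" by (simp add: vimage_def)
    qed simp
    then show ?thesis
      unfolding B_def by (subst Euclidean_space_eq_top_of_set) (rule openin_open_Int)
  qed
  have "connectedin (powertop_real UNIV) B"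
    unfolding BE connectedin_PiE by (auto simp: connectedin_iff_connected)
  then have "connectedin (subtopology (Euclidean_space ?m) ?I) B"
    using BI by (auto simp: connectedin_subtopology Euclidean_space_def B_def topspace_Euclidean_space)
  moreover define W where "W = {x \<in> topspace (subtopology (mtop M) (chart_dom d)). chart_map d x \<in> B}"
  have img: "chart_map d ` W = B"
    using BI is_chartD(2)[OF dD(3)] by (auto simp: W_def)
  have hom: "homeomorphic_map (subtopology (mtop M) (chart_dom d)) (subtopology (Euclidean_space ?m) ?I) (chart_map d)"
    using dD(3) by (simp add: is_chart_def)
  ultimately have "connectedin (subtopology (mtop M) (chart_dom d)) W"
    using homeomorphic_map_connectedness[OF hom, of W] img by (auto simp: W_def)
  then have con: "connectedin (mtop M) W"
    by (simp add: connectedin_subtopology)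
  have "openin (subtopology (mtop M) (chart_dom d)) W"
    unfolding W_def by (rule openin_continuous_map_preimage[OF is_chartD(6)[OF dD(3)] Bopen])
  then have "openin (mtop M) W"
    using is_chartD(1)[OF dD(3)] by (rule openin_trans_full)
  moreover have "y \<in> W"
    using dD e(1) aE by (auto simp: W_def B_def a_def)
  ultimately show thesis using con that by blast
qed

section \<open>Plots in product charts\<close>

definition join_coords :: "nat \<Rightarrow> (nat \<Rightarrow> real) \<Rightarrow> (nat \<Rightarrow> real) \<Rightarrow> nat \<Rightarrow> real" where
  "join_coords n u y = (\<lambda>i. if i < n then u i else y (i - n))"

lemma join_coords_eqD:
  assumes "join_coords n u y = join_coords n u' y'"
    and "u \<in> topspace (Euclidean_space n)" "u' \<in> topspace (Euclidean_space n)"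
  shows "u = u'" "y = y'"
proof -
  have eq: "join_coords n u y i = join_coords n u' y' i" for i using assms(1) by simp
  show "u = u'"
  proof
    fix i show "u i = u' i"
      using eq[of i] assms(2,3) by (cases "i < n") (auto simp: join_coords_def topspace_Euclidean_space)
  qed
  show "y = y'"
  proof
    fix i show "y i = y' i" using eq[of "n + i"] by (simp add: join_coords_def)
  qed
qed

text \<open>Coordinate \<open>n + i\<close> of the product is coordinate \<open>i\<close> of the
  fibre, so partial derivatives along the fibre are those of the map with frozen parameter.\<close>

lemma join_coords_upd: "(join_coords n u y)(n + i := t) = join_coords n u (y(i := t))"
  by (auto simp: join_coords_def fun_eq_iff)

locale functional_plot =
  fixes K :: "'a manifold" and M :: "'b manifold" and n U P
  assumes K: "smooth_manifold K" and M: "smooth_manifold M"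
    and plot: "(n, U, P) \<in> functional_diffeology K M"
begin

abbreviation param :: "(nat \<Rightarrow> real) topology" where
  "param \<equiv> subtopology (Euclidean_space n) U"

abbreviation total :: "((nat \<Rightarrow> real) \<times> 'a) topology" where
  "total \<equiv> prod_topology param (mtop K)"

definition eval_plot :: "(nat \<Rightarrow> real) \<times> 'a \<Rightarrow> 'b" where
  "eval_plot = (\<lambda>(u, x). P u x)"

definition total_chart :: "'a chart \<Rightarrow> ((nat \<Rightarrow> real) \<times> 'a) chart" where
  "total_chart c = prod_chart (Chart n U (\<lambda>x. x)) c"

lemma eval_plot_apply [simp]: "eval_plot (u, x) = P u x"
  by (simp add: eval_plot_def)

lemma openin_U: "openin (Euclidean_space n) U"
  using plot by (simp add: functional_diffeology_def)

lemma U_subset: "U \<subseteq> topspace (Euclidean_space n)"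
  by (rule openin_subset[OF openin_U])

lemma Euclidean_Int_U [simp]: "topspace (Euclidean_space n) \<inter> U = U"
  using U_subset by (simp add: inf.absorb2)

lemma smooth_map_P: "u \<in> U \<Longrightarrow> smooth_map K M (P u)"
  using plot by (auto simp: functional_diffeology_def smooth_maps_def)

lemma smooth_maps_P: "u \<in> U \<Longrightarrow> P u \<in> smooth_maps K M"
  using plot by (auto simp: functional_diffeology_def)

lemma smooth_map_eval: "smooth_map (prod_manifold (euclidean_open_manifold n U) K) M eval_plot"
  using plot by (simp add: functional_diffeology_def eval_plot_def)

lemma continuous_map_eval: "continuous_map total (mtop M) eval_plot"
  using smooth_mapD(1)[OF smooth_map_eval] by (simp add: prod_manifold_def euclidean_open_manifold_def)

lemma total_chart_sel [simp]:
  "chart_dim (total_chart c) = n + chart_dim c" "chart_dom (total_chart c) = U \<times> chart_dom c"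
  "chart_map (total_chart c) (u, x) = join_coords n u (chart_map c x)"
  by (simp_all add: total_chart_def prod_chart_def join_coords_def fun_eq_iff)

lemma smooth_in_total_chart:
  assumes "c \<in> matlas K" "d \<in> matlas M"
  shows "smooth_in_charts (total_chart c) d eval_plot"
  using assms by (intro smooth_mapD(2)[OF smooth_map_eval])
    (auto simp: prod_manifold_def euclidean_open_manifold_def total_chart_def)

lemma inj_on_total_chart:
  assumes "c \<in> matlas K"
  shows "inj_on (chart_map (total_chart c)) (chart_dom (total_chart c))"
proof (rule inj_onI)
  fix z w assume z: "z \<in> chart_dom (total_chart c)" and w: "w \<in> chart_dom (total_chart c)"
    and eq: "chart_map (total_chart c) z = chart_map (total_chart c) w"
  obtain u x u' x' where zw: "z = (u, x)" "w = (u', x')" by (cases z, cases w)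
  have "u = u'" "chart_map c x = chart_map c x'"
    using join_coords_eqD[of n u "chart_map c x" u' "chart_map c x'"] eq z w U_subset by (auto simp: zw)
  then show "z = w"
    using inj_onD[OF is_chartD(3)[OF smooth_manifoldD(2)[OF K assms]]] z w by (auto simp: zw)
qed

lemma continuous_map_total_chart:
  assumes c: "c \<in> matlas K"
  shows "continuous_map (subtopology total (chart_dom (total_chart c)))
    (Euclidean_space (chart_dim (total_chart c))) (chart_map (total_chart c))"
proof -
  let ?D = "subtopology total (chart_dom (total_chart c))"
  note chart = smooth_manifoldD(2)[OF K c]
  have D: "?D = prod_topology param (subtopology (mtop K) (chart_dom c))"
    by (simp add: subtopology_Times subtopology_subtopology)
  have 1: "continuous_map ?D (Euclidean_space n) fst"
    unfolding D by (rule continuous_map_into_fulltopology[OF continuous_map_fst])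
  have 2: "continuous_map ?D (Euclidean_space (chart_dim c)) (\<lambda>z. chart_map c (snd z))"
    unfolding D using continuous_map_compose[OF continuous_map_snd is_chartD(6)[OF chart]] by (simp add: o_def)
  have coord: "continuous_map (Euclidean_space k) euclideanreal (\<lambda>x. x i)" for k i
    unfolding Euclidean_space_def
    by (intro continuous_map_from_subtopology continuous_map_product_projection) simp
  have eq: "chart_map (total_chart c) = (\<lambda>z i. if i < n then fst z i else chart_map c (snd z) (i - n))"
    by (auto simp: fun_eq_iff join_coords_def)
  have "continuous_map ?D euclideanreal (\<lambda>z. chart_map (total_chart c) z i)" for i
    using continuous_map_compose[OF 1 coord[of n i]] continuous_map_compose[OF 2 coord[of _ "i - n"]]
    unfolding eq by (cases "i < n") (simp_all add: o_def)
  moreover have "chart_map (total_chart c) z i = 0"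
    if "z \<in> topspace ?D" "n + chart_dim c \<le> i" for z i
    using that is_chartD(5)[OF chart, of "snd z"] unfolding D
    by (auto simp: eq topspace_Euclidean_space)
  ultimately show ?thesis
    unfolding Euclidean_space_def continuous_map_in_subtopology continuous_map_componentwise_UNIV
    by auto
qed

lemma openin_total_dom:
  assumes "c \<in> matlas K"
  shows "openin total (chart_dom (total_chart c))"
  using is_chartD(1)[OF smooth_manifoldD(2)[OF K assms]] by (simp add: openin_prod_Times_iff openin_U openin_open_subtopology)

text \<open>The pairs \<open>(u, x)\<close> at which \<open>c\<close> and \<open>d\<close> can be
  used for \<open>P u\<close>. Near such a pair the Jacobians of the whole family are read in the
  same two charts.\<close>

definition adapted :: "'a chart \<Rightarrow> 'b chart \<Rightarrow> ((nat \<Rightarrow> real) \<times> 'a) set" where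
  "adapted c d = {z \<in> chart_dom (total_chart c). eval_plot z \<in> chart_dom d}"

lemma in_adapted_iff: "(u, x) \<in> adapted c d \<longleftrightarrow> u \<in> U \<and> x \<in> chart_dom c \<and> P u x \<in> chart_dom d"
  by (simp add: adapted_def)

lemma openin_adapted:
  assumes "c \<in> matlas K" "d \<in> matlas M"
  shows "openin total (adapted c d)"
  unfolding adapted_def
  by (intro openin_chart_domains[OF continuous_map_eval] openin_total_dom assms(1)
      is_chartD(1)[OF smooth_manifoldD(2)[OF M assms(2)]])

text \<open>Freezing the parameter selects the last columns of the Jacobian of the evaluation map. A
  plot is smooth jointly in \<open>(u, x)\<close>, and this is how joint continuity of the Jacobians
  of the single maps \<open>P u\<close> is obtained.\<close>

lemma chart_jac_total:
  assumes c: "c \<in> matlas K" and d: "d \<in> matlas M" and z: "(u, x) \<in> adapted c d" and i: "i < chart_dim c"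
  shows "chart_jac c d (P u) x j i = chart_jac (total_chart c) d eval_plot (u, x) j (n + i)"
proof -
  note chart = smooth_manifoldD(2)[OF K c]
  have u: "u \<in> U" and x: "x \<in> chart_dom c" "P u x \<in> chart_dom d"
    using z by (auto simp: in_adapted_iff)
  have eq: "coord_rep c d (P u) y = coord_rep (total_chart c) d eval_plot (join_coords n u y)"
    if "y \<in> coord_dom c d (P u)" for y
  proof -
    obtain q where q: "q \<in> chart_dom c" "y = chart_map c q"
      using \<open>y \<in> coord_dom c d (P u)\<close> by (auto simp: coord_dom_def)
    show ?thesis
      using coord_rep_apply[OF inj_on_total_chart[OF c], of "(u, q)" d eval_plot]
        coord_rep_apply[OF is_chartD(3)[OF chart] q(1), of d "P u"] q u by simp
  qed
  have dom: "openin (Euclidean_space (chart_dim c)) (coord_dom c d (P u))"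
    using smooth_mapD(2)[OF smooth_map_P[OF u] c d] unfolding smooth_in_charts_def
    by (rule euclidean_smooth_onD(1))
  have "\<forall>\<^sub>F t in nhds (chart_map c x i). (chart_map c x)(i := t) \<in> coord_dom c d (P u)"
    by (rule eventually_fun_upd[OF dom chart_map_in_coord_dom[of x c "P u" d, OF x] i])
  then have ev: "\<forall>\<^sub>F t in nhds (chart_map c x i). coord_rep c d (P u) ((chart_map c x)(i := t)) j =
      coord_rep (total_chart c) d eval_plot ((join_coords n u (chart_map c x))(n + i := t)) j"
    by (rule eventually_mono) (simp only: eq join_coords_upd)
  have "join_coords n u (chart_map c x) (n + i) = chart_map c x i"
    by (simp add: join_coords_def)
  then show ?thesis
    unfolding chart_jac_def jac_def partial_deriv_def total_chart_sel
    using deriv_cong_ev[OF ev refl] by simp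
qed

lemma continuous_map_chart_jac:
  assumes c: "c \<in> matlas K" and d: "d \<in> matlas M" and "j < chart_dim d" "i < chart_dim c"
  shows "continuous_map (subtopology total (adapted c d)) euclideanreal (\<lambda>z. chart_jac c d (P (fst z)) (snd z) j i)"
proof -
  let ?F = "coord_rep (total_chart c) d eval_plot" and ?D = "coord_dom (total_chart c) d eval_plot"
  have F: "euclidean_smooth_on (n + chart_dim c) (chart_dim d) ?D ?F"
    using smooth_in_total_chart[OF c d] by (simp add: smooth_in_charts_def)
  have 1: "continuous_map (subtopology total (adapted c d)) (subtopology (Euclidean_space (n + chart_dim c)) ?D)
      (chart_map (total_chart c))"
  proof -
    have "continuous_map (subtopology total (adapted c d)) (Euclidean_space (n + chart_dim c)) (chart_map (total_chart c))"
      using continuous_map_from_subtopology_mono[OF continuous_map_total_chart[OF c], of "adapted c d"]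
      by (auto simp: adapted_def)
    then show ?thesis
      unfolding continuous_map_in_subtopology by (auto simp: adapted_def coord_dom_def)
  qed
  have 2: "continuous_map (subtopology (Euclidean_space (n + chart_dim c)) ?D) euclideanreal (\<lambda>y. jac ?F y j (n + i))"
    using euclidean_smooth_onD(7)[OF F, of j "n + i"] assms(3,4) euclidean_smooth_onD(2)[OF F]
    by (simp add: continuous_map_Euclidean_subtopology_iff)
  have "continuous_map (subtopology total (adapted c d)) euclideanreal
      (\<lambda>z. jac ?F (chart_map (total_chart c) z) j (n + i))"
    using continuous_map_compose[OF 1 2] by (simp add: o_def)
  then show ?thesis
  proof (rule continuous_map_eq)
    fix z assume "z \<in> topspace (subtopology total (adapted c d))"
    then have "(fst z, snd z) \<in> adapted c d" by simp
    from chart_jac_total[OF c d this assms(4)]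
    show "jac ?F (chart_map (total_chart c) z) j (n + i) = chart_jac c d (P (fst z)) (snd z) j i"
      by (simp add: chart_jac_def)
  qed
qed

text \<open>The neighbourhood contains nearby parameters as well, and on it every \<open>P w\<close>
  separates points; injectivity of \<open>P u\<close> near \<open>x\<close> alone would say nothing
  about neighbouring parameters.\<close>

lemma fibrewise_locally_injective:
  assumes c: "c \<in> matlas K" and d: "d \<in> matlas M" and z: "(u, x) \<in> adapted c d"
    and inj: "mat_inj (chart_dim d) (chart_dim c) (chart_jac c d (P u) x)"
  obtains \<Theta> where "openin total \<Theta>" "(u, x) \<in> \<Theta>"
    "\<And>w y y'. (w, y) \<in> \<Theta> \<Longrightarrow> (w, y') \<in> \<Theta> \<Longrightarrow> P w y = P w y' \<Longrightarrow> y = y'"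
proof -
  let ?t = "total_chart c"
  let ?F = "coord_rep ?t d eval_plot" and ?D = "coord_dom ?t d eval_plot"
  note injt = inj_on_total_chart[OF c]
  have F: "euclidean_smooth_on (n + chart_dim c) (chart_dim d) ?D ?F"
    using smooth_in_total_chart[OF c d] by (simp add: smooth_in_charts_def)
  have zD: "chart_map ?t (u, x) \<in> ?D"
    using z unfolding adapted_def coord_dom_def by blast
  have "mat_inj (chart_dim d) (chart_dim c) (\<lambda>j i. jac ?F (chart_map ?t (u, x)) j (n + i))"
    using inj chart_jac_total[OF c d z] unfolding mat_inj_def chart_jac_def by simp
  then obtain V where V: "openin (Euclidean_space (n + chart_dim c)) V" "chart_map ?t (u, x) \<in> V" "V \<subseteq> ?D"
    "\<And>a b. a \<in> V \<Longrightarrow> b \<in> V \<Longrightarrow> (\<And>i. i < n \<Longrightarrow> a i = b i) \<Longrightarrow> ?F a = ?F b \<Longrightarrow> a = b"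
    using locally_injective_fibrewise[OF F zD] by blast
  define \<Theta> where "\<Theta> = {z \<in> topspace (subtopology total (chart_dom ?t)). chart_map ?t z \<in> V}"
  have "openin (subtopology total (chart_dom ?t)) \<Theta>"
    unfolding \<Theta>_def using V(1) by (intro openin_continuous_map_preimage[OF continuous_map_total_chart[OF c]]) simp
  then have open_\<Theta>: "openin total \<Theta>"
    using openin_total_dom[OF c] by (rule openin_trans_full)
  have dom: "z \<in> chart_dom ?t" if "z \<in> \<Theta>" for z
    using that by (simp add: \<Theta>_def)
  show thesis
  proof
    show "openin total \<Theta>" by (rule open_\<Theta>)
    have "(u, x) \<in> topspace (subtopology total (chart_dom ?t))"
      using z is_chartD(2)[OF smooth_manifoldD(2)[OF K c]] by (auto simp: in_adapted_iff)
    then show "(u, x) \<in> \<Theta>" using V(2) by (simp add: \<Theta>_def)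
    fix w y y' assume y: "(w, y) \<in> \<Theta>" and y': "(w, y') \<in> \<Theta>" and eq: "P w y = P w y'"
    have eqF: "?F (chart_map ?t (w, y)) = ?F (chart_map ?t (w, y'))"
      using eq unfolding coord_rep_apply[OF injt dom[OF y]] coord_rep_apply[OF injt dom[OF y']] by simp
    have inV: "chart_map ?t (w, y) \<in> V" "chart_map ?t (w, y') \<in> V"
      using y y' by (auto simp: \<Theta>_def)
    \<comment> \<open>Both points carry the same parameter \<open>w\<close>, so their first
      \<open>n\<close> coordinates agree.\<close>
    have "chart_map ?t (w, y) = chart_map ?t (w, y')"
      by (rule V(4)[OF inV _ eqF]) (simp add: join_coords_def)
    then have "(w, y) = (w, y')"
      by (rule inj_onD[OF injt _ dom[OF y] dom[OF y']])
    then show "y = y'" by simp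
  qed
qed

lemma ex_adapted_charts:
  assumes "u \<in> U" "x \<in> mcarrier K"
  obtains c d where "c \<in> charts_at K x" "d \<in> charts_at M (P u x)" "(u, x) \<in> adapted c d"
proof -
  obtain c d where "c \<in> charts_at K x" "d \<in> charts_at M (P u x)"
    using smooth_manifoldD(3)[OF K assms(2)] smooth_manifoldD(3)[OF M smooth_mapD(3)[OF smooth_map_P[OF assms(1)] assms(2)]]
    by blast
  then show thesis
    using that assms by (auto simp: in_adapted_iff charts_at_def)
qed

lemma adapted_charts_at:
  assumes "c \<in> matlas K" "d \<in> matlas M" "(u, x) \<in> adapted c d"
  shows "u \<in> U" "c \<in> charts_at K x" "d \<in> charts_at M (P u x)"
  using assms by (auto simp: in_adapted_iff charts_at_def)

lemma immersive_nbhd: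
  assumes u: "u \<in> U" and x: "x \<in> mcarrier K"
    and inj: "inj_on (differential K M (P u) x) (tangent_space K x)"
  shows "\<exists>\<Theta>. openin total \<Theta> \<and> (u, x) \<in> \<Theta> \<and>
    (\<forall>w y. (w, y) \<in> \<Theta> \<longrightarrow> inj_on (differential K M (P w) y) (tangent_space K y))"
proof -
  obtain c d where c: "c \<in> charts_at K x" and d: "d \<in> charts_at M (P u x)" and z: "(u, x) \<in> adapted c d"
    using ex_adapted_charts[OF u x] .
  note cK = charts_atD(1)[OF K c] and dM = charts_atD(1)[OF M d]
  let ?T = "subtopology total (adapted c d)"
  let ?\<Theta> = "{z \<in> topspace ?T. mat_inj (chart_dim d) (chart_dim c) (\<lambda>j i. chart_jac c d (P (fst z)) (snd z) j i)}"
  have "openin ?T ?\<Theta>"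
    by (intro openin_mat_inj continuous_map_chart_jac cK dM)
  then have "openin total ?\<Theta>"
    using openin_adapted[OF cK dM] by (rule openin_trans_full)
  moreover have "(u, x) \<in> ?\<Theta>"
    using z u x inj differential_inj_iff[OF K M smooth_map_P[OF u] c d] by simp
  \<comment> \<open>The charts \<open>c\<close> and \<open>d\<close> remain usable at
    \<open>(w, y)\<close>, so the matrix condition can be read back as one on the
    differential.\<close>
  moreover have "inj_on (differential K M (P w) y) (tangent_space K y)" if "(w, y) \<in> ?\<Theta>" for w y
  proof -
    have a: "(w, y) \<in> adapted c d" using that by simp
    note at = adapted_charts_at[OF cK dM a]
    show ?thesis
      using differential_inj_iff[OF K M smooth_map_P[OF at(1)] at(2,3)] that by simp
  qed
  ultimately show ?thesis by blast
qed

lemma submersive_nbhd: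
  assumes u: "u \<in> U" and x: "x \<in> mcarrier K"
    and surj: "differential K M (P u) x ` tangent_space K x = tangent_space M (P u x)"
  shows "\<exists>\<Theta>. openin total \<Theta> \<and> (u, x) \<in> \<Theta> \<and>
    (\<forall>w y. (w, y) \<in> \<Theta> \<longrightarrow> differential K M (P w) y ` tangent_space K y = tangent_space M (P w y))"
proof -
  obtain c d where c: "c \<in> charts_at K x" and d: "d \<in> charts_at M (P u x)" and z: "(u, x) \<in> adapted c d"
    using ex_adapted_charts[OF u x] .
  note cK = charts_atD(1)[OF K c] and dM = charts_atD(1)[OF M d]
  let ?T = "subtopology total (adapted c d)"
  let ?\<Theta> = "{z \<in> topspace ?T. mat_surj (chart_dim d) (chart_dim c) (\<lambda>j i. chart_jac c d (P (fst z)) (snd z) j i)}"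
  have "openin ?T ?\<Theta>"
    by (intro openin_mat_surj continuous_map_chart_jac cK dM)
  then have "openin total ?\<Theta>"
    using openin_adapted[OF cK dM] by (rule openin_trans_full)
  moreover have "(u, x) \<in> ?\<Theta>"
    using z u x surj differential_surj_iff[OF K M smooth_map_P[OF u] c d] by simp
  moreover have "differential K M (P w) y ` tangent_space K y = tangent_space M (P w y)" if "(w, y) \<in> ?\<Theta>" for w y
  proof -
    have a: "(w, y) \<in> adapted c d" using that by simp
    note at = adapted_charts_at[OF cK dM a]
    show ?thesis
      using differential_surj_iff[OF K M smooth_map_P[OF at(1)] at(2,3)] that by simp
  qed
  ultimately show ?thesis by blast
qed

text \<open>The Jacobian of the inclusion is available over points of \<open>N\<close> only.
  Openness of surjectivity therefore holds first relative to the set \<open>B\<close> of pairs sent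
  into \<open>N\<close>; the open set obtained in the end also contains pairs sent off
  \<open>N\<close>, where nothing is required.\<close>

lemma transversal_nbhd:
  assumes N: "closed_submanifold N M" and u: "u \<in> U" and x: "x \<in> mcarrier K"
    and tr: "transversal K M N (P u)"
  shows "\<exists>\<Theta>. openin total \<Theta> \<and> (u, x) \<in> \<Theta> \<and> (\<forall>w y. (w, y) \<in> \<Theta> \<longrightarrow> P w y \<in> mcarrier N \<longrightarrow>
    {tangent_add (differential K M (P w) y v) (differential N M (\<lambda>y. y) (P w y) v') | v v'.
       v \<in> tangent_space K y \<and> v' \<in> tangent_space N (P w y)} = tangent_space M (P w y))"
proof (cases "P u x \<in> mcarrier N")
  case False
  have "openin (mtop M) (mcarrier M - mcarrier N)"
    using N by (auto simp: closed_submanifold_def)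
  then have "openin total {z \<in> topspace total. eval_plot z \<in> mcarrier M - mcarrier N}"
    by (rule openin_continuous_map_preimage[OF continuous_map_eval])
  then show ?thesis
    using False u x smooth_mapD(3)[OF smooth_map_P[OF u] x]
    by (intro exI[of _ "{z \<in> topspace total. eval_plot z \<in> mcarrier M - mcarrier N}"]) auto
next
  case True
  have Nm: "smooth_manifold N" and emb: "embedding_map (mtop N) (mtop M) (\<lambda>x. x)"
    and inc: "smooth_map N M (\<lambda>x. x)"
    using N by (auto simp: closed_submanifold_def embedding_def immersion_def)
  \<comment> \<open>\<open>N\<close> carries the subspace topology. This makes
    \<open>eval_plot\<close> continuous into \<open>N\<close> on \<open>B\<close>, and the domain of
    a chart of \<open>N\<close> the trace of an open set of \<open>M\<close>.\<close>
  have Ntop: "mtop N = subtopology (mtop M) (mcarrier N)"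
    using emb homeomorphic_map_id[of "mtop N" "subtopology (mtop M) (mcarrier N)"]
    by (simp add: embedding_map_def id_def)
  obtain c d where c: "c \<in> charts_at K x" and d: "d \<in> charts_at M (P u x)" and z: "(u, x) \<in> adapted c d"
    using ex_adapted_charts[OF u x] .
  obtain e where e: "e \<in> charts_at N (P u x)"
    using smooth_manifoldD(3)[OF Nm True] by blast
  note cK = charts_atD(1)[OF K c] and dM = charts_atD(1)[OF M d] and eN = charts_atD[OF Nm e]
  obtain O' where O': "openin (mtop M) O'" "chart_dom e = O' \<inter> mcarrier N"
    using is_chartD(1)[OF eN(3)] Ntop by (metis openin_subtopology)
  define A where "A = {z \<in> adapted c d. eval_plot z \<in> O'}"
  have A: "openin total A"
    unfolding A_def by (intro openin_chart_domains[OF continuous_map_eval] openin_adapted cK dM O'(1))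
  define B where "B = {z \<in> A. eval_plot z \<in> mcarrier N}"
  have B: "z \<in> adapted c d" "eval_plot z \<in> chart_dom e" "eval_plot z \<in> chart_dom d" if "z \<in> B" for z
    using that O'(2) by (auto simp: B_def A_def adapted_def)
  let ?T = "subtopology total B"
  have cont1: "continuous_map ?T euclideanreal (\<lambda>z. chart_jac c d (P (fst z)) (snd z) j i)"
    if "j < chart_dim d" "i < chart_dim c" for j i
    using continuous_map_from_subtopology_mono[OF continuous_map_chart_jac[OF cK dM that], of B] B(1) by blast
  have cont2: "continuous_map ?T euclideanreal (\<lambda>z. chart_jac e d (\<lambda>y. y) (eval_plot z) j i)"
    if "j < chart_dim d" "i < chart_dim e" for j i
  proof -
    let ?D = "coord_dom e d (\<lambda>y. y)" and ?F = "coord_rep e d (\<lambda>y. y)"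
    have F: "euclidean_smooth_on (chart_dim e) (chart_dim d) ?D ?F"
      using smooth_mapD(2)[OF inc eN(1) dM] by (simp add: smooth_in_charts_def)
    have "continuous_map ?T (mtop M) eval_plot"
      by (rule continuous_map_from_subtopology[OF continuous_map_eval])
    then have "continuous_map ?T (mtop N) eval_plot"
      by (subst Ntop) (auto simp: continuous_map_in_subtopology B_def)
    then have "continuous_map ?T (subtopology (mtop N) (chart_dom e)) eval_plot"
      using B(2) by (auto simp: continuous_map_in_subtopology)
    from continuous_map_compose[OF this is_chartD(6)[OF eN(3)]]
    have "continuous_map ?T (subtopology (Euclidean_space (chart_dim e)) ?D) (\<lambda>z. chart_map e (eval_plot z))"
      using B(2,3) by (auto simp: continuous_map_in_subtopology o_def coord_dom_def)
    moreover have "continuous_map (subtopology (Euclidean_space (chart_dim e)) ?D) euclideanreal (\<lambda>y. jac ?F y j i)"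
      using euclidean_smooth_onD(7)[OF F that] euclidean_smooth_onD(2)[OF F]
      by (simp add: continuous_map_Euclidean_subtopology_iff)
    ultimately have "continuous_map ?T euclideanreal ((\<lambda>y. jac ?F y j i) \<circ> (\<lambda>z. chart_map e (eval_plot z)))"
      by (rule continuous_map_compose)
    then show ?thesis by (simp add: o_def chart_jac_def)
  qed
  let ?J = "\<lambda>z. mat_append (chart_dim c) (chart_jac c d (P (fst z)) (snd z)) (chart_jac e d (\<lambda>y. y) (eval_plot z))"
  define S where "S = {z \<in> topspace ?T. mat_surj (chart_dim d) (chart_dim c + chart_dim e) (?J z)}"
  have "openin ?T S"
    unfolding S_def
  proof (rule openin_mat_surj)
    fix j i assume ji: "j < chart_dim d" "i < chart_dim c + chart_dim e"
    show "continuous_map ?T euclideanreal (\<lambda>z. ?J z j i)"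
      using cont1[OF ji(1)] cont2[OF ji(1)] ji(2) by (cases "i < chart_dim c") (simp_all add: mat_append_def)
  qed
  \<comment> \<open>\<open>\<Theta>\<^sub>0\<close> is open in the whole product and meets
    \<open>B\<close> exactly in the good pairs; within \<open>A\<close>, being sent into
    \<open>N\<close> and lying in \<open>B\<close> are the same.\<close>
  then obtain \<Theta>\<^sub>0 where \<Theta>0: "openin total \<Theta>\<^sub>0" "S = \<Theta>\<^sub>0 \<inter> B"
    unfolding openin_subtopology by blast
  have iff: "{tangent_add (differential K M (P w) y v) (differential N M (\<lambda>y. y) (P w y) v') | v v'.
       v \<in> tangent_space K y \<and> v' \<in> tangent_space N (P w y)} = tangent_space M (P w y) \<longleftrightarrow>
      mat_surj (chart_dim d) (chart_dim c + chart_dim e) (?J (w, y))" if wy: "(w, y) \<in> B" for w y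
  proof -
    note at = adapted_charts_at[OF cK dM B(1)[OF wy]]
    have "e \<in> charts_at N (P w y)" using B(2)[OF wy] eN(1) by (simp add: charts_at_def)
    from tangent_sum_eq_iff[OF K Nm M smooth_map_P[OF at(1)] inc refl at(2) this at(3)]
    show ?thesis by simp
  qed
  have uB: "(u, x) \<in> B"
    using z True eN(2) O'(2) by (auto simp: B_def A_def)
  have "mat_surj (chart_dim d) (chart_dim c + chart_dim e) (?J (u, x))"
    by (rule iff[OF uB, THEN iffD1, OF mp[OF bspec[OF tr[unfolded transversal_def] x] True]])
  then have "(u, x) \<in> S"
    unfolding S_def by (intro CollectI conjI) (use u x uB in simp)
  then have "(u, x) \<in> \<Theta>\<^sub>0 \<inter> A"
    using uB unfolding \<Theta>0(2) B_def by blast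
  moreover have "openin total (\<Theta>\<^sub>0 \<inter> A)"
    using \<Theta>0(1) A by (rule openin_Int)
  moreover have "{tangent_add (differential K M (P w) y v) (differential N M (\<lambda>y. y) (P w y) v') | v v'.
       v \<in> tangent_space K y \<and> v' \<in> tangent_space N (P w y)} = tangent_space M (P w y)"
    if w: "(w, y) \<in> \<Theta>\<^sub>0 \<inter> A" "P w y \<in> mcarrier N" for w y
  proof (rule iff[THEN iffD2])
    show wB: "(w, y) \<in> B" using w by (simp add: B_def)
    have "(w, y) \<in> S" unfolding \<Theta>0(2) using wB w(1) by blast
    then show "mat_surj (chart_dim d) (chart_dim c + chart_dim e) (?J (w, y))"
      unfolding S_def mem_Collect_eq by (rule conjunct2)
  qed
  ultimately show ?thesis
    by (intro exI[of _ "\<Theta>\<^sub>0 \<inter> A"] conjI allI impI)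
qed

lemma ex_uniform_nbhd:
  assumes "compact_space (mtop K)" "u \<in> U"
    and "\<And>x. x \<in> mcarrier K \<Longrightarrow> \<exists>\<Theta>. openin total \<Theta> \<and> (u, x) \<in> \<Theta> \<and> (\<forall>w y. (w, y) \<in> \<Theta> \<longrightarrow> R w y)"
  obtains V where "openin param V" "u \<in> V" "V \<subseteq> U" "\<And>w x. w \<in> V \<Longrightarrow> x \<in> mcarrier K \<Longrightarrow> R w x"
proof -
  obtain V where V: "openin param V" "u \<in> V" "\<And>w x. w \<in> V \<Longrightarrow> x \<in> mcarrier K \<Longrightarrow> R w x"
    using tube_nbhd[OF assms(1), of u param R] assms(2,3) by auto
  moreover have "V \<subseteq> U" using openin_subset[OF V(1)] by simp
  ultimately show thesis using that by blast
qed

section \<open>Persistence of each property near a parameter\<close>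

lemma immersion_nbhd:
  assumes K_compact: "compact_space (mtop K)" and u: "u \<in> U" and "immersion K M (P u)"
  obtains V where "openin param V" "u \<in> V" "V \<subseteq> U" "\<And>w. w \<in> V \<Longrightarrow> immersion K M (P w)"
proof -
  have "inj_on (differential K M (P u) x) (tangent_space K x)" if "x \<in> mcarrier K" for x
    using assms(3) that by (simp add: immersion_def)
  then obtain V where V: "openin param V" "u \<in> V" "V \<subseteq> U"
    "\<And>w x. w \<in> V \<Longrightarrow> x \<in> mcarrier K \<Longrightarrow> inj_on (differential K M (P w) x) (tangent_space K x)"
    using ex_uniform_nbhd[OF K_compact u immersive_nbhd[OF u]] by blast
  then have "immersion K M (P w)" if "w \<in> V" for w
    using that smooth_map_P by (auto simp: immersion_def)
  then show thesis using that V by blast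
qed

lemma submersion_nbhd:
  assumes K_compact: "compact_space (mtop K)" and u: "u \<in> U" and "submersion K M (P u)"
  obtains V where "openin param V" "u \<in> V" "V \<subseteq> U" "\<And>w. w \<in> V \<Longrightarrow> submersion K M (P w)"
proof -
  have "differential K M (P u) x ` tangent_space K x = tangent_space M (P u x)" if "x \<in> mcarrier K" for x
    using assms(3) that by (simp add: submersion_def)
  then obtain V where V: "openin param V" "u \<in> V" "V \<subseteq> U"
    "\<And>w x. w \<in> V \<Longrightarrow> x \<in> mcarrier K \<Longrightarrow>
      differential K M (P w) x ` tangent_space K x = tangent_space M (P w x)"
    using ex_uniform_nbhd[OF K_compact u submersive_nbhd[OF u]] by blast
  have "submersion K M (P w)" if "w \<in> V" for w
    unfolding submersion_def using that V(3,4) smooth_map_P by blast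
  then show thesis using that V by blast
qed

lemma etale_nbhd:
  assumes K_compact: "compact_space (mtop K)" and u: "u \<in> U" and "etale_map K M (P u)"
  obtains V where "openin param V" "u \<in> V" "V \<subseteq> U" "\<And>w. w \<in> V \<Longrightarrow> etale_map K M (P w)"
proof -
  have "immersion K M (P u)" "submersion K M (P u)"
    using assms(3) etale_iff_immersion_submersion[OF K M] by blast+
  then obtain V V' where V: "openin param V" "u \<in> V" "V \<subseteq> U" "\<And>w. w \<in> V \<Longrightarrow> immersion K M (P w)"
    and V': "openin param V'" "u \<in> V'" "V' \<subseteq> U" "\<And>w. w \<in> V' \<Longrightarrow> submersion K M (P w)"
    using immersion_nbhd[OF K_compact u] submersion_nbhd[OF K_compact u] by metis
  show thesis
  proof
    show "openin param (V \<inter> V')" using V(1) V'(1) by (rule openin_Int)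
    show "etale_map K M (P w)" if "w \<in> V \<inter> V'" for w
      using that V(4) V'(4) etale_iff_immersion_submersion[OF K M] by blast
  qed (use V V' in auto)
qed

lemma transversal_open_nbhd:
  assumes K_compact: "compact_space (mtop K)" and u: "u \<in> U"
    and N: "closed_submanifold N M" and tr: "transversal K M N (P u)"
  obtains V where "openin param V" "u \<in> V" "V \<subseteq> U" "\<And>w. w \<in> V \<Longrightarrow> transversal K M N (P w)"
proof -
  obtain V where V: "openin param V" "u \<in> V" "V \<subseteq> U"
    "\<And>w x. w \<in> V \<Longrightarrow> x \<in> mcarrier K \<Longrightarrow> P w x \<in> mcarrier N \<longrightarrow>
      {tangent_add (differential K M (P w) x v) (differential N M (\<lambda>y. y) (P w x) v') | v v'.
         v \<in> tangent_space K x \<and> v' \<in> tangent_space N (P w x)} = tangent_space M (P w x)"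
    using ex_uniform_nbhd[OF K_compact u transversal_nbhd[OF N u _ tr]] by blast
  have "transversal K M N (P w)" if "w \<in> V" for w
    unfolding transversal_def by (intro ballI V(4)[OF that])
  then show thesis using that V by blast
qed

text \<open>At a diagonal point the immersion separates nearby points uniformly in the parameter.
  Off the diagonal the two values lie in disjoint open sets of \<open>M\<close>, and continuity of
  the evaluation keeps them there.\<close>

lemma injective_immersion_nbhd:
  assumes K_compact: "compact_space (mtop K)" and u: "u \<in> U"
    and im: "immersion K M (P u)" and inj: "inj_on (P u) (mcarrier K)"
  obtains V where "openin param V" "u \<in> V" "V \<subseteq> U" "\<And>w. w \<in> V \<Longrightarrow> inj_on (P w) (mcarrier K)"
proof -
  let ?KK = "prod_topology (mtop K) (mtop K)"
  let ?Z = "prod_topology param ?KK"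
  have c1: "continuous_map ?Z total (\<lambda>z. (fst z, fst (snd z)))"
    and c2: "continuous_map ?Z total (\<lambda>z. (fst z, snd (snd z)))"
    by (auto intro!: continuous_map_pairedI continuous_map_fst
        continuous_map_compose[OF continuous_map_snd continuous_map_fst, unfolded o_def]
        continuous_map_compose[OF continuous_map_snd continuous_map_snd, unfolded o_def])
  have e1: "continuous_map ?Z (mtop M) (\<lambda>z. P (fst z) (fst (snd z)))"
    and e2: "continuous_map ?Z (mtop M) (\<lambda>z. P (fst z) (snd (snd z)))"
    using continuous_map_compose[OF c1 continuous_map_eval] continuous_map_compose[OF c2 continuous_map_eval]
    by (simp_all add: o_def)
  have nbhd: "\<exists>\<Theta>. openin ?Z \<Theta> \<and> (u, y) \<in> \<Theta> \<and>
      (\<forall>w z. (w, z) \<in> \<Theta> \<longrightarrow> P w (fst z) = P w (snd z) \<longrightarrow> fst z = snd z)"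
    if y: "y \<in> topspace ?KK" for y
  proof -
    obtain x x' where y_eq: "y = (x, x')" and x: "x \<in> mcarrier K" and x': "x' \<in> mcarrier K"
      using y by auto
    show ?thesis
    proof (cases "x = x'")
      case True
      obtain c d where c: "c \<in> charts_at K x" and d: "d \<in> charts_at M (P u x)" and z: "(u, x) \<in> adapted c d"
        using ex_adapted_charts[OF u x] .
      have "mat_inj (chart_dim d) (chart_dim c) (chart_jac c d (P u) x)"
        using im x differential_inj_iff[OF K M smooth_map_P[OF u] c d] by (simp add: immersion_def)
      then obtain \<Theta> where \<Theta>: "openin total \<Theta>" "(u, x) \<in> \<Theta>"
        "\<And>w y y'. (w, y) \<in> \<Theta> \<Longrightarrow> (w, y') \<in> \<Theta> \<Longrightarrow> P w y = P w y' \<Longrightarrow> y = y'"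
        using fibrewise_locally_injective[OF charts_atD(1)[OF K c] charts_atD(1)[OF M d] z] by blast
      let ?A = "{z \<in> topspace ?Z. (fst z, fst (snd z)) \<in> \<Theta>} \<inter> {z \<in> topspace ?Z. (fst z, snd (snd z)) \<in> \<Theta>}"
      have "openin ?Z ?A"
        by (intro openin_Int openin_continuous_map_preimage[OF c1 \<Theta>(1)] openin_continuous_map_preimage[OF c2 \<Theta>(1)])
      moreover have "(u, y) \<in> ?A" using \<Theta>(2) True u x by (simp add: y_eq)
      moreover have "fst z = snd z" if "(w, z) \<in> ?A" "P w (fst z) = P w (snd z)" for w z
        using \<Theta>(3)[of w "fst z" "snd z"] that by simp
      ultimately show ?thesis by (intro exI[of _ ?A] conjI allI impI)
    next
      case False
      then have "P u x \<noteq> P u x'" using inj x x' by (auto dest: inj_onD)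
      moreover have "P u x \<in> mcarrier M" "P u x' \<in> mcarrier M"
        using smooth_mapD(3)[OF smooth_map_P[OF u]] x x' by blast+
      ultimately obtain A B where AB: "openin (mtop M) A" "openin (mtop M) B" "P u x \<in> A" "P u x' \<in> B" "disjnt A B"
        using smooth_manifoldD(1)[OF M] unfolding Hausdorff_space_def by blast
      let ?A = "{z \<in> topspace ?Z. P (fst z) (fst (snd z)) \<in> A} \<inter> {z \<in> topspace ?Z. P (fst z) (snd (snd z)) \<in> B}"
      have "openin ?Z ?A"
        by (intro openin_Int openin_continuous_map_preimage[OF e1 AB(1)] openin_continuous_map_preimage[OF e2 AB(2)])
      moreover have "(u, y) \<in> ?A" using AB(3,4) u x x' by (simp add: y_eq)
      moreover have "fst z = snd z" if "(w, z) \<in> ?A" "P w (fst z) = P w (snd z)" for w z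
        using that AB(5) by (auto simp: disjnt_iff)
      ultimately show ?thesis by (intro exI[of _ ?A] conjI allI impI)
    qed
  qed
  have KK: "compact_space ?KK" using K_compact by (simp add: compact_space_prod_topology)
  have "u \<in> topspace param" using u by simp
  from tube_nbhd[OF KK this nbhd]
  obtain V where V: "openin param V" "u \<in> V"
    "\<And>w y. w \<in> V \<Longrightarrow> y \<in> topspace ?KK \<Longrightarrow> P w (fst y) = P w (snd y) \<longrightarrow> fst y = snd y"
    by blast
  have "inj_on (P w) (mcarrier K)" if "w \<in> V" for w
    using V(3)[OF that, of "(_, _)"] by (intro inj_onI) simp
  moreover have "V \<subseteq> U" using openin_subset[OF V(1)] by simp
  ultimately show thesis using that V by blast
qed

lemma embedding_nbhd:
  assumes K_compact: "compact_space (mtop K)" and u: "u \<in> U" and emb: "embedding K M (P u)"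
  obtains V where "openin param V" "u \<in> V" "V \<subseteq> U" "\<And>w. w \<in> V \<Longrightarrow> embedding K M (P w)"
proof -
  have im: "immersion K M (P u)" and em: "embedding_map (mtop K) (mtop M) (P u)"
    using emb by (auto simp: embedding_def)
  have inj: "inj_on (P u) (mcarrier K)"
    using em homeomorphic_imp_injective_map unfolding embedding_map_def by blast
  obtain V where V: "openin param V" "u \<in> V" "V \<subseteq> U" "\<And>w. w \<in> V \<Longrightarrow> immersion K M (P w)"
    using immersion_nbhd[OF K_compact u im] by blast
  obtain V' where V': "openin param V'" "u \<in> V'" "V' \<subseteq> U" "\<And>w. w \<in> V' \<Longrightarrow> inj_on (P w) (mcarrier K)"
    using injective_immersion_nbhd[OF K_compact u im inj] by blast
  show thesis
  proof
    show "openin param (V \<inter> V')" using V(1) V'(1) by (rule openin_Int)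
    show "embedding K M (P w)" if w: "w \<in> V \<inter> V'" for w
    proof -
      have cont: "continuous_map (mtop K) (mtop M) (P w)"
        using w V(3) by (intro smooth_mapD(1) smooth_map_P) blast
      \<comment> \<open>A continuous map from a compact to a Hausdorff space is closed, and a closed
        continuous injection is a homeomorphism onto its image.\<close>
      then have "closed_map (mtop K) (mtop M) (P w)"
        using K_compact smooth_manifoldD(1)[OF M] by (intro T1_Spaces.continuous_imp_closed_map)
      then have "embedding_map (mtop K) (mtop M) (P w)"
        using cont V'(4) w by (intro injective_closed_imp_embedding_map) auto
      then show ?thesis using V(4) w by (simp add: embedding_def)
    qed
  qed (use V V' in auto)
qed

text \<open>Closedness comes from compactness of \<open>K\<close> and the Hausdorff property of
  \<open>M\<close>; openness is local.\<close>

lemma etale_clopen_image: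
  assumes K_compact: "compact_space (mtop K)" and f: "etale_map K M f"
  shows "openin (mtop M) (f ` mcarrier K)" "closedin (mtop M) (f ` mcarrier K)"
proof -
  have cont: "continuous_map (mtop K) (mtop M) f"
    using f by (auto simp: etale_map_def dest: smooth_mapD(1))
  have "compactin (mtop M) (f ` mcarrier K)"
    using K_compact cont unfolding compact_space_def by (rule image_compactin)
  then show "closedin (mtop M) (f ` mcarrier K)"
    using smooth_manifoldD(1)[OF M] by (intro compactin_imp_closedin)
  show "openin (mtop M) (f ` mcarrier K)"
  proof (subst openin_subopen, intro ballI)
    fix y assume "y \<in> f ` mcarrier K"
    then obtain x where x: "x \<in> mcarrier K" "y = f x" by blast
    then obtain W where "openin (mtop K) W" "x \<in> W" "openin (mtop M) (f ` W)"
      using f unfolding etale_map_def by blast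
    then show "\<exists>T. openin (mtop M) T \<and> y \<in> T \<and> T \<subseteq> f ` mcarrier K"
      using x openin_subset by (intro exI[of _ "f ` W"]) blast
  qed
qed

text \<open>The image of an etale map on a compact manifold is open and closed, so it contains every
  connected set that it meets.\<close>

lemma surjective_etale_nbhd:
  assumes K_compact: "compact_space (mtop K)" and u: "u \<in> U"
    and et: "etale_map K M (P u)" and surj: "P u ` mcarrier K = mcarrier M"
  obtains V where "openin param V" "u \<in> V" "V \<subseteq> U" "\<And>w. w \<in> V \<Longrightarrow> etale_map K M (P w)"
    "\<And>w. w \<in> V \<Longrightarrow> P w ` mcarrier K = mcarrier M"
proof -
  obtain V where V: "openin param V" "u \<in> V" "V \<subseteq> U" "\<And>w. w \<in> V \<Longrightarrow> etale_map K M (P w)"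
    using etale_nbhd[OF K_compact u et] by blast
  \<comment> \<open>The condition speaks of \<open>P u y\<close>, so that letting \<open>y\<close>
    range over the compact \<open>K\<close> reaches all of \<open>M\<close>, by surjectivity of
    \<open>P u\<close>.\<close>
  have nbhd: "\<exists>\<Theta>. openin total \<Theta> \<and> (u, x) \<in> \<Theta> \<and>
      (\<forall>w y. (w, y) \<in> \<Theta> \<longrightarrow> w \<in> V \<and> P u y \<in> P w ` mcarrier K)" if x: "x \<in> mcarrier K" for x
  proof -
    have "P u x \<in> mcarrier M" using smooth_mapD(3)[OF smooth_map_P[OF u] x] .
    then obtain W where W: "openin (mtop M) W" "P u x \<in> W" "connectedin (mtop M) W"
      using ex_connected_nbhd[OF M] by blast
    have "continuous_map total total (\<lambda>z. (fst z, x))"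
      using x by (intro continuous_map_pairedI continuous_map_fst) simp
    from continuous_map_compose[OF this continuous_map_eval]
    have 1: "continuous_map total (mtop M) (\<lambda>z. P (fst z) x)" by (simp add: o_def)
    from continuous_map_compose[OF continuous_map_snd smooth_mapD(1)[OF smooth_map_P[OF u]]]
    have 2: "continuous_map total (mtop M) (\<lambda>z. P u (snd z))" by (simp add: o_def)
    \<comment> \<open>In the second condition \<open>x\<close> stays fixed, so the image of
      \<open>P w\<close> meets \<open>W\<close> and hence contains it; the third condition places
      \<open>P u y\<close> in \<open>W\<close>.\<close>
    let ?\<Theta> = "{z \<in> topspace total. fst z \<in> V} \<inter> {z \<in> topspace total. P (fst z) x \<in> W}
      \<inter> {z \<in> topspace total. P u (snd z) \<in> W}"
    have "openin total ?\<Theta>"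
      by (intro openin_Int openin_continuous_map_preimage[OF continuous_map_fst V(1)]
          openin_continuous_map_preimage[OF 1 W(1)] openin_continuous_map_preimage[OF 2 W(1)])
    moreover have "(u, x) \<in> ?\<Theta>" using u x V(2) W(2) by simp
    moreover have "w \<in> V \<and> P u y \<in> P w ` mcarrier K" if wy: "(w, y) \<in> ?\<Theta>" for w y
    proof -
      have w: "w \<in> V" "P w x \<in> W" "P u y \<in> W" using wy by auto
      note clopen = etale_clopen_image[OF K_compact V(4)[OF w(1)]]
      have "P w x \<in> P w ` mcarrier K" using x by blast
      then have "W \<subseteq> P w ` mcarrier K"
        using connectedin_clopen_cases[OF W(3) clopen(2,1)] w(2) by (auto simp: disjnt_iff)
      then show ?thesis using w by blast
    qed
    ultimately show ?thesis by (intro exI[of _ ?\<Theta>] conjI allI impI) blast+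
  qed
  obtain V' where V': "openin param V'" "u \<in> V'" "V' \<subseteq> U"
    "\<And>w x. w \<in> V' \<Longrightarrow> x \<in> mcarrier K \<Longrightarrow> w \<in> V \<and> P u x \<in> P w ` mcarrier K"
    using ex_uniform_nbhd[OF K_compact u nbhd] by blast
  show thesis
  proof
    show "openin param (V \<inter> V')" using V(1) V'(1) by (rule openin_Int)
    fix w assume w: "w \<in> V \<inter> V'"
    show "etale_map K M (P w)" using V(4) w by blast
    have "smooth_map K M (P w)" using w V(3) smooth_map_P by blast
    from smooth_mapD(3)[OF this] have "P w ` mcarrier K \<subseteq> mcarrier M" by blast
    moreover have "mcarrier M \<subseteq> P w ` mcarrier K"
      unfolding surj[symmetric] using V'(4) w by blast
    ultimately show "P w ` mcarrier K = mcarrier M" by blast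
  qed (use V V' in auto)
qed

text \<open>The inverses of the maps \<open>P w\<close> are not followed along the plot:
  injectivity, surjectivity and regularity persist, and together they give back a smooth inverse for
  each \<open>w\<close>.\<close>

lemma diffeomorphism_nbhd:
  assumes K_compact: "compact_space (mtop K)" and u: "u \<in> U" and dif: "diffeomorphism K M (P u)"
  obtains V where "openin param V" "u \<in> V" "V \<subseteq> U" "\<And>w. w \<in> V \<Longrightarrow> diffeomorphism K M (P w)"
proof -
  have reg: "regular_in_charts K M (P u) x" if "x \<in> mcarrier K" for x
    using diffeomorphism_imp_regular[OF K M dif that] .
  have "inj_on (differential K M (P u) x) (tangent_space K x) \<and>
      differential K M (P u) x ` tangent_space K x = tangent_space M (P u x)" if x: "x \<in> mcarrier K" for x
  proof -
    obtain c d where c: "c \<in> charts_at K x" and d: "d \<in> charts_at M (P u x)"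
      using ex_adapted_charts[OF u x] by blast
    then show ?thesis
      using reg[OF x] differential_inj_iff[OF K M smooth_map_P[OF u] c d]
        differential_surj_iff[OF K M smooth_map_P[OF u] c d]
      unfolding regular_in_charts_def by blast
  qed
  then have im: "immersion K M (P u)" and sub: "submersion K M (P u)"
    using smooth_map_P[OF u] by (auto simp: immersion_def submersion_def)
  then have et: "etale_map K M (P u)"
    using etale_iff_immersion_submersion[OF K M] by blast
  obtain g where g: "smooth_map M K g" "\<And>x. x \<in> mcarrier K \<Longrightarrow> g (P u x) = x"
    "\<And>y. y \<in> mcarrier M \<Longrightarrow> P u (g y) = y"
    using dif unfolding diffeomorphism_def by blast
  have inj: "inj_on (P u) (mcarrier K)"
    using g(2) by (rule inj_on_inverseI)
  have surj: "P u ` mcarrier K = mcarrier M"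
  proof
    show "P u ` mcarrier K \<subseteq> mcarrier M" using smooth_mapD(3)[OF smooth_map_P[OF u]] by blast
    show "mcarrier M \<subseteq> P u ` mcarrier K"
    proof
      fix y assume y: "y \<in> mcarrier M"
      show "y \<in> P u ` mcarrier K"
        using g(3)[OF y, symmetric] smooth_mapD(3)[OF g(1) y] by (rule image_eqI)
    qed
  qed
  obtain V where V: "openin param V" "u \<in> V" "V \<subseteq> U" "\<And>w. w \<in> V \<Longrightarrow> inj_on (P w) (mcarrier K)"
    using injective_immersion_nbhd[OF K_compact u im inj] by blast
  obtain V' where V': "openin param V'" "u \<in> V'" "V' \<subseteq> U" "\<And>w. w \<in> V' \<Longrightarrow> etale_map K M (P w)"
    "\<And>w. w \<in> V' \<Longrightarrow> P w ` mcarrier K = mcarrier M"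
    using surjective_etale_nbhd[OF K_compact u et surj] by blast
  show thesis
  proof
    show "openin param (V \<inter> V')" using V(1) V'(1) by (rule openin_Int)
    show "diffeomorphism K M (P w)" if w: "w \<in> V \<inter> V'" for w
    proof (rule regular_bijection_imp_diffeomorphism[OF K M])
      show "smooth_map K M (P w)" using w V(3) smooth_map_P by blast
      have imsub: "immersion K M (P w)" "submersion K M (P w)"
        using V'(4) w etale_iff_immersion_submersion[OF K M] by blast+
      show "regular_in_charts K M (P w) x" if "x \<in> mcarrier K" for x
        by (rule immersion_submersion_imp_regular[OF K M imsub that])
      show "bij_betw (P w) (mcarrier K) (mcarrier M)"
        using V(4) V'(5) w by (auto simp: bij_betw_def)
    qed
  qed (use V V' in auto)
qed

end

lemma D_open_smooth_maps:
  assumes K: "smooth_manifold K" and M: "smooth_manifold M"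
    and nbhd: "\<And>n U P u. functional_plot K M n U P \<Longrightarrow> u \<in> U \<Longrightarrow> Q (P u) \<Longrightarrow>
      \<exists>V. openin (subtopology (Euclidean_space n) U) V \<and> u \<in> V \<and> V \<subseteq> U \<and> (\<forall>w\<in>V. Q (P w))"
  shows "D_open (smooth_maps K M) (functional_diffeology K M) {f \<in> smooth_maps K M. Q f}"
proof (rule D_openI)
  fix n U P assume "(n, U, P) \<in> functional_diffeology K M"
  then interpret functional_plot K M n U P
    using K M by unfold_locales
  show "openin (Euclidean_space n) U" by (rule openin_U)
  fix u assume u: "u \<in> U" "P u \<in> {f \<in> smooth_maps K M. Q f}"
  then obtain V where "openin param V" "u \<in> V" "V \<subseteq> U" "\<forall>w\<in>V. Q (P w)"
    using nbhd[OF functional_plot_axioms u(1)] by blast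
  then show "\<exists>V. openin param V \<and> u \<in> V \<and> (\<forall>w\<in>V. P w \<in> {f \<in> smooth_maps K M. Q f})"
    using smooth_maps_P by blast
qed blast

theorem theorem1p8:
  fixes K :: "'a manifold" and M :: "'b manifold"
  assumes "smooth_manifold K" and "compact_space (mtop K)" and "smooth_manifold M"
  defines "C \<equiv> smooth_maps K M" and "\<D> \<equiv> functional_diffeology K M"
  shows "D_open C \<D> {f \<in> C. diffeomorphism K M f} \<and>
    D_open C \<D> {f \<in> C. etale_map K M f} \<and>
    D_open C \<D> {f \<in> C. submersion K M f} \<and>
    D_open C \<D> {f \<in> C. immersion K M f} \<and>
    D_open C \<D> {f \<in> C. embedding K M f} \<and>
    (\<forall>N. closed_submanifold N M \<longrightarrow> D_open C \<D> {f \<in> C. transversal K M N f})"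
  unfolding C_def \<D>_def
proof (intro conjI allI impI)
  note D_open = D_open_smooth_maps[OF assms(1,3)]
  show "D_open (smooth_maps K M) (functional_diffeology K M) {f \<in> smooth_maps K M. diffeomorphism K M f}"
    by (rule D_open) (meson functional_plot.diffeomorphism_nbhd[OF _ assms(2)])
  show "D_open (smooth_maps K M) (functional_diffeology K M) {f \<in> smooth_maps K M. etale_map K M f}"
    by (rule D_open) (meson functional_plot.etale_nbhd[OF _ assms(2)])
  show "D_open (smooth_maps K M) (functional_diffeology K M) {f \<in> smooth_maps K M. submersion K M f}"
    by (rule D_open) (meson functional_plot.submersion_nbhd[OF _ assms(2)])
  show "D_open (smooth_maps K M) (functional_diffeology K M) {f \<in> smooth_maps K M. immersion K M f}"
    by (rule D_open) (meson functional_plot.immersion_nbhd[OF _ assms(2)])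
  show "D_open (smooth_maps K M) (functional_diffeology K M) {f \<in> smooth_maps K M. embedding K M f}"
    by (rule D_open) (meson functional_plot.embedding_nbhd[OF _ assms(2)])
  fix N assume N: "closed_submanifold N M"
  show "D_open (smooth_maps K M) (functional_diffeology K M) {f \<in> smooth_maps K M. transversal K M N f}"
    by (rule D_open) (meson functional_plot.transversal_open_nbhd[OF _ assms(2) _ N])
qed

end
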